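(* Let $\mu$ be an infinitely divisible distribution on $\mathbb R$ with Lévy measure $\nu$, and let $\nu_{(1)}(dx)=\mathbf 1_{(1,\infty)}(x)\,\nu(dx)/\nu((1,\infty))$. Then the following are equivalent: (i) $\mu\in\mathcal S_{loc}\cap\mathcal D_{loc}$; (ii) $\nu_{(1)}\in\mathcal S_{loc}\cap\mathcal D_{loc}$; (iii) $\nu_{(1)}\in\mathcal L_{loc}\cap\mathcal D_{loc}$ and $\mu(x+\Delta)\sim\nu(x+\Delta)$ for every $\Delta=(0,c]$, $c>0$.
   Context: An infinitely divisible distribution $\mu$ on $\mathbb R$ has characteristic function $\widehat\mu(z)=\exp\{\int_{-\infty}^\infty(e^{izy}-1-izy\mathbf 1_{\{|y|\le1\}})\nu(dy)+iaz-\frac12b^2z^2\}$ with $a\in\mathbb R$, $b\ge0$ and Lévy measure $\nu$ satisfying $\nu(\{0\})=0$, $\int(1\wedge x^2)\nu(dx)<\infty$. An assertion that $\nu_{(1)}$ belongs to a class includes $\nu((1,\infty))>0$, so that $\nu_{(1)}$ is defined. For $\Delta=(0,c]$ and a measure $F$, $F(x+\Delta):=F((x,x+c])$. $F^{*n}$ is the $n$-fold convolution. $\alpha(x)\sim\beta(x)$ means $\alpha(x)/\beta(x)\to1$ as $x\to\infty$. A non-negative measurable function $\alpha$ belongs to $\mathcal L$ if there is $x_0>0$ with $\alpha(x)>0$ for $x\ge x_0$ and, for every fixed $y>0$, $\alpha(x+y)\sim\alpha(x)$. A distribution $F$ is in $\mathcal L_\Delta$ if the function $x\mapsto F(x+\Delta)$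 is in $\mathcal L$. $F\in\mathcal S_\Delta$ if $F\in\mathcal L_\Delta$ and $F^{*2}(x+\Delta)\sim 2F(x+\Delta)$. A function $\alpha:\mathbb R\to\mathbb R_+$ is almost decreasing if there exist $x_0>0$ and $K>0$ such that $\alpha(x+y)\le K\alpha(x)$ for all $x>x_0$, $y>0$. $F\in\mathcal D_\Delta$ if $x\mapsto F(x+\Delta)$ is almost decreasing. $F\in\mathcal L_{loc}$ (resp. $\mathcal S_{loc}$, $\mathcal D_{loc}$) if $F\in\mathcal L_\Delta$ (resp. $\mathcal S_\Delta$, $\mathcal D_\Delta$) for all $\Delta=(0,c]$ with $c>0$. *)

theory Defs
  imports "HOL-Probability.Probability" "HOL-Library.Landau_Symbols"
begin

section \<open>Infinitely divisible distributions\<close>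

primrec conv_power :: "real measure \<Rightarrow> nat \<Rightarrow> real measure" where
  "conv_power F 0 = return borel 0"
| "conv_power F (Suc n) = (F \<star> conv_power F n)"

definition infinitely_divisible :: "real measure \<Rightarrow> bool" where
  "infinitely_divisible \<mu> \<longleftrightarrow> real_distribution \<mu> \<and>
     (\<forall>n\<ge>1. \<exists>\<rho>. real_distribution \<rho> \<and> \<mu> = conv_power \<rho> n)"

definition levy_measure :: "real measure \<Rightarrow> bool" where
  "levy_measure \<nu> \<longleftrightarrow> sets \<nu> = sets borel \<and> emeasure \<nu> {0} = 0 \<and>
     (\<integral>\<^sup>+ x. ennreal (min 1 (x\<^sup>2)) \<partial>\<nu>) < \<infinity>"

text \<open>The integrand is bounded by a constant multiple (depending on \<open>z\<close>) of \<open>min 1 (y\<^sup>2)\<close>,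
  so the Bochner integral is a genuine one for every Levy measure.\<close>

definition levy_khintchine_exponent ::
    "real \<Rightarrow> real \<Rightarrow> real measure \<Rightarrow> real \<Rightarrow> complex" where
  "levy_khintchine_exponent a b \<nu> z =
     (CLINT y|\<nu>. iexp (z * y) - 1 - \<i> * of_real (z * y * indicator {-1..1} y))
       + \<i> * of_real (a * z) - of_real (b\<^sup>2 * z\<^sup>2 / 2)"

definition has_levy_measure :: "real measure \<Rightarrow> real measure \<Rightarrow> bool" where
  "has_levy_measure \<mu> \<nu> \<longleftrightarrow> levy_measure \<nu> \<and>
     (\<exists>a b. b \<ge> 0 \<and> (\<forall>z. char \<mu> z = exp (levy_khintchine_exponent a b \<nu> z)))"

text \<open>The normalised restriction to \<open>(1, \<infinity>)\<close>. It is the zero measure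
  when \<open>\<nu>\<close> does not charge \<open>(1, \<infinity>)\<close>.\<close>

definition levy_tail :: "real measure \<Rightarrow> real measure" where
  "levy_tail \<nu> = uniform_measure \<nu> {1<..}"


section \<open>Local subexponentiality\<close>

text \<open>The value \<open>F(x + \<Delta>)\<close> for \<open>\<Delta> = (0, c]\<close>. For an infinite Levy measure this is
  only guaranteed to be the true mass when \<open>(x, x + c]\<close> stays away from \<open>0\<close>, for instance
  for all \<open>x > 0\<close>.\<close>

definition local_mass :: "real measure \<Rightarrow> real \<Rightarrow> real \<Rightarrow> real" where
  "local_mass F c x = measure F {x<..x + c}"

text \<open>All asymptotic equivalences below have an eventually positive right-hand side,
  so \<open>f \<sim>[at_top] g\<close> means that \<open>f x / g x\<close> tends to \<open>1\<close>.\<close>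

definition long_tailed_fun :: "(real \<Rightarrow> real) \<Rightarrow> bool" where
  "long_tailed_fun \<alpha> \<longleftrightarrow> \<alpha> \<in> borel_measurable borel \<and> (\<forall>x. 0 \<le> \<alpha> x) \<and>
     (\<exists>x0>0. \<forall>x\<ge>x0. 0 < \<alpha> x) \<and>
     (\<forall>y>0. (\<lambda>x. \<alpha> (x + y)) \<sim>[at_top] \<alpha>)"

definition almost_decreasing :: "(real \<Rightarrow> real) \<Rightarrow> bool" where
  "almost_decreasing \<alpha> \<longleftrightarrow> (\<forall>x. 0 \<le> \<alpha> x) \<and>
     (\<exists>x0>0. \<exists>K>0. \<forall>x>x0. \<forall>y>0. \<alpha> (x + y) \<le> K * \<alpha> x)"

definition L_Delta :: "real \<Rightarrow> real measure set" where
  "L_Delta c = {F. real_distribution F \<and> long_tailed_fun (local_mass F c)}"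

definition S_Delta :: "real \<Rightarrow> real measure set" where
  "S_Delta c = {F \<in> L_Delta c. local_mass (F \<star> F) c \<sim>[at_top] (\<lambda>x. 2 * local_mass F c x)}"

definition D_Delta :: "real \<Rightarrow> real measure set" where
  "D_Delta c = {F. real_distribution F \<and> almost_decreasing (local_mass F c)}"

definition L_loc :: "real measure set" where
  "L_loc = (\<Inter>c\<in>{0<..}. L_Delta c)"

definition S_loc :: "real measure set" where
  "S_loc = (\<Inter>c\<in>{0<..}. S_Delta c)"

definition D_loc :: "real measure set" where
  "D_loc = (\<Inter>c\<in>{0<..}. D_Delta c)"

end

theory Submission
  imports Defs
begin

text \<open>
  The proof rests on the principle of a single big jump. Let the local masses of a distribution \<open>R\<close> be long-tailed
  and almost decreasing. The convolution square of \<open>R\<close> charges a distant window either by one jump of size at most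
  \<open>A\<close> and a second one of about the size of the total, or by two jumps exceeding \<open>A\<close>. The first contribution
  converges by dominated convergence, since \<open>local_mass R c (x - s)\<close> is at most \<open>C * (1 + exp s) * local_mass R c x\<close>
  (lemma \<open>shift_domination\<close>): slow decay covers positive \<open>s\<close>, almost monotonicity covers negative \<open>s\<close>. Local
  subexponentiality therefore says exactly that two big jumps are negligible (lemma \<open>local_subexponential_iff\<close>), a
  property shared by all distributions with proportional local masses (lemma \<open>local_class_transfer\<close>).

  Let \<open>\<mu>\<close> be infinitely divisible with Levy measure \<open>\<nu>\<close>. For every threshold \<open>A\<close>, \<open>\<mu>\<close> is the convolution of the
  compound Poisson law of the jumps above \<open>A\<close> with a factor \<open>N\<close> that has an exponential moment (lemma
  \<open>positive_jumps_decomposition\<close>). If two big jumps are negligible, the compound Poisson law contributes to distant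
  local masses essentially through its part with a single jump, with an error that vanishes as \<open>A\<close> grows
  (lemma \<open>one_big_jump_principle\<close>). At the same time the rate \<open>measure \<nu> {A<..}\<close> tends to \<open>0\<close>. This settles the three
  implications that matter.

  If the Levy tail is locally subexponential, its long-tailedness makes the factor \<open>N\<close> invisible, and \<open>\<mu>\<close> and \<open>\<nu>\<close>
  are locally equivalent; by transfer, \<open>\<mu>\<close> is locally subexponential as well.

  If \<open>\<mu>\<close> and \<open>\<nu>\<close> are locally equivalent and the Levy tail is long-tailed, the single jumps exhaust the local
  mass of \<open>\<mu>\<close>. So two jumps smoothed by \<open>N\<close> are negligible, and the smoothing can be undone because
  only the order of magnitude matters: a window of double length absorbs it.

  If \<open>\<mu>\<close> is locally subexponential, the principle shows no more than that the convolution of \<open>\<nu>\<close> with \<open>N\<close>, and in the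
  limit with \<open>\<mu>\<close>, is locally equivalent to \<open>\<mu>\<close>. Undoing this convolution is a Tauberian problem. The measures
  \<open>\<nu>\<close> seen from a distant point and divided by the local mass of \<open>\<mu>\<close> have cluster points by Helly's theorem. The
  increments of a cluster point, less those of Lebesgue measure, form a bounded function annihilated by
  convolution with \<open>\<mu>\<close> (lemma \<open>cluster_point_equation\<close>). As the characteristic function of an infinitely divisible law
  has no zeros, such a function vanishes (lemma \<open>deconvolution_infinitely_divisible\<close>): after a contraction argument
  has removed the large jumps, the characteristic function is smooth and decays no faster than a Gaussian, so that it
  can be divided out of a narrow Gaussian. Hence Lebesgue measure is the only cluster point, which is the local
  equivalence of \<open>\<nu>\<close> and \<open>\<mu>\<close>.
\<close>

section \<open>Long-tailed almost decreasing functions\<close>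

lemma filterlim_shift_at_top: "filterlim (\<lambda>x::real. x + s) at_top at_top"
  using filterlim_tendsto_add_at_top[OF tendsto_const[of s] filterlim_ident] by (simp add: add.commute)

lemma asymp_equiv_ratio:
  fixes f g :: "real \<Rightarrow> real"
  assumes "f \<sim>[at_top] g" "\<forall>\<^sub>F x in at_top. 0 < g x"
  shows "((\<lambda>x. f x / g x) \<longlongrightarrow> 1) at_top"
  using asymp_equivD[OF assms(1)]
  by (rule Lim_transform_eventually) (use assms(2) in eventually_elim, auto)

lemma long_tailed_fun_pos:
  assumes "long_tailed_fun \<phi>"
  shows "\<forall>\<^sub>F x in at_top. 0 < \<phi> x"
  using assms unfolding long_tailed_fun_def eventually_at_top_linorder by blast

lemma long_tailed_fun_shift:
  assumes "long_tailed_fun \<phi>"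
  shows "((\<lambda>x. \<phi> (x + s) / \<phi> x) \<longlongrightarrow> 1) at_top"
proof -
  note pos = long_tailed_fun_pos[OF assms]
  have up: "((\<lambda>x. \<phi> (x + y) / \<phi> x) \<longlongrightarrow> 1) at_top" if "y > 0" for y
    using assms that pos unfolding long_tailed_fun_def by (intro asymp_equiv_ratio) auto
  consider "s > 0" | "s = 0" | "s < 0" by linarith
  then show ?thesis
  proof cases
    case 1 then show ?thesis by (rule up)
  next
    case 2
    then show ?thesis using pos
      by (intro tendsto_eventually) (auto elim!: eventually_mono)
  next
    case 3
    have "((\<lambda>x. \<phi> ((x + s) + (-s)) / \<phi> (x + s)) \<longlongrightarrow> 1) at_top"
      using up[of "-s"] 3 by (intro filterlim_compose[OF _ filterlim_shift_at_top]) auto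
    then have "((\<lambda>x. inverse (\<phi> x / \<phi> (x + s))) \<longlongrightarrow> inverse 1) at_top"
      by (intro tendsto_inverse) auto
    then show ?thesis by (simp add: field_simps)
  qed
qed

text \<open>Long-tailedness makes \<open>\<phi>\<close> decay more slowly than any exponential; the rate
  \<open>1\<close> is the one that is compared with. The almost decreasing property transports the comparison, which iteration yields for
  integer shifts only, to all shifts.\<close>

lemma long_tailed_growth:
  assumes lt: "long_tailed_fun \<phi>" and ad: "almost_decreasing \<phi>"
  obtains x1 K where "K \<ge> 1" "x1 > 0" "\<And>u. u \<ge> x1 \<Longrightarrow> 0 < \<phi> u"
    "\<And>u t. u \<ge> x1 \<Longrightarrow> t \<ge> 0 \<Longrightarrow> \<phi> (u + t) \<le> K * \<phi> u"
    "\<And>u t. u \<ge> x1 \<Longrightarrow> t \<ge> 0 \<Longrightarrow> \<phi> u \<le> K * exp t * \<phi> (u + t)"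
proof -
  from ad obtain a K0 where K0: "a > 0" "K0 > 0" "\<And>x y. x > a \<Longrightarrow> y > 0 \<Longrightarrow> \<phi> (x + y) \<le> K0 * \<phi> x"
    and nn: "\<And>x. 0 \<le> \<phi> x"
    unfolding almost_decreasing_def by blast
  from lt obtain b where b: "b > 0" "\<And>x. x \<ge> b \<Longrightarrow> 0 < \<phi> x" unfolding long_tailed_fun_def by blast
  have "\<forall>\<^sub>F x in at_top. \<phi> (x + 1) / \<phi> x > exp (-1)"
    by (rule order_tendstoD(1)[OF long_tailed_fun_shift[OF lt]]) auto
  then obtain d where d: "\<And>x. x \<ge> d \<Longrightarrow> \<phi> (x + 1) / \<phi> x > exp (-1)"
    unfolding eventually_at_top_linorder by blast
  define x1 where "x1 = max (max (a + 1) b) d"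
  define K where "K = max 1 (K0 * exp 1)"
  have step: "\<phi> u \<le> exp 1 * \<phi> (u + 1)" if "u \<ge> x1" for u
    using d[of u] b(2)[of u] that by (auto simp: x1_def field_simps exp_minus)
  have steps: "\<phi> u \<le> exp (real n) * \<phi> (u + real n)" if "u \<ge> x1" for u n
  proof (induction n)
    case (Suc n)
    have "\<phi> (u + real n) \<le> exp 1 * \<phi> (u + real n + 1)" using that by (intro step) auto
    then have "exp (real n) * \<phi> (u + real n) \<le> exp (real n) * (exp 1 * \<phi> (u + real n + 1))"
      by (intro mult_left_mono) auto
    with Suc have "\<phi> u \<le> exp (real n) * (exp 1 * \<phi> (u + real n + 1))" by linarith
    then show ?case by (simp add: exp_add ac_simps)
  qed simp
  show ?thesis
  proof (rule that)
    show "K \<ge> 1" by (simp add: K_def)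
    show "x1 > 0" using b by (simp add: x1_def)
    show "0 < \<phi> u" if "u \<ge> x1" for u using that b by (simp add: x1_def)
    have "K0 \<le> K0 * exp 1" using K0(2) by simp
    then have K0K: "K0 \<le> K" unfolding K_def by linarith
    show "\<phi> (u + t) \<le> K * \<phi> u" if "u \<ge> x1" "t \<ge> 0" for u t
    proof (cases "t = 0")
      case True then show ?thesis using \<open>K \<ge> 1\<close> nn[of u] by (simp add: mult_le_cancel_right1)
    next
      case False
      then have "\<phi> (u + t) \<le> K0 * \<phi> u" using that K0(1) by (intro K0(3)) (auto simp: x1_def)
      also have "\<dots> \<le> K * \<phi> u" using K0K nn by (intro mult_right_mono) auto
      finally show ?thesis .
    qed
    show "\<phi> u \<le> K * exp t * \<phi> (u + t)" if ut: "u \<ge> x1" "t \<ge> 0" for u t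
    proof -
      define n where "n = nat \<lfloor>t\<rfloor> + 1"
      have n: "t < real n" "real n \<le> t + 1" using ut real_of_int_floor_add_one_gt[of t] of_int_floor_le[of t]
        by (simp_all add: n_def algebra_simps)
      have "\<phi> u \<le> exp (real n) * \<phi> ((u + t) + (real n - t))" using steps[OF ut(1), of n] by simp
      also have "\<phi> ((u + t) + (real n - t)) \<le> K0 * \<phi> (u + t)"
        using n ut K0(1) by (intro K0(3)) (auto simp: x1_def)
      also have "exp (real n) * (K0 * \<phi> (u + t)) \<le> exp (t + 1) * (K0 * \<phi> (u + t))"
        using n K0 nn by (intro mult_right_mono) auto
      also have "\<dots> = (K0 * exp 1) * (exp t * \<phi> (u + t))" by (simp add: exp_add)
      also have "\<dots> \<le> K * (exp t * \<phi> (u + t))"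
        using nn by (intro mult_right_mono) (auto simp: K_def)
      finally show ?thesis by (simp add: mult.assoc)
    qed
  qed
qed

text \<open>The dominating function for all limits below: to the left of \<open>x\<close> by the slow decay of \<open>\<phi>\<close>,
  to the right of \<open>x\<close> by almost monotonicity. Where \<open>x - s\<close> lies below the range in which \<open>q\<close> is
  controlled, \<open>s\<close> is so large that the bound \<open>Q\<close> is already absorbed by \<open>exp s * \<phi> x\<close>.\<close>

lemma shift_domination:
  assumes lt: "long_tailed_fun \<phi>" and ad: "almost_decreasing \<phi>"
    and q: "\<And>x. 0 \<le> q x" "\<And>x. q x \<le> Q" and le: "\<forall>\<^sub>F x in at_top. q x \<le> C1 * \<phi> x"
  obtains C x2 where "\<And>x s. x \<ge> x2 \<Longrightarrow> q (x - s) \<le> C * (1 + exp s) * \<phi> x" "C \<ge> 0"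
    "\<And>x. x \<ge> x2 \<Longrightarrow> 0 < \<phi> x"
proof -
  from long_tailed_growth[OF lt ad] obtain x1 K where K: "K \<ge> 1" "x1 > 0" "\<And>u. u \<ge> x1 \<Longrightarrow> 0 < \<phi> u"
    "\<And>u t. u \<ge> x1 \<Longrightarrow> t \<ge> 0 \<Longrightarrow> \<phi> (u + t) \<le> K * \<phi> u"
    "\<And>u t. u \<ge> x1 \<Longrightarrow> t \<ge> 0 \<Longrightarrow> \<phi> u \<le> K * exp t * \<phi> (u + t)" by metis
  from le obtain d where d: "\<And>x. x \<ge> d \<Longrightarrow> q x \<le> C1 * \<phi> x" unfolding eventually_at_top_linorder by blast
  define y where "y = max x1 d"
  have y: "y \<ge> x1" "y \<ge> d" by (auto simp: y_def)
  have nn: "0 \<le> \<phi> x" for x using lt by (simp add: long_tailed_fun_def)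
  have Q: "Q \<ge> 0" using q[of 0] by linarith
  define B where "B = Q * K / \<phi> y"
  have yp: "\<phi> y > 0" using K(3) y by auto
  have Bn: "B \<ge> 0" using Q K(1) yp by (simp add: B_def)
  define C where "C = \<bar>C1\<bar> * K + B"
  have Cn: "C \<ge> 0" using Bn K(1) by (simp add: C_def)
  show ?thesis
  proof (rule that)
    show "C \<ge> 0" by fact
    show "\<phi> x > 0" if "x \<ge> y" for x using that K(3) y by auto
    fix x s assume x: "x \<ge> y"
    show "q (x - s) \<le> C * (1 + exp s) * \<phi> x"
    proof (cases "x - s \<ge> y")
      case True
      have *: "\<phi> (x - s) \<le> K * (1 + exp s) * \<phi> x"
      proof (cases "s \<ge> 0")
        case s: True
        have "\<phi> (x - s) \<le> K * exp s * \<phi> (x - s + s)" using True y s by (intro K(5)) auto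
        also have "\<dots> \<le> K * (1 + exp s) * \<phi> x" using K(1) nn by (intro mult_mono) auto
        finally show ?thesis .
      next
        case s: False
        have "\<phi> (x + (-s)) \<le> K * \<phi> x" using x y s by (intro K(4)) auto
        also have "\<dots> \<le> K * (1 + exp s) * \<phi> x" using K(1) nn by (intro mult_right_mono) auto
        finally show ?thesis by simp
      qed
      have "q (x - s) \<le> C1 * \<phi> (x - s)" using d True y by auto
      also have "\<dots> \<le> \<bar>C1\<bar> * \<phi> (x - s)" using nn by (intro mult_right_mono) auto
      also have "\<dots> \<le> \<bar>C1\<bar> * (K * (1 + exp s) * \<phi> x)" using * by (intro mult_left_mono) auto
      also have "\<dots> = (\<bar>C1\<bar> * K) * ((1 + exp s) * \<phi> x)" by simp
      also have "\<dots> \<le> C * ((1 + exp s) * \<phi> x)"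
        using Bn nn[of x] by (intro mult_right_mono) (auto simp: C_def add_nonneg_nonneg)
      finally show ?thesis by (simp add: mult.assoc)
    next
      case False
      have "\<phi> y \<le> K * exp (x - y) * \<phi> (y + (x - y))" using x y by (intro K(5)) auto
      also have "\<dots> \<le> K * exp s * \<phi> x" using False K(1) nn by (auto intro!: mult_right_mono)
      finally have 1: "\<phi> y \<le> K * exp s * \<phi> x" .
      have "q (x - s) \<le> Q * (\<phi> y / \<phi> y)" using q yp by simp
      also have "\<dots> \<le> Q * (K * exp s * \<phi> x / \<phi> y)"
        using 1 Q yp by (intro mult_left_mono divide_right_mono) auto
      also have "\<dots> = B * (exp s * \<phi> x)" by (simp add: B_def)
      also have "\<dots> \<le> C * ((1 + exp s) * \<phi> x)"
        using Bn nn[of x] K(1) by (intro mult_mono mult_right_mono) (auto simp: C_def)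
      finally show ?thesis by (simp add: mult.assoc)
    qed
  qed
qed

text \<open>Convolution with a light-tailed measure leaves the asymptotics unchanged. The left tail of \<open>W\<close> is
  arbitrary: there almost monotonicity of \<open>\<phi>\<close> supplies the domination. Restrictions of a distribution to
  \<open>{..A}\<close> are light-tailed in this sense.\<close>

lemma light_convolution_limit:
  assumes lt: "long_tailed_fun \<phi>" and ad: "almost_decreasing \<phi>"
    and [measurable]: "q \<in> borel_measurable borel"
    and q: "\<And>x. 0 \<le> q x" "\<And>x. q x \<le> Q" and lim: "((\<lambda>x. q x / \<phi> x) \<longlongrightarrow> g) at_top"
    and W: "finite_borel_measure W" "integrable W exp"
  shows "((\<lambda>x. (\<integral>s. q (x - s) \<partial>W) / \<phi> x) \<longlongrightarrow> g * measure W UNIV) at_top"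
proof -
  interpret W: finite_borel_measure W by fact
  note [measurable_cong] = W.M_is_borel
  have "\<forall>\<^sub>F x in at_top. q x / \<phi> x < g + 1" by (rule order_tendstoD(2)[OF lim]) auto
  with long_tailed_fun_pos[OF lt] have "\<forall>\<^sub>F x in at_top. q x \<le> (g + 1) * \<phi> x"
    by eventually_elim (auto simp: field_simps)
  from shift_domination[OF lt ad q this] obtain C x2 where C:
    "\<And>x s. x \<ge> x2 \<Longrightarrow> q (x - s) \<le> C * (1 + exp s) * \<phi> x" "C \<ge> 0" "\<And>x. x \<ge> x2 \<Longrightarrow> 0 < \<phi> x" by metis
  have "((\<lambda>x. (\<integral>s. q (x - s) / \<phi> x \<partial>W)) \<longlongrightarrow> (\<integral>s. g \<partial>W)) at_top"
  proof (rule integral_dominated_convergence_at_top[where w = "\<lambda>s. C * (1 + exp s)"])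
    show "integrable W (\<lambda>s. C * (1 + exp s))" using W(2) by auto
    show "\<forall>\<^sub>F x in at_top. AE s in W. norm (q (x - s) / \<phi> x) \<le> C * (1 + exp s)"
      using eventually_ge_at_top[of x2]
    proof eventually_elim
      case (elim x)
      have "norm (q (x - s) / \<phi> x) \<le> C * (1 + exp s)" for s
        using C(1)[OF elim, of s] C(3)[OF elim] q(1)[of "x - s"] by (simp add: pos_divide_le_eq)
      then show ?case by simp
    qed
    show "AE s in W. ((\<lambda>x. q (x - s) / \<phi> x) \<longlongrightarrow> g) at_top"
    proof (rule AE_I2)
      fix s
      have f: "filterlim (\<lambda>x::real. x - s) at_top at_top" using filterlim_shift_at_top[of "-s"] by simp
      have "((\<lambda>x. q (x - s) / \<phi> (x - s)) \<longlongrightarrow> g) at_top"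
        using filterlim_compose[OF lim f] .
      from tendsto_mult[OF this long_tailed_fun_shift[OF lt, of "-s"]]
      have "((\<lambda>x. (q (x - s) / \<phi> (x - s)) * (\<phi> (x - s) / \<phi> x)) \<longlongrightarrow> g) at_top" by simp
      moreover have "\<forall>\<^sub>F x in at_top. \<phi> (x - s) > 0"
        using long_tailed_fun_pos[OF lt] f by (rule eventually_compose_filterlim)
      then have "\<forall>\<^sub>F x in at_top. (q (x - s) / \<phi> (x - s)) * (\<phi> (x - s) / \<phi> x) = q (x - s) / \<phi> x"
        by eventually_elim auto
      ultimately show "((\<lambda>x. q (x - s) / \<phi> x) \<longlongrightarrow> g) at_top"
        by (rule Lim_transform_eventually)
    qed
  qed auto
  then show ?thesis by (simp add: W.borel_UNIV mult.commute)
qed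

section \<open>Convolutions and local masses\<close>

lemma fbm_convolution:
  assumes "finite_borel_measure M" "finite_borel_measure N"
  shows "finite_borel_measure (M \<star> N)"
  using assms convolution_finite[of M N]
  by (auto simp: finite_borel_measure_def finite_borel_measure_axioms_def)

lemma real_distribution_convolution:
  assumes "real_distribution M" "real_distribution N"
  shows "real_distribution (M \<star> N)"
proof -
  interpret M: real_distribution M by fact
  interpret N: real_distribution N by fact
  interpret P: pair_prob_space M N ..
  show ?thesis unfolding convolution_def real_distribution_def real_distribution_axioms_def
    by (auto intro!: P.prob_space_distr)
qed

lemma fbm_real_distribution: "real_distribution M \<Longrightarrow> finite_borel_measure M"
  by (rule real_distribution.finite_borel_measure_M)

lemma real_distribution_dirac: "real_distribution (return borel (0::real))"
  by (auto simp: prob_space_return real_distribution_def real_distribution_axioms_def)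

lemma integral_convolution:
  fixes f :: "real \<Rightarrow> 'b::{banach, second_countable_topology}"
  assumes M: "finite_borel_measure M" and N: "finite_borel_measure N"
    and [measurable]: "f \<in> borel_measurable borel" and B: "\<And>x. norm (f x) \<le> B"
  shows "(\<integral>x. f x \<partial>(M \<star> N)) = (\<integral>x. \<integral>y. f (x + y) \<partial>N \<partial>M)"
proof -
  interpret M: finite_borel_measure M by fact
  interpret N: finite_borel_measure N by fact
  note [measurable_cong] = M.M_is_borel N.M_is_borel
  interpret P: pair_sigma_finite M N ..
  interpret PF: finite_measure "M \<Otimes>\<^sub>M N"
    by (intro finite_measure_pair_measure M.finite_measure_axioms N.finite_measure_axioms)
  have "(\<integral>x. f x \<partial>(M \<star> N)) = (\<integral>p. f (fst p + snd p) \<partial>(M \<Otimes>\<^sub>M N))"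
    unfolding convolution_def by (subst integral_distr) (auto simp: split_beta)
  also have "\<dots> = (\<integral>x. \<integral>y. f (x + y) \<partial>N \<partial>M)"
    by (subst P.integral_fst'[symmetric])
       (auto intro!: PF.integrable_const_bound[where B = B] simp: B)
  finally show ?thesis .
qed

lemma local_mass_nonneg [simp]: "0 \<le> local_mass F c x"
  by (simp add: local_mass_def)

lemma local_mass_cdf:
  assumes "finite_borel_measure M" "c \<ge> 0"
  shows "local_mass M c x = cdf M (x + c) - cdf M x"
proof -
  interpret M: finite_borel_measure M by fact
  show ?thesis using M.cdf_diff_eq[of x "x + c"] assms(2)
    by (cases "c = 0") (auto simp: local_mass_def)
qed

lemma local_mass_measurable [measurable]:
  assumes "finite_borel_measure M"
  shows "local_mass M c \<in> borel_measurable borel"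
proof (cases "c \<ge> 0")
  case True
  interpret M: finite_borel_measure M by fact
  have "cdf M \<in> borel_measurable borel"
    by (intro borel_measurable_mono monoI M.cdf_nondecreasing)
  then have "(\<lambda>x. cdf M (x + c) - cdf M x) \<in> borel_measurable borel" by measurable
  then show ?thesis using local_mass_cdf[OF assms True] by (simp cong: measurable_cong)
next
  case False
  then have "local_mass M c = (\<lambda>_. 0)" by (auto simp: local_mass_def)
  then show ?thesis by simp
qed

lemma local_mass_le: "finite_borel_measure M \<Longrightarrow> local_mass M c x \<le> measure M UNIV"
proof -
  assume "finite_borel_measure M"
  then interpret M: finite_borel_measure M .
  show ?thesis unfolding local_mass_def by (rule M.finite_measure_mono) auto
qed

lemma local_mass_integral:
  assumes "finite_borel_measure M"
  shows "local_mass M c x = (\<integral>y. indicator {x<..x + c} y \<partial>M)"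
proof -
  interpret M: finite_borel_measure M by fact
  show ?thesis by (simp add: local_mass_def M.borel_UNIV)
qed

lemma local_mass_convolution:
  assumes M: "finite_borel_measure M" and N: "finite_borel_measure N"
  shows "local_mass (M \<star> N) c x = (\<integral>s. local_mass M c (x - s) \<partial>N)"
proof -
  interpret M: finite_borel_measure M by fact
  interpret N: finite_borel_measure N by fact
  note [measurable_cong] = M.M_is_borel N.M_is_borel
  have "(M \<star> N) = (N \<star> M)"
    by (rule convolution_commutative) (simp_all add: M.finite_measure_axioms N.finite_measure_axioms M.M_is_borel N.M_is_borel)
  then have "local_mass (M \<star> N) c x = (\<integral>y. indicator {x<..x + c} y \<partial>(N \<star> M))"
    using local_mass_integral[OF fbm_convolution[OF N M]] by simp
  also have "\<dots> = (\<integral>s. \<integral>y. indicator {x<..x + c} (s + y) \<partial>M \<partial>N)"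
    by (rule integral_convolution[OF N M, where B = 1]) (auto split: split_indicator)
  also have "\<dots> = (\<integral>s. \<integral>y. indicator {x - s<..x - s + c} y \<partial>M \<partial>N)"
    by (intro Bochner_Integration.integral_cong refl) (auto split: split_indicator)
  finally show ?thesis by (simp add: local_mass_integral[OF M])
qed

section \<open>Two big jumps\<close>

definition tail_part :: "real measure \<Rightarrow> real \<Rightarrow> real measure" where
  "tail_part M A = density M (indicator {A<..})"

lemma tail_part_sets [simp, measurable_cong]: "sets (tail_part M A) = sets M"
  by (simp add: tail_part_def)

lemma fbm_density_indicator:
  assumes "sets M = sets borel" "S \<in> sets borel" "emeasure M S < \<infinity>"
  shows "finite_borel_measure (density M (indicator S))"
proof -
  have [simp]: "space M = UNIV" using sets_eq_imp_space_eq[OF assms(1)] by simp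
  show ?thesis
  unfolding finite_borel_measure_def finite_borel_measure_axioms_def
  using assms by (auto intro!: finite_measureI simp: emeasure_density)
qed

lemma fbm_tail_part:
  assumes "finite_borel_measure M"
  shows "finite_borel_measure (tail_part M A)"
proof -
  interpret M: finite_borel_measure M by fact
  show ?thesis unfolding tail_part_def
    by (rule fbm_density_indicator) (auto simp: M.M_is_borel M.emeasure_eq_measure)
qed

lemma measure_density_indicator:
  assumes "sets M = sets borel" "S \<in> sets borel" "X \<in> sets borel"
  shows "measure (density M (indicator S)) X = measure M (S \<inter> X)"
proof -
  have "emeasure (density M (indicator S)) X = (\<integral>\<^sup>+x. indicator (S \<inter> X) x \<partial>M)"
    using assms by (subst emeasure_density)
      (auto simp del: nn_integral_indicator intro!: nn_integral_cong split: split_indicator)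
  also have "\<dots> = emeasure M (S \<inter> X)" using assms by (subst nn_integral_indicator) auto
  finally show ?thesis by (simp add: measure_def)
qed

lemma integral_density_indicator:
  fixes f :: "real \<Rightarrow> real"
  assumes "sets M = sets borel" "f \<in> borel_measurable borel" "S \<in> sets borel"
  shows "(\<integral>x. f x \<partial>(density M (indicator S))) = (\<integral>x. indicator S x * f x \<partial>M)"
proof -
  have [measurable_cong]: "sets M = sets borel" by fact
  have [measurable]: "f \<in> borel_measurable borel" "S \<in> sets borel" by fact+
  have "density M (indicator S) = density M (\<lambda>x. ennreal (indicator S x))"
    by (rule density_cong) (auto simp: ennreal_indicator)
  then show ?thesis using integral_density[of f M "indicator S"] by simp
qed

lemma integral_tail_part:
  fixes f :: "real \<Rightarrow> real"
  assumes "sets M = sets borel" "f \<in> borel_measurable borel"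
  shows "(\<integral>x. f x \<partial>(tail_part M A)) = (\<integral>x. indicator {A<..} x * f x \<partial>M)"
  unfolding tail_part_def using assms by (intro integral_density_indicator) auto

lemma local_mass_tail_part:
  assumes "sets M = sets borel"
  shows "local_mass (tail_part M A) c x = measure M ({A<..} \<inter> {x<..x + c})"
  unfolding local_mass_def tail_part_def by (rule measure_density_indicator) (auto simp: assms)

lemma local_mass_tail_part_le:
  assumes "finite_borel_measure M"
  shows "local_mass (tail_part M A) c x \<le> (if x + c > A then local_mass M c x else 0)"
proof -
  interpret M: finite_borel_measure M by fact
  have "{A<..} \<inter> {x<..x + c} = {}" if "\<not> A < x + c" using that by auto
  then show ?thesis
    unfolding local_mass_tail_part[OF M.M_is_borel]
    by (auto simp: local_mass_def M.M_is_borel intro!: M.finite_measure_mono)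
qed

lemma local_mass_tail_part_eq:
  assumes "sets M = sets borel" "x \<ge> A"
  shows "local_mass (tail_part M A) c x = local_mass M c x"
  unfolding local_mass_tail_part[OF assms(1)] unfolding local_mass_def
  using assms(2) by (intro arg_cong[where f = "measure M"]) auto

definition two_big_jumps :: "real measure \<Rightarrow> real \<Rightarrow> real \<Rightarrow> real \<Rightarrow> real" where
  "two_big_jumps R c A x = local_mass (tail_part R A \<star> tail_part R A) c x"

text \<open>The bound is required for all \<open>x\<close>. This is no more than an eventual bound, because two jumps above
  \<open>A\<close> never land in a window \<open>{x<..x + c}\<close> with \<open>x + c \<le> 2 * A\<close>.\<close>

definition negligible_two_big_jumps :: "real measure \<Rightarrow> real \<Rightarrow> bool" where
  "negligible_two_big_jumps R c \<longleftrightarrow>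
     (\<forall>\<epsilon>>0. \<exists>A0. \<forall>A\<ge>A0. \<forall>x. two_big_jumps R c A x \<le> \<epsilon> * local_mass R c x)"

lemma integrable_bounded_fbm:
  fixes f :: "real \<Rightarrow> real"
  assumes "finite_borel_measure N" "f \<in> borel_measurable borel" "\<And>x. \<bar>f x\<bar> \<le> B"
  shows "integrable N f"
proof -
  interpret N: finite_borel_measure N by fact
  note [measurable_cong] = N.M_is_borel
  show ?thesis using assms by (intro N.integrable_const_bound[where B = B]) auto
qed

lemma integrable_local_mass_shift:
  assumes M: "finite_borel_measure M" and N: "finite_borel_measure N"
  shows "integrable N (\<lambda>s. local_mass M c (x - s))"
proof -
  have [measurable]: "local_mass M c \<in> borel_measurable borel" using M by measurable
  show ?thesis
    by (rule integrable_bounded_fbm[OF N, where B = "measure M UNIV"]) (auto simp: local_mass_le[OF M])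
qed

text \<open>Mass of \<open>M\<close> beyond \<open>A\<close> is replaced by mass of \<open>R\<close>; since the window has length \<open>c\<close>, the jump
  of \<open>R\<close> may start up to \<open>c\<close> below \<open>A\<close>.\<close>

lemma local_mass_convolution_tail_le:
  assumes M: "finite_borel_measure M" and N: "finite_borel_measure N" and R: "finite_borel_measure R"
    and c: "c > 0" and C: "C \<ge> 0"
    and zero: "\<And>z. z + c \<le> A \<Longrightarrow> local_mass M c z = 0"
    and le: "\<And>z. z + c > A \<Longrightarrow> local_mass M c z \<le> C * local_mass R c z"
  shows "local_mass (M \<star> N) c x \<le> C * local_mass (tail_part R (A - c) \<star> N) c x"
proof -
  note T = fbm_tail_part[OF R, of "A - c"]
  interpret R: finite_borel_measure R by fact
  have "local_mass (M \<star> N) c x = (\<integral>s. local_mass M c (x - s) \<partial>N)"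
    by (rule local_mass_convolution[OF M N])
  also have "\<dots> \<le> (\<integral>s. C * local_mass (tail_part R (A - c)) c (x - s) \<partial>N)"
  proof (rule integral_mono)
    show "local_mass M c (x - s) \<le> C * local_mass (tail_part R (A - c)) c (x - s)" for s
    proof (cases "x - s + c \<le> A")
      case True
      then show ?thesis using zero C by simp
    next
      case False
      then show ?thesis using le[of "x - s"] local_mass_tail_part_eq[OF R.M_is_borel, of "A - c" "x - s" c]
        by simp
    qed
  qed (use integrable_local_mass_shift[OF M N] integrable_local_mass_shift[OF T N] in auto)
  also have "\<dots> = C * local_mass (tail_part R (A - c) \<star> N) c x"
    by (simp add: local_mass_convolution[OF T N])
  finally show ?thesis .
qed

lemma convolution_commutative_fbm:
  assumes M: "finite_borel_measure M" and N: "finite_borel_measure N"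
  shows "(M \<star> N) = (N \<star> M)"
  using assms unfolding finite_borel_measure_def finite_borel_measure_axioms_def
  by (intro convolution_commutative) auto

lemma local_mass_tail_part_mono:
  assumes R: "finite_borel_measure R" and "A \<le> B"
  shows "local_mass (tail_part R B) c x \<le> local_mass (tail_part R A) c x"
proof -
  interpret R: finite_borel_measure R by fact
  show ?thesis unfolding local_mass_tail_part[OF R.M_is_borel]
    using assms(2) by (intro R.finite_measure_mono) (auto simp: R.M_is_borel)
qed

lemma local_mass_convolution_mono:
  assumes M: "finite_borel_measure M" and N: "finite_borel_measure N" and M': "finite_borel_measure M'"
    and le: "\<And>z. local_mass M c z \<le> local_mass M' c z"
  shows "local_mass (M \<star> N) c x \<le> local_mass (M' \<star> N) c x"
  unfolding local_mass_convolution[OF M N] local_mass_convolution[OF M' N]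
  by (intro integral_mono integrable_local_mass_shift assms)

lemma two_big_jumps_antimono:
  assumes R: "finite_borel_measure R" and "A \<le> B"
  shows "two_big_jumps R c B x \<le> two_big_jumps R c A x"
proof -
  note T = fbm_tail_part[OF R]
  have "two_big_jumps R c B x \<le> local_mass (tail_part R A \<star> tail_part R B) c x"
    unfolding two_big_jumps_def
    by (intro local_mass_convolution_mono T local_mass_tail_part_mono R assms)
  also have "\<dots> = local_mass (tail_part R B \<star> tail_part R A) c x"
    by (simp add: convolution_commutative_fbm[OF T T])
  also have "\<dots> \<le> two_big_jumps R c A x"
    unfolding two_big_jumps_def
    by (intro local_mass_convolution_mono T local_mass_tail_part_mono R assms)
  finally show ?thesis .
qed

lemma two_big_jumps_zero:
  assumes R: "finite_borel_measure R" and "x + c \<le> 2 * A"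
  shows "two_big_jumps R c A x = 0"
proof -
  interpret R: finite_borel_measure R by fact
  note T = fbm_tail_part[OF R]
  have [measurable]: "local_mass (tail_part R A) c \<in> borel_measurable borel" using T by measurable
  have "indicator {A<..} s * local_mass (tail_part R A) c (x - s) = 0" for s
  proof (cases "s > A")
    case True
    then have "x - s + c \<le> A" using assms by linarith
    then have "local_mass (tail_part R A) c (x - s) \<le> 0"
      using local_mass_tail_part_le[OF R, of A c "x - s"] by simp
    then show ?thesis using local_mass_nonneg[of "tail_part R A" c "x - s"] by simp
  qed simp
  then have "(\<lambda>s. indicator {A<..} s * local_mass (tail_part R A) c (x - s)) = (\<lambda>_. 0)" by auto
  then show ?thesis unfolding two_big_jumps_def local_mass_convolution[OF T T]
    by (subst integral_tail_part) (simp_all add: R.M_is_borel)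
qed

lemma negligible_two_big_jumpsI:
  assumes R: "finite_borel_measure R"
    and ev: "\<And>\<epsilon>. \<epsilon> > 0 \<Longrightarrow> \<exists>A. \<forall>\<^sub>F x in at_top. two_big_jumps R c A x \<le> \<epsilon> * local_mass R c x"
  shows "negligible_two_big_jumps R c"
  unfolding negligible_two_big_jumps_def
proof (intro allI impI)
  fix \<epsilon> :: real assume e: "\<epsilon> > 0"
  from ev[OF e] obtain A0 x0 where x0: "\<And>x. x \<ge> x0 \<Longrightarrow> two_big_jumps R c A0 x \<le> \<epsilon> * local_mass R c x"
    unfolding eventually_at_top_linorder by blast
  show "\<exists>A0. \<forall>A\<ge>A0. \<forall>x. two_big_jumps R c A x \<le> \<epsilon> * local_mass R c x"
  proof (intro exI allI impI)
    fix A x assume A: "A \<ge> max A0 ((x0 + c) / 2)"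
    show "two_big_jumps R c A x \<le> \<epsilon> * local_mass R c x"
    proof (cases "x \<ge> x0")
      case True
      then show ?thesis using x0[of x] two_big_jumps_antimono[OF R, of A0 A c x] A by auto
    next
      case False
      then show ?thesis using A e by (subst two_big_jumps_zero[OF R]) auto
    qed
  qed
qed

lemma tail_small:
  assumes "real_distribution R" "\<epsilon> > 0"
  shows "\<exists>A0. \<forall>A\<ge>A0. measure R {A<..} < \<epsilon>"
proof -
  interpret R: real_distribution R by fact
  have "\<forall>\<^sub>F A in at_top. cdf R A > 1 - \<epsilon>"
    by (rule order_tendstoD(1)[OF R.cdf_lim_at_top_prob]) (use assms in auto)
  then obtain A0 where "\<And>A. A \<ge> A0 \<Longrightarrow> cdf R A > 1 - \<epsilon>" unfolding eventually_at_top_linorder by blast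
  moreover have "measure R {A<..} = 1 - cdf R A" for A
  proof -
    have "{A<..} = UNIV - {..A}" by auto
    then show ?thesis unfolding cdf_def using R.prob_compl[of "{..A}"] by simp
  qed
  ultimately have "measure R {A<..} < \<epsilon>" if "A \<ge> A0" for A using that by (smt (verit))
  then show ?thesis by blast
qed

text \<open>For \<open>x \<ge> 2 * A\<close> two jumps of size at most \<open>A\<close> cannot reach beyond \<open>x\<close>, so either exactly
  one of them is at most \<open>A\<close>, or none.\<close>

lemma convolution_square_split:
  assumes "real_distribution R" and c: "c > 0" and x: "x \<ge> 2 * A"
  shows "local_mass (R \<star> R) c x =
    2 * (\<integral>s. local_mass R c (x - s) \<partial>(density R (indicator {..A}))) + two_big_jumps R c A x"
proof -
  interpret R: real_distribution R by fact
  note F = fbm_real_distribution[OF assms(1)]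
  note T = fbm_tail_part[OF F, of A]
  have [measurable]: "local_mass R c \<in> borel_measurable borel" "local_mass (tail_part R A) c \<in> borel_measurable borel"
    using F T by measurable
  have i1: "integrable R (\<lambda>s. local_mass R c (x - s))" by (rule integrable_local_mass_shift[OF F F])
  have i2: "integrable R (\<lambda>s. local_mass (tail_part R A) c (x - s))" by (rule integrable_local_mass_shift[OF T F])
  have split: "(\<integral>s. f s \<partial>R) = (\<integral>s. f s \<partial>(density R (indicator {..A}))) + (\<integral>s. f s \<partial>(tail_part R A))"
    if "integrable R f" "f \<in> borel_measurable borel" for f :: "real \<Rightarrow> real"
  proof -
    have "(\<integral>s. f s \<partial>R) = (\<integral>s. indicator {..A} s * f s + indicator {A<..} s * f s \<partial>R)"
      by (intro Bochner_Integration.integral_cong refl) (auto split: split_indicator)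
    also have "\<dots> = (\<integral>s. indicator {..A} s * f s \<partial>R) + (\<integral>s. indicator {A<..} s * f s \<partial>R)"
      using that integrable_mult_indicator[of _ R f] by (intro Bochner_Integration.integral_add) auto
    finally show ?thesis using that
      by (subst integral_density_indicator, simp, simp, simp, subst integral_tail_part, simp, simp)
  qed
  have "local_mass (R \<star> R) c x = (\<integral>s. local_mass R c (x - s) \<partial>R)"
    by (rule local_mass_convolution[OF F F])
  also have "\<dots> = (\<integral>s. local_mass R c (x - s) \<partial>(density R (indicator {..A})))
     + (\<integral>s. local_mass R c (x - s) \<partial>(tail_part R A))"
    by (rule split[OF i1]) measurable
  also have "(\<integral>s. local_mass R c (x - s) \<partial>(tail_part R A)) = local_mass (tail_part R A \<star> R) c x"
    using local_mass_convolution[OF F T] convolution_commutative_fbm[OF F T] by simp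
  also have "\<dots> = (\<integral>s. local_mass (tail_part R A) c (x - s) \<partial>R)"
    by (rule local_mass_convolution[OF T F])
  also have "\<dots> = (\<integral>s. local_mass (tail_part R A) c (x - s) \<partial>(density R (indicator {..A})))
     + (\<integral>s. local_mass (tail_part R A) c (x - s) \<partial>(tail_part R A))"
    by (rule split[OF i2]) measurable
  also have "(\<integral>s. local_mass (tail_part R A) c (x - s) \<partial>(tail_part R A)) = two_big_jumps R c A x"
    unfolding two_big_jumps_def by (rule local_mass_convolution[OF T T, symmetric])
  also have "(\<integral>s. local_mass (tail_part R A) c (x - s) \<partial>(density R (indicator {..A}))) =
      (\<integral>s. local_mass R c (x - s) \<partial>(density R (indicator {..A})))"
  proof -
    have "(\<lambda>s. indicator {..A} s * local_mass (tail_part R A) c (x - s)) =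
      (\<lambda>s. indicator {..A} s * local_mass R c (x - s))"
      using x by (auto simp: fun_eq_iff local_mass_tail_part_eq indicator_def)
    then show ?thesis by (subst (1 2) integral_density_indicator) simp_all
  qed
  finally show ?thesis by simp
qed

lemma one_small_jump_limit:
  assumes "real_distribution R"
    and "long_tailed_fun (local_mass R c)" "almost_decreasing (local_mass R c)"
  shows "((\<lambda>x. (\<integral>s. local_mass R c (x - s) \<partial>(density R (indicator {..A}))) / local_mass R c x)
    \<longlongrightarrow> measure R {..A}) at_top"
proof -
  interpret R: real_distribution R by fact
  note F = fbm_real_distribution[OF assms(1)]
  have W: "finite_borel_measure (density R (indicator {..A}))"
    by (rule fbm_density_indicator) (auto simp: R.emeasure_eq_measure)
  have "density R (indicator {..A}) = density R (\<lambda>x. ennreal (indicator {..A} x))"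
    by (rule density_cong) (auto simp: ennreal_indicator)
  moreover have "integrable R (\<lambda>x. indicator {..A} x *\<^sub>R exp x)"
    by (rule integrable_bounded_fbm[OF F, where B = "exp A"]) (auto split: split_indicator)
  ultimately have e: "integrable (density R (indicator {..A})) exp"
    by (simp add: integrable_density)
  have [measurable]: "local_mass R c \<in> borel_measurable borel" using F by measurable
  have "((\<lambda>x. local_mass R c x / local_mass R c x) \<longlongrightarrow> 1) at_top"
    using long_tailed_fun_pos[OF assms(2)] by (intro tendsto_eventually) (auto elim: eventually_mono)
  from light_convolution_limit[OF assms(2,3) _ _ local_mass_le[OF F] this W e]
  show ?thesis by (simp add: measure_density_indicator)
qed

text \<open>Given the regularity of local masses, local subexponentiality says exactly that two big jumps
  are negligible: the contributions of one jump of size at most \<open>A\<close> add up to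
  \<open>2 * measure R {..A}\<close>, close to \<open>2\<close>.\<close>

lemma local_subexponential_iff:
  assumes R: "real_distribution R" and c: "c > 0"
    and lt: "long_tailed_fun (local_mass R c)" and ad: "almost_decreasing (local_mass R c)"
  shows "local_mass (R \<star> R) c \<sim>[at_top] (\<lambda>x. 2 * local_mass R c x) \<longleftrightarrow> negligible_two_big_jumps R c"
proof
  interpret R: real_distribution R by fact
  note F = fbm_real_distribution[OF R]
  note pos = long_tailed_fun_pos[OF lt]
  have compl: "measure R {..A} = 1 - measure R {A<..}" for A
    using R.prob_compl[of "{A<..}"] by (simp add: Compl_eq_Diff_UNIV[symmetric])
  let ?I = "\<lambda>A x. \<integral>s. local_mass R c (x - s) \<partial>(density R (indicator {..A}))"
  {
    assume "local_mass (R \<star> R) c \<sim>[at_top] (\<lambda>x. 2 * local_mass R c x)"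
    then have "((\<lambda>x. local_mass (R \<star> R) c x / (2 * local_mass R c x)) \<longlongrightarrow> 1) at_top"
      by (rule asymp_equiv_ratio) (use pos in auto)
    from tendsto_mult[OF tendsto_const[of 2] this]
    have l: "((\<lambda>x. local_mass (R \<star> R) c x / local_mass R c x) \<longlongrightarrow> 2) at_top" by simp
    show "negligible_two_big_jumps R c"
    proof (rule negligible_two_big_jumpsI[OF F])
      fix \<epsilon> :: real assume e: "\<epsilon> > 0"
      obtain A0 where A0: "measure R {A0<..} < \<epsilon> / 2" using tail_small[OF R, of "\<epsilon>/2"] e by auto
      have "((\<lambda>x. local_mass (R \<star> R) c x / local_mass R c x - 2 * (?I A0 x / local_mass R c x))
          \<longlongrightarrow> 2 - 2 * measure R {..A0}) at_top"
        by (intro tendsto_intros l one_small_jump_limit R lt ad)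
      moreover have "2 - 2 * measure R {..A0} < \<epsilon>" using compl[of A0] A0 by simp
      ultimately have "\<forall>\<^sub>F x in at_top. local_mass (R \<star> R) c x / local_mass R c x - 2 * (?I A0 x / local_mass R c x) < \<epsilon>"
        by (rule order_tendstoD(2))
      with pos eventually_ge_at_top[of "2 * A0"]
      have "\<forall>\<^sub>F x in at_top. two_big_jumps R c A0 x \<le> \<epsilon> * local_mass R c x"
      proof eventually_elim
        case (elim x)
        then show ?case using convolution_square_split[OF R c elim(2)] by (simp add: field_simps)
      qed
      then show "\<exists>A. \<forall>\<^sub>F x in at_top. two_big_jumps R c A x \<le> \<epsilon> * local_mass R c x" by blast
    qed
  }
  assume N: "negligible_two_big_jumps R c"
  have l: "((\<lambda>x. local_mass (R \<star> R) c x / local_mass R c x) \<longlongrightarrow> 2) at_top"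
  proof (rule tendstoI)
    fix \<epsilon> :: real assume e: "\<epsilon> > 0"
    have "\<epsilon>/2 > 0" using e by simp
    with N obtain A0 where A0: "\<And>A x. A \<ge> A0 \<Longrightarrow> two_big_jumps R c A x \<le> \<epsilon>/2 * local_mass R c x"
      unfolding negligible_two_big_jumps_def by blast
    obtain A1 where A1: "\<And>A. A \<ge> A1 \<Longrightarrow> measure R {A<..} < \<epsilon> / 8" using tail_small[OF R, of "\<epsilon>/8"] e by auto
    define A where "A = max A0 A1"
    have A: "measure R {A<..} < \<epsilon> / 8" "\<And>x. two_big_jumps R c A x \<le> \<epsilon>/2 * local_mass R c x"
      using A0 A1 by (auto simp: A_def)
    have "\<forall>\<^sub>F x in at_top. dist (?I A x / local_mass R c x) (measure R {..A}) < \<epsilon> / 8"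
      by (rule tendstoD[OF one_small_jump_limit[OF R lt ad]]) (use e in auto)
    with pos eventually_ge_at_top[of "2 * A"]
    show "\<forall>\<^sub>F x in at_top. dist (local_mass (R \<star> R) c x / local_mass R c x) 2 < \<epsilon>"
    proof eventually_elim
      case (elim x)
      have t: "two_big_jumps R c A x / local_mass R c x \<le> \<epsilon>/2" "two_big_jumps R c A x / local_mass R c x \<ge> 0"
        using A(2)[of x] elim(1) by (auto simp: field_simps two_big_jumps_def)
      have "local_mass (R \<star> R) c x / local_mass R c x = 2 * (?I A x / local_mass R c x) + two_big_jumps R c A x / local_mass R c x"
        using convolution_square_split[OF R c elim(2)] by (simp add: add_divide_distrib)
      then show ?case using t elim(3) A(1) compl[of A] measure_nonneg[of R "{A<..}"] e
        unfolding dist_real_def abs_less_iff by linarith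
    qed
  qed
  have "((\<lambda>x. local_mass (R \<star> R) c x / (2 * local_mass R c x)) \<longlongrightarrow> 1) at_top"
    using tendsto_mult[OF tendsto_const[of "1/2"] l] by (simp add: field_simps)
  then show "local_mass (R \<star> R) c \<sim>[at_top] (\<lambda>x. 2 * local_mass R c x)"
    by (rule asymp_equivI')
qed

section \<open>Transfer between distributions with proportional local masses\<close>

text \<open>The two jumps of \<open>M\<close> are replaced by jumps of \<open>R\<close> one after the other; each replacement lowers the
  threshold by \<open>c\<close>.\<close>

lemma two_big_jumps_le:
  assumes M: "finite_borel_measure M" and R: "finite_borel_measure R" and c: "c > 0" and C: "C \<ge> 0"
    and le: "\<And>z. z \<ge> y \<Longrightarrow> local_mass M c z \<le> C * local_mass R c z"
    and A: "A \<ge> y + 2 * c"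
  shows "two_big_jumps M c A x \<le> C\<^sup>2 * two_big_jumps R c (A - 2 * c) x"
proof -
  note TM = fbm_tail_part[OF M] and TR = fbm_tail_part[OF R]
  have le': "local_mass (tail_part M A) c z \<le> C * local_mass R c z" if "z + c > A" for z
    using local_mass_tail_part_le[OF M, of A c z] le[of z] that A c by simp
  have zero: "local_mass (tail_part M A) c z = 0" if "z + c \<le> A" for z
    using local_mass_tail_part_le[OF M, of A c z] that local_mass_nonneg[of "tail_part M A" c z] by simp
  have "two_big_jumps M c A x \<le> C * local_mass (tail_part R (A - c) \<star> tail_part M A) c x"
    unfolding two_big_jumps_def by (rule local_mass_convolution_tail_le[OF TM TM R c C zero le'])
  also have "local_mass (tail_part R (A - c) \<star> tail_part M A) c x = local_mass (tail_part M A \<star> tail_part R (A - c)) c x"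
    by (simp add: convolution_commutative_fbm[OF TR TM])
  also have "\<dots> \<le> C * local_mass (tail_part R (A - c) \<star> tail_part R (A - c)) c x"
    by (rule local_mass_convolution_tail_le[OF TM TR R c C zero le'])
  also have "\<dots> \<le> C * two_big_jumps R c (A - 2 * c) x"
    using two_big_jumps_antimono[OF R, of "A - 2 * c" "A - c" c x] c C
    by (intro mult_left_mono) (auto simp: two_big_jumps_def)
  finally show ?thesis using C by (simp add: mult_left_mono power2_eq_square mult.assoc)
qed

lemma ratio_eventually_bounds:
  fixes f g :: "real \<Rightarrow> real"
  assumes "((\<lambda>x. f x / g x) \<longlongrightarrow> \<kappa>) at_top" "\<kappa> > 0" "\<forall>\<^sub>F x in at_top. 0 < g x"
  shows "\<exists>y>0. \<forall>x\<ge>y. 0 < g x \<and> \<kappa> / 2 * g x \<le> f x \<and> f x \<le> 2 * \<kappa> * g x \<and> 0 < f x"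
proof -
  have "\<forall>\<^sub>F x in at_top. f x / g x > \<kappa> / 2" by (rule order_tendstoD(1)[OF assms(1)]) (use assms in auto)
  moreover have "\<forall>\<^sub>F x in at_top. f x / g x < 2 * \<kappa>" by (rule order_tendstoD(2)[OF assms(1)]) (use assms in auto)
  ultimately have "\<forall>\<^sub>F x in at_top. 0 < g x \<and> \<kappa> / 2 * g x \<le> f x \<and> f x \<le> 2 * \<kappa> * g x \<and> 0 < f x"
    using assms(3)
  proof eventually_elim
    case (elim x)
    have "\<kappa> / 2 * g x < f x" using elim by (simp add: pos_less_divide_eq)
    moreover have "f x < 2 * \<kappa> * g x" using elim by (simp add: pos_divide_less_eq)
    moreover have "\<kappa> / 2 * g x > 0" using elim assms by simp
    ultimately show ?case using elim by linarith
  qed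
  with eventually_gt_at_top[of 0] have "\<forall>\<^sub>F x in at_top. 0 < x \<and> (0 < g x \<and> \<kappa> / 2 * g x \<le> f x \<and> f x \<le> 2 * \<kappa> * g x \<and> 0 < f x)"
    by eventually_elim auto
  then obtain y where y: "\<And>x. x \<ge> y \<Longrightarrow> 0 < x \<and> (0 < g x \<and> \<kappa> / 2 * g x \<le> f x \<and> f x \<le> 2 * \<kappa> * g x \<and> 0 < f x)"
    unfolding eventually_at_top_linorder by blast
  then show ?thesis by (intro exI[of _ y]) auto
qed

lemma long_tailed_fun_transfer:
  assumes lt: "long_tailed_fun \<phi>" and lim: "((\<lambda>x. f x / \<phi> x) \<longlongrightarrow> \<kappa>) at_top" "\<kappa> > 0"
    and f: "f \<in> borel_measurable borel" "\<And>x. 0 \<le> f x"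
  shows "long_tailed_fun f"
  unfolding long_tailed_fun_def
proof (intro conjI allI impI)
  from ratio_eventually_bounds[OF lim long_tailed_fun_pos[OF lt]]
  show "\<exists>x0>0. \<forall>x\<ge>x0. 0 < f x" by blast
  then have posf: "\<forall>\<^sub>F x in at_top. 0 < f x" unfolding eventually_at_top_linorder by blast
  fix y :: real assume "y > 0"
  have "((\<lambda>x. f (x + y) / \<phi> (x + y)) \<longlongrightarrow> \<kappa>) at_top"
    by (rule filterlim_compose[OF lim(1) filterlim_shift_at_top])
  from tendsto_mult[OF tendsto_mult[OF this long_tailed_fun_shift[OF lt, of y]] tendsto_inverse[OF lim(1)]]
  have "((\<lambda>x. f (x + y) / \<phi> (x + y) * (\<phi> (x + y) / \<phi> x) * inverse (f x / \<phi> x)) \<longlongrightarrow> 1) at_top"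
    using lim(2) by simp
  moreover have "\<forall>\<^sub>F x in at_top. \<phi> (x + y) > 0"
    using long_tailed_fun_pos[OF lt] filterlim_shift_at_top by (rule eventually_compose_filterlim)
  with long_tailed_fun_pos[OF lt] posf
  have "\<forall>\<^sub>F x in at_top. f (x + y) / \<phi> (x + y) * (\<phi> (x + y) / \<phi> x) * inverse (f x / \<phi> x) = f (x + y) / f x"
    by eventually_elim (auto simp: field_simps)
  ultimately have "((\<lambda>x. f (x + y) / f x) \<longlongrightarrow> 1) at_top" by (rule Lim_transform_eventually)
  then show "(\<lambda>x. f (x + y)) \<sim>[at_top] f" by (rule asymp_equivI')
qed (use f in auto)

lemma almost_decreasing_transfer:
  assumes pos: "\<forall>\<^sub>F x in at_top. 0 < \<phi> x"
    and ad: "almost_decreasing \<phi>" and lim: "((\<lambda>x. f x / \<phi> x) \<longlongrightarrow> \<kappa>) at_top" "\<kappa> > 0"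
    and f: "\<And>x. 0 \<le> f x"
  shows "almost_decreasing f"
proof -
  from ratio_eventually_bounds[OF lim pos] obtain y where
    y: "y > 0" "\<And>x. x \<ge> y \<Longrightarrow> 0 < \<phi> x \<and> \<kappa> / 2 * \<phi> x \<le> f x \<and> f x \<le> 2 * \<kappa> * \<phi> x" by blast
  from ad obtain x0 K where K: "x0 > 0" "K > 0" "\<And>x t. x > x0 \<Longrightarrow> t > 0 \<Longrightarrow> \<phi> (x + t) \<le> K * \<phi> x"
    unfolding almost_decreasing_def by blast
  have "f (x + t) \<le> (4 * K) * f x" if x: "x > max x0 y" and t: "t > 0" for x t
  proof -
    have "f (x + t) \<le> 2 * \<kappa> * \<phi> (x + t)" using y(2)[of "x + t"] x t by auto
    also have "\<dots> \<le> 2 * \<kappa> * (K * \<phi> x)" using K(3)[of x t] x t lim(2) by (intro mult_left_mono) auto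
    also have "\<dots> = 4 * K * (\<kappa> / 2 * \<phi> x)" by simp
    also have "\<dots> \<le> 4 * K * f x" using y(2)[of x] x K(2) by (intro mult_left_mono) auto
    finally show ?thesis .
  qed
  then show ?thesis unfolding almost_decreasing_def using f y(1) K(2)
    by (intro conjI allI exI[of _ "max x0 y"] exI[of _ "4 * K"]) auto
qed

lemma negligible_two_big_jumps_transfer:
  assumes R: "finite_borel_measure R" and M: "finite_borel_measure M" and c: "c > 0"
    and pos: "\<forall>\<^sub>F x in at_top. 0 < local_mass R c x"
    and lim: "((\<lambda>x. local_mass M c x / local_mass R c x) \<longlongrightarrow> \<kappa>) at_top" "\<kappa> > 0"
    and N: "negligible_two_big_jumps R c"
  shows "negligible_two_big_jumps M c"
  unfolding negligible_two_big_jumps_def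
proof (intro allI impI)
  fix \<epsilon> :: real assume e: "\<epsilon> > 0"
  from ratio_eventually_bounds[OF lim pos] obtain y where
    y: "y > 0" "\<And>x. x \<ge> y \<Longrightarrow> \<kappa> / 2 * local_mass R c x \<le> local_mass M c x \<and> local_mass M c x \<le> 2 * \<kappa> * local_mass R c x" by blast
  have "\<epsilon> / (8 * \<kappa>) > 0" using e lim(2) by simp
  with N obtain A0 where A0: "\<And>A x. A \<ge> A0 \<Longrightarrow> two_big_jumps R c A x \<le> \<epsilon> / (8 * \<kappa>) * local_mass R c x"
    unfolding negligible_two_big_jumps_def by blast
  show "\<exists>A0. \<forall>A\<ge>A0. \<forall>x. two_big_jumps M c A x \<le> \<epsilon> * local_mass M c x"
  proof (intro exI allI impI)
    fix A x assume A: "A \<ge> max (A0 + 2 * c) (y + 2 * c)"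
    show "two_big_jumps M c A x \<le> \<epsilon> * local_mass M c x"
    proof (cases "x + c \<le> 2 * A")
      case True then show ?thesis using e by (simp add: two_big_jumps_zero[OF M])
    next
      case False
      then have x: "x \<ge> y" using A c y(1) by auto
      have "two_big_jumps M c A x \<le> (2 * \<kappa>)\<^sup>2 * two_big_jumps R c (A - 2 * c) x"
        using A lim(2) y(2) by (intro two_big_jumps_le[OF M R c, of _ y]) auto
      also have "\<dots> \<le> (2 * \<kappa>)\<^sup>2 * (\<epsilon> / (8 * \<kappa>) * local_mass R c x)"
        using A by (intro mult_left_mono A0) auto
      also have "\<dots> = \<epsilon> * (\<kappa> / 2 * local_mass R c x)" using lim(2) by (simp add: power2_eq_square)
      also have "\<dots> \<le> \<epsilon> * local_mass M c x" using y(2)[OF x] e by (intro mult_left_mono) auto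
      finally show ?thesis .
    qed
  qed
qed

text \<open>All three ingredients of the local classes survive passing to proportional local masses; for
  subexponentiality this is visible only in its formulation through big jumps.\<close>

lemma local_class_transfer:
  assumes R: "real_distribution R" and M: "real_distribution M" and c: "c > 0"
    and lim: "((\<lambda>x. local_mass M c x / local_mass R c x) \<longlongrightarrow> \<kappa>) at_top" "\<kappa> > 0"
    and S: "R \<in> S_Delta c" and D: "R \<in> D_Delta c"
  shows "M \<in> S_Delta c \<inter> D_Delta c"
proof -
  note FR = fbm_real_distribution[OF R] and FM = fbm_real_distribution[OF M]
  have ltR: "long_tailed_fun (local_mass R c)" and adR: "almost_decreasing (local_mass R c)"
    using S D by (auto simp: S_Delta_def L_Delta_def D_Delta_def)
  note pos = long_tailed_fun_pos[OF ltR]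
  have lt: "long_tailed_fun (local_mass M c)"
    by (rule long_tailed_fun_transfer[OF ltR lim local_mass_measurable[OF FM]]) simp
  have ad: "almost_decreasing (local_mass M c)"
    by (rule almost_decreasing_transfer[OF pos adR lim]) simp
  have "negligible_two_big_jumps R c"
    using S local_subexponential_iff[OF R c ltR adR] by (simp add: S_Delta_def)
  then have "negligible_two_big_jumps M c"
    by (rule negligible_two_big_jumps_transfer[OF FR FM c pos lim])
  then show ?thesis using local_subexponential_iff[OF M c lt ad] lt ad M
    by (simp add: S_Delta_def L_Delta_def D_Delta_def)
qed

section \<open>Compound Poisson distributions\<close>

lemma real_distribution_conv_power:
  assumes "real_distribution F"
  shows "real_distribution (conv_power F k)"
  by (induction k) (simp_all add: real_distribution_dirac real_distribution_convolution assms)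

lemma char_convolution:
  assumes "real_distribution M" "real_distribution N"
  shows "char (M \<star> N) t = char M t * char N t"
proof -
  interpret M: real_distribution M by fact
  interpret N: real_distribution N by fact
  have "char (M \<star> N) t = (\<integral>x. \<integral>y. iexp (t * (x + y)) \<partial>N \<partial>M)"
    unfolding char_def by (rule integral_convolution[where B = 1])
      (auto simp: fbm_real_distribution assms)
  also have "\<dots> = (\<integral>x. \<integral>y. iexp (t * x) * iexp (t * y) \<partial>N \<partial>M)"
    by (simp add: distrib_left exp_add)
  finally show ?thesis by (simp add: char_def)
qed

lemma char_conv_power:
  assumes "real_distribution F"
  shows "char (conv_power F k) t = char F t ^ k"
proof (induction k)
  case 0
  show ?case by (simp add: char_def integral_return)
qed (simp add: char_convolution real_distribution_conv_power assms)

lemma nn_integral_exp_convolution: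
  assumes "real_distribution M" "real_distribution N"
  shows "(\<integral>\<^sup>+x. ennreal (exp (\<gamma> * x)) \<partial>(M \<star> N)) =
    (\<integral>\<^sup>+x. ennreal (exp (\<gamma> * x)) \<partial>M) * (\<integral>\<^sup>+x. ennreal (exp (\<gamma> * x)) \<partial>N)"
proof -
  interpret M: real_distribution M by fact
  interpret N: real_distribution N by fact
  have "(\<integral>\<^sup>+x. ennreal (exp (\<gamma> * x)) \<partial>(M \<star> N)) = (\<integral>\<^sup>+x. \<integral>\<^sup>+y. ennreal (exp (\<gamma> * (x + y))) \<partial>N \<partial>M)"
    by (rule nn_integral_convolution) (auto simp: M.finite_measure_axioms N.finite_measure_axioms)
  also have "\<dots> = (\<integral>\<^sup>+x. \<integral>\<^sup>+y. ennreal (exp (\<gamma> * x)) * ennreal (exp (\<gamma> * y)) \<partial>N \<partial>M)"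
    by (simp add: distrib_left exp_add ennreal_mult)
  also have "\<dots> = (\<integral>\<^sup>+x. ennreal (exp (\<gamma> * x)) * (\<integral>\<^sup>+y. ennreal (exp (\<gamma> * y)) \<partial>N) \<partial>M)"
    by (intro nn_integral_cong nn_integral_cmult) simp
  also have "\<dots> = (\<integral>\<^sup>+x. ennreal (exp (\<gamma> * x)) \<partial>M) * (\<integral>\<^sup>+y. ennreal (exp (\<gamma> * y)) \<partial>N)"
    by (intro nn_integral_multc) simp
  finally show ?thesis .
qed

lemma nn_integral_exp_conv_power:
  assumes "real_distribution F"
  shows "(\<integral>\<^sup>+x. ennreal (exp (\<gamma> * x)) \<partial>(conv_power F k)) = (\<integral>\<^sup>+x. ennreal (exp (\<gamma> * x)) \<partial>F) ^ k"
proof (induction k)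
  case 0
  show ?case by (simp add: nn_integral_return)
qed (simp add: nn_integral_exp_convolution real_distribution_conv_power assms)

lemma real_distribution_uniform_measure:
  assumes "sets \<nu> = sets borel" "J \<in> sets borel" "emeasure \<nu> J < \<infinity>" "measure \<nu> J > 0"
  shows "real_distribution (uniform_measure \<nu> J)"
proof -
  have "emeasure \<nu> J \<noteq> 0" using assms(4) by (auto simp: measure_def)
  then show ?thesis using assms prob_space_uniform_measure[of \<nu> J]
    by (auto simp: real_distribution_def real_distribution_axioms_def)
qed

lemma integral_uniform_measure:
  fixes f :: "real \<Rightarrow> 'b::{banach, second_countable_topology}"
  assumes sets: "sets \<nu> = sets borel" and J: "J \<in> sets borel" "emeasure \<nu> J < \<infinity>" "measure \<nu> J > 0"
    and [measurable]: "f \<in> borel_measurable borel"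
  shows "measure \<nu> J *\<^sub>R (\<integral>x. f x \<partial>(uniform_measure \<nu> J)) = (\<integral>x. indicator J x *\<^sub>R f x \<partial>\<nu>)"
proof -
  have [measurable_cong]: "sets \<nu> = sets borel" by fact
  have [measurable]: "J \<in> sets borel" by fact
  have e: "emeasure \<nu> J = ennreal (measure \<nu> J)"
    using J by (intro emeasure_eq_ennreal_measure) auto
  have "uniform_measure \<nu> J = density \<nu> (\<lambda>x. ennreal (indicator J x / measure \<nu> J))"
    unfolding uniform_measure_def e using J
    by (intro density_cong) (auto simp: divide_ennreal ennreal_indicator[symmetric] split: split_indicator)
  then have "(\<integral>x. f x \<partial>(uniform_measure \<nu> J)) = (\<integral>x. (indicator J x / measure \<nu> J) *\<^sub>R f x \<partial>\<nu>)"
    using J by (subst integral_density[symmetric]) (auto simp: fun_eq_iff)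
  also have "\<dots> = (\<integral>x. (1 / measure \<nu> J) *\<^sub>R (indicator J x *\<^sub>R f x) \<partial>\<nu>)" by simp
  also have "\<dots> = (1 / measure \<nu> J) *\<^sub>R (\<integral>x. indicator J x *\<^sub>R f x \<partial>\<nu>)" by (rule integral_scaleR_right)
  finally show ?thesis using J by simp
qed

lemma convolution_return_0:
  assumes "real_distribution F"
  shows "(F \<star> return borel 0) = F"
proof (rule measure_eqI)
  interpret real_distribution F by fact
  fix B assume B: "B \<in> sets (F \<star> return borel 0)"
  then have "emeasure (F \<star> return borel 0) B = (\<integral>\<^sup>+x. \<integral>\<^sup>+y. indicator B (x + y) \<partial>(return borel 0) \<partial>F)"
    by (intro convolution_emeasure')
      (auto simp: finite_measure_axioms prob_space.finite_measure prob_space_return)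
  also have "\<dots> = (\<integral>\<^sup>+x. indicator B x \<partial>F)"
    using B by (intro nn_integral_cong) (subst nn_integral_return, auto)
  finally show "emeasure (F \<star> return borel 0) B = emeasure F B" using B by simp
qed (use assms in \<open>simp add: real_distribution.events_eq_borel\<close>)

text \<open>The compound Poisson law with Levy measure the restriction of \<open>\<nu>\<close> to \<open>J\<close>. For total mass \<open>0\<close> neither the
  Poisson law nor the normalised jump distribution makes sense, and there is no jump.\<close>

definition cpoisson :: "real measure \<Rightarrow> real set \<Rightarrow> real measure" where
  "cpoisson \<nu> J = (if measure \<nu> J = 0 then return borel 0
     else measure_pmf (poisson_pmf (measure \<nu> J)) \<bind> conv_power (uniform_measure \<nu> J))"

context
  fixes \<nu> :: "real measure" and J :: "real set"
  assumes sets_nu: "sets \<nu> = sets borel" and J: "J \<in> sets borel" "emeasure \<nu> J < \<infinity>"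
begin

lemma conv_power_measurable:
  "measure \<nu> J > 0 \<Longrightarrow> conv_power (uniform_measure \<nu> J) \<in> measurable (measure_pmf p) (subprob_algebra borel)"
  using real_distribution_conv_power[OF real_distribution_uniform_measure[OF sets_nu J]]
  by (auto simp: space_subprob_algebra measurable_def real_distribution_def real_distribution_axioms_def
      intro: prob_space_imp_subprob_space)

lemma real_distribution_cpoisson: "real_distribution (cpoisson \<nu> J)"
proof (cases "measure \<nu> J = 0")
  case True
  then show ?thesis by (simp add: cpoisson_def real_distribution_dirac)
next
  case False
  then have pos: "measure \<nu> J > 0" by (simp add: zero_less_measure_iff)
  note F = real_distribution_conv_power[OF real_distribution_uniform_measure[OF sets_nu J pos]]
  have "prob_space (measure_pmf (poisson_pmf (measure \<nu> J)) \<bind> conv_power (uniform_measure \<nu> J))"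
    using F by (intro measure_pmf.prob_space_bind[OF _ conv_power_measurable[OF pos]])
      (auto simp: real_distribution_def)
  moreover have "sets (measure_pmf (poisson_pmf (measure \<nu> J)) \<bind> conv_power (uniform_measure \<nu> J)) = sets borel"
    by (rule sets_bind_measurable[OF conv_power_measurable[OF pos]]) auto
  ultimately show ?thesis using False
    by (simp add: cpoisson_def real_distribution_def real_distribution_axioms_def)
qed

lemma nn_integral_cpoisson:
  assumes pos: "measure \<nu> J > 0" and f: "f \<in> borel_measurable borel"
  shows "(\<integral>\<^sup>+x. f x \<partial>(cpoisson \<nu> J)) = (\<Sum>k. ennreal (measure \<nu> J ^ k / fact k * exp (- measure \<nu> J)) *
      (\<integral>\<^sup>+x. f x \<partial>(conv_power (uniform_measure \<nu> J) k)))"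
proof -
  have "(\<integral>\<^sup>+x. f x \<partial>(cpoisson \<nu> J)) = (\<integral>\<^sup>+k. \<integral>\<^sup>+x. f x \<partial>(conv_power (uniform_measure \<nu> J) k)
      \<partial>(measure_pmf (poisson_pmf (measure \<nu> J))))"
    using pos f conv_power_measurable[OF pos] by (simp add: cpoisson_def nn_integral_bind[where B = borel])
  also have "\<dots> = (\<integral>\<^sup>+k. ennreal (pmf (poisson_pmf (measure \<nu> J)) k) *
      (\<integral>\<^sup>+x. f x \<partial>(conv_power (uniform_measure \<nu> J) k)) \<partial>count_space UNIV)"
    by (rule nn_integral_measure_pmf)
  finally show ?thesis using pos by (simp add: nn_integral_count_space_nat)
qed

lemma sums_cpoisson:
  fixes f :: "real \<Rightarrow> real"
  assumes pos: "measure \<nu> J > 0" and [measurable]: "f \<in> borel_measurable borel" and B: "\<And>x. \<bar>f x\<bar> \<le> B"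
  shows "(\<lambda>k. (measure \<nu> J ^ k / fact k * exp (- measure \<nu> J)) *
      (\<integral>x. f x \<partial>(conv_power (uniform_measure \<nu> J) k))) sums (\<integral>x. f x \<partial>(cpoisson \<nu> J))"
proof -
  let ?F = "uniform_measure \<nu> J" and ?P = "measure_pmf (poisson_pmf (measure \<nu> J))"
  note F = real_distribution_conv_power[OF real_distribution_uniform_measure[OF sets_nu J pos]]
  note meas = conv_power_measurable[OF pos, of "poisson_pmf (measure \<nu> J)"]
  have bnd: "\<bar>\<integral>x. f x \<partial>(conv_power ?F k)\<bar> \<le> B" for k
  proof -
    interpret K: real_distribution "conv_power ?F k" by (rule F)
    have "\<bar>\<integral>x. f x \<partial>(conv_power ?F k)\<bar> \<le> (\<integral>x. \<bar>f x\<bar> \<partial>(conv_power ?F k))" by simp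
    also have "\<dots> \<le> (\<integral>x. B \<partial>(conv_power ?F k))"
      using B order_trans[OF abs_ge_zero B[of 0]] by (intro integral_mono K.integrable_const_bound[where B = B]) auto
    finally show ?thesis using K.prob_space by simp
  qed
  have join: "cpoisson \<nu> J = join (distr ?P (subprob_algebra borel) (conv_power ?F))"
    using pos bind_nonempty''[OF meas] by (simp add: cpoisson_def)
  have "(\<integral>x. f x \<partial>(cpoisson \<nu> J)) = (\<integral>M. (\<integral>x. f x \<partial>M) \<partial>(distr ?P (subprob_algebra borel) (conv_power ?F)))"
    unfolding join
  proof (rule integral_join[where B = B and B' = 1 and N = borel])
    show "finite_measure (distr ?P (subprob_algebra borel) (conv_power ?F))"
      by (rule finite_measure.finite_measure_distr[OF _ meas]) (rule measure_pmf.finite_measure_axioms)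
    show "AE M in distr ?P (subprob_algebra borel) (conv_power ?F). emeasure M (space M) \<le> ennreal 1"
      using F by (subst AE_distr_iff[OF meas])
        (auto simp: real_distribution_def prob_space.emeasure_space_1 intro!: AE_I2)
  qed (use B in \<open>auto\<close>)
  also have "\<dots> = (\<integral>k. (\<integral>x. f x \<partial>(conv_power ?F k)) \<partial>?P)"
    by (rule integral_distr[OF meas]) measurable
  also have "\<dots> = (\<integral>k. pmf (poisson_pmf (measure \<nu> J)) k * (\<integral>x. f x \<partial>(conv_power ?F k)) \<partial>count_space UNIV)"
    unfolding measure_pmf_eq_density by (subst integral_density) auto
  finally have eq: "(\<integral>x. f x \<partial>(cpoisson \<nu> J)) =
    (\<integral>k. pmf (poisson_pmf (measure \<nu> J)) k * (\<integral>x. f x \<partial>(conv_power ?F k)) \<partial>count_space UNIV)" .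
  have "integrable ?P (\<lambda>k. \<integral>x. f x \<partial>(conv_power ?F k))"
    using bnd by (intro measure_pmf.integrable_const_bound[where B = B]) auto
  then have "integrable (count_space UNIV) (\<lambda>k. pmf (poisson_pmf (measure \<nu> J)) k * (\<integral>x. f x \<partial>(conv_power ?F k)))"
    unfolding measure_pmf_eq_density by (subst (asm) integrable_density) auto
  from sums_integral_count_space_nat[OF this] show ?thesis
    using pos unfolding eq by simp
qed

lemma measure_sums_cpoisson:
  assumes "measure \<nu> J > 0" "B \<in> sets borel"
  shows "(\<lambda>k. (measure \<nu> J ^ k / fact k * exp (- measure \<nu> J)) *
      measure (conv_power (uniform_measure \<nu> J) k) B) sums measure (cpoisson \<nu> J) B"
proof -
  note F = real_distribution_conv_power[OF real_distribution_uniform_measure[OF sets_nu J assms(1)]]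
  have *: "(\<integral>x. indicator B x \<partial>M) = measure M B" if "real_distribution M" for M
  proof -
    interpret real_distribution M by fact
    show ?thesis using assms by simp
  qed
  show ?thesis
    using sums_cpoisson[OF assms(1), of "indicator B" 1] assms(2)
    by (simp only: *[OF F] *[OF real_distribution_cpoisson]) (simp split: split_indicator)
qed

lemma Re_complex_of_real_mult: "Re (complex_of_real a * z) = a * Re z"
  and Im_complex_of_real_mult: "Im (complex_of_real a * z) = a * Im z" by simp_all

lemma char_cpoisson:
  "char (cpoisson \<nu> J) t = exp (\<integral>y. indicator J y *\<^sub>R (iexp (t * y) - 1) \<partial>\<nu>)"
proof (cases "measure \<nu> J = 0")
  case True
  then have "emeasure \<nu> J = 0" using J by (simp add: emeasure_eq_ennreal_measure)
  then have "AE y in \<nu>. y \<notin> J" using J sets_nu by (intro AE_not_in) auto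
  then have "(\<integral>y. indicator J y *\<^sub>R (iexp (t * y) - 1) \<partial>\<nu>) = (\<integral>y. 0 \<partial>\<nu>)"
    using J sets_nu[measurable_cong] by (intro integral_cong_AE) auto
  then show ?thesis using True by (simp add: cpoisson_def char_def integral_return)
next
  case False
  then have pos: "measure \<nu> J > 0" by (simp add: zero_less_measure_iff)
  let ?F = "uniform_measure \<nu> J" and ?l = "measure \<nu> J"
  note U = real_distribution_uniform_measure[OF sets_nu J pos]
  interpret U: real_distribution ?F by (rule U)
  note F = real_distribution_conv_power[OF U]
  have ReIm: "Re (char M t) = (\<integral>x. cos (t * x) \<partial>M)" "Im (char M t) = (\<integral>x. sin (t * x) \<partial>M)"
    if "real_distribution M" for M
  proof -
    interpret real_distribution M by fact
    have "integrable M (\<lambda>x. iexp (t * x))" by (intro integrable_const_bound[where B = 1]) auto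
    then show "Re (char M t) = (\<integral>x. cos (t * x) \<partial>M)" "Im (char M t) = (\<integral>x. sin (t * x) \<partial>M)"
      unfolding char_def by (simp_all flip: integral_Re integral_Im add: Re_exp Im_exp)
  qed
  have "(\<lambda>k. ?l ^ k / fact k * exp (- ?l) * Re (char ?F t ^ k)) sums Re (char (cpoisson \<nu> J) t)"
    using sums_cpoisson[OF pos, of "\<lambda>x. cos (t * x)" 1]
    by (simp add: ReIm[OF F, symmetric] ReIm[OF real_distribution_cpoisson, symmetric] char_conv_power[OF U])
  moreover have "(\<lambda>k. ?l ^ k / fact k * exp (- ?l) * Im (char ?F t ^ k)) sums Im (char (cpoisson \<nu> J) t)"
    using sums_cpoisson[OF pos, of "\<lambda>x. sin (t * x)" 1]
    by (simp add: ReIm[OF F, symmetric] ReIm[OF real_distribution_cpoisson, symmetric] char_conv_power[OF U])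
  ultimately have "(\<lambda>k. complex_of_real (?l ^ k / fact k * exp (- ?l)) * char ?F t ^ k) sums char (cpoisson \<nu> J) t"
    unfolding sums_complex_iff Re_complex_of_real_mult Im_complex_of_real_mult by blast
  moreover have "(\<lambda>k. complex_of_real (?l ^ k / fact k * exp (- ?l)) * char ?F t ^ k) sums
      (exp (- complex_of_real ?l) * exp (?l * char ?F t))"
    using sums_mult[OF exp_converges[of "?l * char ?F t"], of "exp (- complex_of_real ?l)"]
    by (simp add: scaleR_conv_of_real power_mult_distrib field_simps exp_of_real[symmetric])
  ultimately have "char (cpoisson \<nu> J) t = exp (- complex_of_real ?l) * exp (?l * char ?F t)"
    using sums_unique2 by blast
  also have "\<dots> = exp (?l * (char ?F t - 1))" by (simp add: exp_add[symmetric] algebra_simps)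
  also have "char ?F t - 1 = (\<integral>x. iexp (t * x) - 1 \<partial>?F)"
  proof -
    have "integrable ?F (\<lambda>x. iexp (t * x))" by (intro U.integrable_const_bound[where B = 1]) auto
    then show ?thesis using U.prob_space by (simp add: char_def)
  qed
  also have "?l * (\<integral>x. iexp (t * x) - 1 \<partial>?F) = (\<integral>y. indicator J y *\<^sub>R (iexp (t * y) - 1) \<partial>\<nu>)"
    using integral_uniform_measure[OF sets_nu J pos, of "\<lambda>x. iexp (t * x) - 1"]
    by (simp add: scaleR_conv_of_real)
  finally show ?thesis .
qed

lemma nn_integral_exp_cpoisson:
  assumes int: "integrable \<nu> (\<lambda>y. indicator J y * exp (\<gamma> * y))"
  shows "(\<integral>\<^sup>+x. ennreal (exp (\<gamma> * x)) \<partial>(cpoisson \<nu> J)) =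
    ennreal (exp (\<integral>y. indicator J y * (exp (\<gamma> * y) - 1) \<partial>\<nu>))"
proof (cases "measure \<nu> J = 0")
  case True
  then have "emeasure \<nu> J = 0" using J by (simp add: emeasure_eq_ennreal_measure)
  then have "AE y in \<nu>. y \<notin> J" using J sets_nu by (intro AE_not_in) auto
  then have "(\<integral>y. indicator J y * (exp (\<gamma> * y) - 1) \<partial>\<nu>) = (\<integral>y. 0 \<partial>\<nu>)"
    using J sets_nu[measurable_cong] by (intro integral_cong_AE) auto
  then show ?thesis using True by (simp add: cpoisson_def nn_integral_return)
next
  case False
  then have pos: "measure \<nu> J > 0" by (simp add: zero_less_measure_iff)
  let ?F = "uniform_measure \<nu> J" and ?l = "measure \<nu> J"
  note U = real_distribution_uniform_measure[OF sets_nu J pos]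
  interpret U: real_distribution ?F by (rule U)
  note [measurable_cong] = sets_nu
  note [measurable] = J(1)
  have e: "emeasure \<nu> J = ennreal ?l" using J by (intro emeasure_eq_ennreal_measure) auto
  define m where "m = (\<integral>y. indicator J y * exp (\<gamma> * y) \<partial>\<nu>)"
  have m: "m \<ge> 0" unfolding m_def by (intro integral_nonneg_AE) auto
  have "(\<integral>\<^sup>+x. ennreal (exp (\<gamma> * x)) \<partial>?F) = (\<integral>\<^sup>+x. ennreal (exp (\<gamma> * x)) * indicator J x \<partial>\<nu>) / ennreal ?l"
    using J sets_nu by (subst nn_integral_uniform_measure) (auto simp: e)
  also have "(\<integral>\<^sup>+x. ennreal (exp (\<gamma> * x)) * indicator J x \<partial>\<nu>) = (\<integral>\<^sup>+x. ennreal (indicator J x * exp (\<gamma> * x)) \<partial>\<nu>)"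
    by (intro nn_integral_cong) (auto split: split_indicator)
  also have "\<dots> = ennreal m" unfolding m_def using int by (intro nn_integral_eq_integral) auto
  finally have F: "(\<integral>\<^sup>+x. ennreal (exp (\<gamma> * x)) \<partial>?F) = ennreal (m / ?l)" using m pos by (simp add: divide_ennreal)
  have "(\<integral>\<^sup>+x. ennreal (exp (\<gamma> * x)) \<partial>(cpoisson \<nu> J)) =
      (\<Sum>k. ennreal (?l ^ k / fact k * exp (- ?l)) * ennreal (m / ?l) ^ k)"
    by (subst nn_integral_cpoisson[OF pos]) (auto simp: nn_integral_exp_conv_power[OF U] F)
  also have "\<dots> = (\<Sum>k. ennreal (exp (- ?l) * (m ^ k /\<^sub>R fact k)))"
    using m pos by (intro suminf_cong) (auto simp: ennreal_power ennreal_mult[symmetric] field_simps)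
  also have "\<dots> = ennreal (exp (- ?l) * exp m)"
    using m by (intro suminf_ennreal_eq sums_mult exp_converges) auto
  also have "exp (- ?l) * exp m = exp (m - ?l)" by (simp add: exp_diff exp_minus field_simps)
  also have "m - ?l = (\<integral>y. indicator J y * (exp (\<gamma> * y) - 1) \<partial>\<nu>)"
  proof -
    have i: "integrable \<nu> (indicator J :: real \<Rightarrow> real)" using J sets_nu by (intro integrable_real_indicator) auto
    have "(\<integral>y. indicator J y * (exp (\<gamma> * y) - 1) \<partial>\<nu>) = (\<integral>y. indicator J y * exp (\<gamma> * y) - indicator J y \<partial>\<nu>)"
      by (intro Bochner_Integration.integral_cong) (auto simp: algebra_simps)
    also have "\<dots> = m - (\<integral>y. indicator J y \<partial>\<nu>)" unfolding m_def
      by (rule Bochner_Integration.integral_diff[OF int i])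
    also have "(\<integral>y. indicator J y \<partial>\<nu>) = ?l"
      using J sets_nu sets.sets_into_space[of J \<nu>] by (auto simp: Int_absorb2)
    finally show ?thesis by simp
  qed
  finally show ?thesis .
qed

lemma cpoisson_atom: "exp (- measure \<nu> J) \<le> measure (cpoisson \<nu> J) {0}"
proof (cases "measure \<nu> J = 0")
  case True
  then show ?thesis by (simp add: cpoisson_def measure_return)
next
  case False
  then have pos: "measure \<nu> J > 0" by (simp add: zero_less_measure_iff)
  from measure_sums_cpoisson[OF pos, of "{0}"]
  have s: "(\<lambda>k. measure \<nu> J ^ k / fact k * exp (- measure \<nu> J) * measure (conv_power (uniform_measure \<nu> J) k) {0})
    sums measure (cpoisson \<nu> J) {0}" by simp
  show ?thesis using sum_le_suminf[OF sums_summable[OF s], of "{0}"] sums_unique[OF s]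
    by (simp add: measure_return)
qed

text \<open>Keeping the terms with one and with two jumps in the Poisson series.\<close>

lemma cpoisson_ge:
  assumes pos: "measure \<nu> J > 0" and B: "B \<in> sets borel"
  shows "exp (- measure \<nu> J) * (measure \<nu> J * measure (uniform_measure \<nu> J) B
    + (measure \<nu> J)\<^sup>2 / 2 * measure (uniform_measure \<nu> J \<star> uniform_measure \<nu> J) B)
    \<le> measure (cpoisson \<nu> J) B"
proof -
  let ?F = "uniform_measure \<nu> J"
  note U = real_distribution_uniform_measure[OF sets_nu J pos]
  interpret U: real_distribution ?F by (rule U)
  note [simp] = convolution_return_0[OF U]
  from measure_sums_cpoisson[OF pos B]
  have s: "(\<lambda>k. measure \<nu> J ^ k / fact k * exp (- measure \<nu> J) * measure (conv_power ?F k) B)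
    sums measure (cpoisson \<nu> J) B" .
  have "(\<Sum>k\<in>{1,2}. measure \<nu> J ^ k / fact k * exp (- measure \<nu> J) * measure (conv_power ?F k) B) \<le> measure (cpoisson \<nu> J) B"
    using sum_le_suminf[OF sums_summable[OF s], of "{1,2}"] sums_unique[OF s] by simp
  then show ?thesis by (simp add: numeral_2_eq_2 algebra_simps power2_eq_square)
qed

text \<open>Isolating the terms with no jump and with one jump; the remaining terms are summed with
  \<open>exp 1 \<le> 3\<close>.\<close>

lemma cpoisson_le:
  assumes pos: "measure \<nu> J > 0" and B: "B \<in> sets borel" and C: "C \<ge> 0"
    and le: "\<And>k. k \<ge> 2 \<Longrightarrow> measure \<nu> J ^ k * measure (conv_power (uniform_measure \<nu> J) k) B \<le> C"
  shows "measure (cpoisson \<nu> J) B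
    \<le> indicator B 0 + exp (- measure \<nu> J) * (measure \<nu> J * measure (uniform_measure \<nu> J) B) + 3 * C"
proof -
  let ?F = "uniform_measure \<nu> J" and ?l = "measure \<nu> J"
  note U = real_distribution_uniform_measure[OF sets_nu J pos]
  interpret U: real_distribution ?F by (rule U)
  note [simp] = convolution_return_0[OF U]
  from measure_sums_cpoisson[OF pos B]
  have s: "(\<lambda>k. ?l ^ k / fact k * exp (- ?l) * measure (conv_power ?F k) B) sums measure (cpoisson \<nu> J) B" .
  define a where "a k = (if k = 0 then indicator B 0 * exp (- ?l) else if k = 1 then exp (- ?l) * (?l * measure ?F B) else 0)" for k :: nat
  have a: "a sums (indicator B 0 * exp (- ?l) + exp (- ?l) * (?l * measure ?F B))"
    using sums_finite[of "{0,1}" a] by (auto simp: a_def)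
  have e: "(\<lambda>k. C * (1 ^ k /\<^sub>R fact k)) sums (C * exp 1)" by (intro sums_mult exp_converges)
  have "measure (cpoisson \<nu> J) B \<le> (indicator B 0 * exp (- ?l) + exp (- ?l) * (?l * measure ?F B)) + C * exp 1"
  proof (rule sums_le[OF _ s sums_add[OF a e]])
    fix k :: nat
    consider "k = 0" | "k = 1" | "k \<ge> 2" by linarith
    then show "?l ^ k / fact k * exp (- ?l) * measure (conv_power ?F k) B \<le> a k + C * (1 ^ k /\<^sub>R fact k)"
    proof cases
      case 3
      have "?l ^ k / fact k * exp (- ?l) * measure (conv_power ?F k) B =
         (?l ^ k * measure (conv_power ?F k) B) * (exp (- ?l) / fact k)" by simp
      also have "\<dots> \<le> C * (1 / fact k)"
        using le[OF 3] C pos by (intro mult_mono divide_right_mono) auto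
      finally show ?thesis using 3 by (simp add: a_def divide_inverse)
    qed (use C B in \<open>auto simp: a_def measure_return\<close>)
  qed
  also have "indicator B 0 * exp (- ?l) \<le> indicator B (0::real)" using pos by (simp split: split_indicator)
  also have "C * exp 1 \<le> 3 * C" using C exp_le by (simp add: mult.commute mult_left_mono)
  finally show ?thesis by simp
qed

text \<open>The atom of \<open>cpoisson \<nu> J\<close> at \<open>0\<close> is close to \<open>1\<close> when \<open>\<nu> J\<close> is small, so that
  convolution with it is a small perturbation.\<close>

lemma cpoisson_perturbation:
  fixes f :: "real \<Rightarrow> real"
  assumes M: "real_distribution M" and [measurable]: "f \<in> borel_measurable borel" and S: "\<And>x. \<bar>f x\<bar> \<le> S"
  shows "\<bar>(\<integral>x. f x \<partial>(cpoisson \<nu> J \<star> M)) - (\<integral>x. f x \<partial>M)\<bar> \<le> 2 * S * (1 - exp (- measure \<nu> J))"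
proof -
  interpret M: real_distribution M by fact
  interpret P: real_distribution "cpoisson \<nu> J" by (rule real_distribution_cpoisson)
  have S0: "S \<ge> 0" using S[of 0] by simp
  have i: "integrable M (\<lambda>x. f (s + x))" for s
    using S by (intro M.integrable_const_bound[where B = S]) auto
  have b: "\<bar>(\<integral>x. f (s + x) \<partial>M)\<bar> \<le> S" for s
  proof -
    have "\<bar>(\<integral>x. f (s + x) \<partial>M)\<bar> \<le> (\<integral>x. \<bar>f (s + x)\<bar> \<partial>M)" by simp
    also have "\<dots> \<le> (\<integral>x. S \<partial>M)" using S by (intro integral_mono integrable_abs i) auto
    finally show ?thesis using M.prob_space by simp
  qed
  let ?h = "\<lambda>s. (\<integral>x. f (s + x) \<partial>M)"
  have [measurable]: "?h \<in> borel_measurable borel" by measurable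
  have ih: "integrable (cpoisson \<nu> J) ?h"
    using b by (intro P.integrable_const_bound[where B = S]) auto
  have "(\<integral>x. f x \<partial>(cpoisson \<nu> J \<star> M)) = (\<integral>s. ?h s \<partial>(cpoisson \<nu> J))"
    by (rule integral_convolution[where B = S]) (use S in \<open>auto simp: fbm_real_distribution M P.real_distribution_axioms\<close>)
  then have "\<bar>(\<integral>x. f x \<partial>(cpoisson \<nu> J \<star> M)) - ?h 0\<bar> = \<bar>\<integral>s. ?h s - ?h 0 \<partial>(cpoisson \<nu> J)\<bar>"
    using ih P.prob_space by simp
  also have "\<dots> \<le> (\<integral>s. \<bar>?h s - ?h 0\<bar> \<partial>(cpoisson \<nu> J))" by simp
  also have "\<dots> \<le> (\<integral>s. 2 * S * indicator (UNIV - {0}) s \<partial>(cpoisson \<nu> J))"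
  proof (rule integral_mono)
    show "\<bar>?h s - ?h 0\<bar> \<le> 2 * S * indicator (UNIV - {0}) s" for s
      using b[of s] b[of 0] by (auto split: split_indicator)
  qed (use ih P.emeasure_eq_measure in \<open>auto intro!: integrable_real_indicator\<close>)
  also have "\<dots> = 2 * S * measure (cpoisson \<nu> J) (UNIV - {0})" by simp
  also have "measure (cpoisson \<nu> J) (UNIV - {0}) = 1 - measure (cpoisson \<nu> J) {0}"
    using P.prob_compl[of "{0}"] by simp
  also have "2 * S * (1 - measure (cpoisson \<nu> J) {0}) \<le> 2 * S * (1 - exp (- measure \<nu> J))"
    using S0 cpoisson_atom by (intro mult_left_mono) auto
  finally show ?thesis by simp
qed

end

section \<open>The part of an infinitely divisible law with bounded jumps\<close>

lemma levy_measure_sets: "levy_measure \<nu> \<Longrightarrow> sets \<nu> = sets borel"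
  by (simp add: levy_measure_def)

lemma levy_measure_finite_away:
  assumes "levy_measure \<nu>" "\<epsilon> > 0" "J \<in> sets borel" "\<And>y. y \<in> J \<Longrightarrow> \<epsilon> \<le> \<bar>y\<bar>"
  shows "emeasure \<nu> J < \<infinity>"
proof -
  have [measurable_cong]: "sets \<nu> = sets borel" using assms(1) by (rule levy_measure_sets)
  define d where "d = min 1 (\<epsilon>\<^sup>2)"
  have d: "d > 0" using assms(2) by (simp add: d_def)
  have "ennreal d * emeasure \<nu> J = (\<integral>\<^sup>+x. ennreal d * indicator J x \<partial>\<nu>)"
    using assms by (subst nn_integral_cmult_indicator) auto
  also have "\<dots> \<le> (\<integral>\<^sup>+ x. ennreal (min 1 (x\<^sup>2)) \<partial>\<nu>)"
  proof (rule nn_integral_mono)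
    fix x
    show "ennreal d * indicator J x \<le> ennreal (min 1 (x\<^sup>2))"
    proof (cases "x \<in> J")
      case True
      have "\<epsilon>\<^sup>2 \<le> x\<^sup>2" using assms(4)[OF True] assms(2) by (simp add: abs_le_square_iff[symmetric])
      then show ?thesis using True by (auto simp: d_def intro!: ennreal_leI)
    qed simp
  qed
  also have "\<dots> < \<infinity>" using assms(1) by (simp add: levy_measure_def)
  finally show ?thesis using d by (auto simp: ennreal_mult_less_top)
qed

lemma levy_measure_second_moment:
  assumes "levy_measure \<nu>" "L > 0"
  shows "integrable \<nu> (\<lambda>y. indicator {-L..L} y * y\<^sup>2)"
proof (rule integrableI_bounded)
  have [measurable_cong]: "sets \<nu> = sets borel" using assms(1) by (rule levy_measure_sets)
  show "(\<lambda>y. indicator {-L..L} y * y\<^sup>2) \<in> borel_measurable \<nu>" by measurable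
  have le: "indicator {-L..L} y * y\<^sup>2 \<le> max 1 (L\<^sup>2) * min 1 (y\<^sup>2)" for y :: real
  proof (cases "\<bar>y\<bar> \<le> L")
    case True
    then have "y\<^sup>2 \<le> L\<^sup>2" using assms(2) by (simp add: abs_le_square_iff[symmetric])
    moreover have "y\<^sup>2 \<le> max 1 (L\<^sup>2) * y\<^sup>2" by (simp add: mult_le_cancel_right1)
    ultimately have "y\<^sup>2 \<le> max 1 (L\<^sup>2) * min 1 (y\<^sup>2)" by (auto simp: min_def max_def)
    then show ?thesis by (auto split: split_indicator)
  qed (auto split: split_indicator)
  have "(\<integral>\<^sup>+ y. ennreal (norm (indicator {-L..L} y * y\<^sup>2)) \<partial>\<nu>) \<le> (\<integral>\<^sup>+ y. ennreal (max 1 (L\<^sup>2)) * ennreal (min 1 (y\<^sup>2)) \<partial>\<nu>)"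
    using le by (intro nn_integral_mono) (simp add: ennreal_mult[symmetric] ennreal_leI)
  also have "\<dots> = ennreal (max 1 (L\<^sup>2)) * (\<integral>\<^sup>+ y. ennreal (min 1 (y\<^sup>2)) \<partial>\<nu>)"
    by (rule nn_integral_cmult) simp
  also have "\<dots> < \<infinity>" using assms(1) by (auto simp: levy_measure_def ennreal_mult_less_top)
  finally show "(\<integral>\<^sup>+ y. ennreal (norm (indicator {-L..L} y * y\<^sup>2)) \<partial>\<nu>) < \<infinity>" .
qed

lemma exp_remainder: "exp t - 1 - t \<le> t\<^sup>2 * exp \<bar>t\<bar>" for t :: real
proof -
  obtain u where u: "\<bar>u\<bar> \<le> \<bar>t\<bar>" "exp t = (\<Sum>m<2. t ^ m / fact m) + exp u / fact 2 * t\<^sup>2"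
    using Maclaurin_exp_le[of t 2] by blast
  then have "exp t - 1 - t = (exp u / 2) * t\<^sup>2" by (simp add: numeral_2_eq_2)
  also have "\<dots> \<le> exp \<bar>t\<bar> * t\<^sup>2"
  proof (rule mult_right_mono)
    have "exp u \<le> exp \<bar>t\<bar>" using u(1) by simp
    then show "exp u / 2 \<le> exp \<bar>t\<bar>" using exp_gt_zero[of u] by linarith
  qed simp
  finally show ?thesis by (simp add: mult.commute)
qed

lemma iexp_remainder: "cmod (iexp x - 1 - \<i> * of_real x) \<le> x\<^sup>2 / 2"
  using iexp_approx1[of x 1] by (simp add: numeral_2_eq_2 power2_eq_square algebra_simps)

lemma iexp_remainder0: "cmod (iexp x - 1) \<le> 2"
  using norm_triangle_ineq4[of "iexp x" 1] by simp

lemma char_distr_shift: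
  assumes "real_distribution M"
  shows "char (distr M borel (\<lambda>x. x + d)) t = exp (\<i> * of_real (t * d)) * char M t"
proof -
  interpret real_distribution M by fact
  have "char (distr M borel (\<lambda>x. x + d)) t = (\<integral>x. iexp (t * (x + d)) \<partial>M)"
    unfolding char_def by (subst integral_distr) auto
  also have "\<dots> = (\<integral>x. exp (\<i> * of_real (t * d)) * iexp (t * x) \<partial>M)"
    by (intro Bochner_Integration.integral_cong) (auto simp: exp_add[symmetric] algebra_simps)
  finally show ?thesis by (simp add: char_def)
qed

lemma tail_le_exp_moment:
  assumes "real_distribution M" "(\<integral>\<^sup>+x. ennreal (exp (\<gamma> * x)) \<partial>M) \<le> ennreal C" "C \<ge> 0"
  shows "measure M {x. u \<le> \<gamma> * x} \<le> C * exp (- u)"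
proof -
  interpret real_distribution M by fact
  have "emeasure M {x. u \<le> \<gamma> * x} = (\<integral>\<^sup>+x. indicator {x. u \<le> \<gamma> * x} x \<partial>M)" by simp
  also have "\<dots> \<le> (\<integral>\<^sup>+x. ennreal (exp (- u)) * ennreal (exp (\<gamma> * x)) \<partial>M)"
    by (intro nn_integral_mono) (auto simp: ennreal_mult[symmetric] exp_add[symmetric] split: split_indicator)
  also have "\<dots> = ennreal (exp (- u)) * (\<integral>\<^sup>+x. ennreal (exp (\<gamma> * x)) \<partial>M)" by (rule nn_integral_cmult) simp
  also have "\<dots> \<le> ennreal (exp (- u)) * ennreal C" by (intro mult_left_mono assms) simp
  also have "\<dots> = ennreal (C * exp (- u))" using assms(3) by (simp add: ennreal_mult[symmetric] mult.commute)
  finally show ?thesis using assms(3) by (simp add: emeasure_eq_measure)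
qed

text \<open>Exponential moments of both signs, uniformly bounded, give tightness and survive the limit.\<close>

lemma exp_moments_limit:
  assumes M: "\<And>n. real_distribution (M n)"
    and mom: "\<And>n. (\<integral>\<^sup>+x. ennreal (exp (1 * x)) \<partial>(M n)) \<le> ennreal C" "\<And>n. (\<integral>\<^sup>+x. ennreal (exp ((-1) * x)) \<partial>(M n)) \<le> ennreal C"
    and char: "\<And>t. (\<lambda>n. char (M n) t) \<longlonglongrightarrow> h t" and C: "C > 0"
  shows "\<exists>N. real_distribution N \<and> char N = h \<and> integrable N exp"
proof -
  interpret M: real_distribution "M n" for n by fact
  have tight: "tight M"
    unfolding tight_def
  proof (intro conjI allI impI M)
    fix \<epsilon> :: real assume e: "\<epsilon> > 0"
    define u where "u = max 1 (ln (4 * C / \<epsilon>))"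
    have u: "C * exp (- u) < \<epsilon> / 2" "u \<ge> 1"
    proof -
      have "C * exp (- u) \<le> C * exp (- ln (4 * C / \<epsilon>))" using C by (auto simp: u_def)
      also have "\<dots> = \<epsilon> / 4" using C e by (simp add: exp_minus field_simps)
      finally show "C * exp (- u) < \<epsilon> / 2" using e by simp
    qed (simp add: u_def)
    have "1 - \<epsilon> < measure (M n) {- u<..u}" for n
    proof -
      have "measure (M n) (UNIV - {- u<..u}) \<le> measure (M n) ({x. u \<le> 1 * x} \<union> {x. u \<le> (-1) * x})"
        by (intro M.finite_measure_mono) auto
      also have "\<dots> \<le> measure (M n) {x. u \<le> 1 * x} + measure (M n) {x. u \<le> (-1) * x}"
        by (intro measure_Un_le) auto
      also have "\<dots> < \<epsilon>"
        using tail_le_exp_moment[OF M mom(1), of n u] tail_le_exp_moment[OF M mom(2), of n u] C u by auto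
      finally show ?thesis using M.prob_compl[of "{- u<..u}" n] by simp
    qed
    then show "\<exists>a b. a < b \<and> (\<forall>n. 1 - \<epsilon> < measure (M n) {a<..b})"
      using u by (intro exI[of _ "-u"] exI[of _ u]) auto
  qed
  from tight_imp_convergent_subsubsequence[OF tight strict_mono_id]
  obtain r N where r: "strict_mono r" and N: "real_distribution N" and w: "weak_conv_m (M \<circ> r) N" by auto
  interpret N: real_distribution N by fact
  have wr: "\<And>n. real_distribution ((M \<circ> r) n)" using M by simp
  have "char N t = h t" for t
  proof (rule LIMSEQ_unique)
    show "(\<lambda>n. char ((M \<circ> r) n) t) \<longlonglongrightarrow> char N t" by (rule levy_continuity1[OF wr N w])
    show "(\<lambda>n. char ((M \<circ> r) n) t) \<longlonglongrightarrow> h t"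
      using LIMSEQ_subseq_LIMSEQ[OF char r] by (simp add: o_def)
  qed
  moreover have "integrable N exp"
  proof (rule integrableI_bounded)
    have bd: "(\<integral>x. min (exp x) (real k) \<partial>N) \<le> C" for k
    proof (rule LIMSEQ_le_const2)
      show "(\<lambda>n. \<integral>x. min (exp x) (real k) \<partial>((M \<circ> r) n)) \<longlonglongrightarrow> (\<integral>x. min (exp x) (real k) \<partial>N)"
        by (rule weak_conv_imp_integral_bdd_continuous_conv[OF wr N w, where B = "real k"])
           (auto intro!: continuous_intros)
      have "(\<integral>x. min (exp x) (real k) \<partial>((M \<circ> r) n)) \<le> C" for n
      proof -
        have "ennreal (\<integral>x. min (exp x) (real k) \<partial>(M (r n))) = (\<integral>\<^sup>+x. ennreal (min (exp x) (real k)) \<partial>(M (r n)))"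
          by (intro nn_integral_eq_integral[symmetric] M.integrable_const_bound[where B = "real k"]) auto
        also have "\<dots> \<le> (\<integral>\<^sup>+x. ennreal (exp (1 * x)) \<partial>(M (r n)))"
          by (intro nn_integral_mono) (auto intro: ennreal_leI)
        also have "\<dots> \<le> ennreal C" by (rule mom)
        finally show ?thesis using C by (simp add: o_def)
      qed
      then show "\<exists>N. \<forall>n\<ge>N. (\<integral>x. min (exp x) (real k) \<partial>((M \<circ> r) n)) \<le> C" by blast
    qed
    have "(\<integral>\<^sup>+x. ennreal (norm (exp x)) \<partial>N) = (\<integral>\<^sup>+x. (liminf (\<lambda>k. ennreal (min (exp x) (real k)))) \<partial>N)"
    proof (rule nn_integral_cong)
      fix x :: real
      have "\<forall>\<^sub>F k in sequentially. real k \<ge> exp x"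
        using filterlim_real_sequentially by (auto simp: filterlim_at_top)
      then have "\<forall>\<^sub>F k in sequentially. ennreal (min (exp x) (real k)) = ennreal (norm (exp x))"
        by eventually_elim (auto simp: min_def)
      then have "(\<lambda>k. ennreal (min (exp x) (real k))) \<longlonglongrightarrow> ennreal (norm (exp x))" by (rule tendsto_eventually)
      then show "ennreal (norm (exp x)) = liminf (\<lambda>k. ennreal (min (exp x) (real k)))"
        by (intro lim_imp_Liminf[symmetric]) auto
    qed
    also have "\<dots> \<le> liminf (\<lambda>k. \<integral>\<^sup>+x. ennreal (min (exp x) (real k)) \<partial>N)"
      by (rule nn_integral_liminf) auto
    also have "\<dots> \<le> liminf (\<lambda>k::nat. ennreal C)"
    proof (intro Liminf_mono always_eventually allI)
      fix k
      have "(\<integral>\<^sup>+x. ennreal (min (exp x) (real k)) \<partial>N) = ennreal (\<integral>x. min (exp x) (real k) \<partial>N)"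
        by (intro nn_integral_eq_integral N.integrable_const_bound[where B = "real k"]) auto
      then show "(\<integral>\<^sup>+x. ennreal (min (exp x) (real k)) \<partial>N) \<le> ennreal C" using bd[of k] by (simp add: ennreal_leI)
    qed
    also have "\<dots> = ennreal C" by (intro Liminf_const) simp
    finally show "(\<integral>\<^sup>+x. ennreal (norm (exp x)) \<partial>N) < \<infinity>" by (simp add: le_less_trans)
  qed simp
  ultimately show ?thesis using N by blast
qed

text \<open>An affine image of the standard normal law, which is the point mass at \<open>a\<close> when \<open>b = 0\<close>.\<close>

lemma gaussian_part:
  fixes a b :: real
  shows "\<exists>N. real_distribution N \<and> (\<forall>t. char N t = exp (\<i> * of_real (a * t) - of_real (b\<^sup>2 * t\<^sup>2 / 2))) \<and>
    (\<integral>\<^sup>+x. ennreal (exp (1 * x)) \<partial>N) < \<infinity>"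
proof -
  interpret S: real_distribution std_normal_distribution by (rule real_dist_normal_dist)
  let ?N = "distr std_normal_distribution borel (\<lambda>x. a + b * x)"
  have "real_distribution ?N" by (rule S.real_distribution_distr) simp
  moreover have "char ?N t = exp (\<i> * of_real (a * t) - of_real (b\<^sup>2 * t\<^sup>2 / 2))" for t
  proof -
    have "char ?N t = (\<integral>x. iexp (t * (a + b * x)) \<partial>std_normal_distribution)"
      unfolding char_def by (subst integral_distr) auto
    also have "\<dots> = (\<integral>x. exp (\<i> * of_real (a * t)) * iexp ((t * b) * x) \<partial>std_normal_distribution)"
      by (intro Bochner_Integration.integral_cong) (auto simp: exp_add[symmetric] algebra_simps)
    also have "\<dots> = exp (\<i> * of_real (a * t)) * char std_normal_distribution (t * b)" by (simp add: char_def)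
    also have "\<dots> = exp (\<i> * of_real (a * t)) * exp (of_real (- ((t * b)\<^sup>2 / 2)))"
      by (simp add: char_std_normal_distribution exp_of_real[symmetric])
    finally show ?thesis by (simp add: exp_add[symmetric] power_mult_distrib mult.commute)
  qed
  moreover have "(\<integral>\<^sup>+x. ennreal (exp (1 * x)) \<partial>?N) < \<infinity>"
  proof -
    have eq: "std_normal_density x * exp (a + b * x) = exp (a + b\<^sup>2 / 2) * normal_density b 1 x" for x
    proof -
      have "- x\<^sup>2 / 2 + (a + b * x) = (a + b\<^sup>2 / 2) + (- (x - b)\<^sup>2 / 2)"
        by (simp add: power2_eq_square field_simps)
      then show ?thesis unfolding normal_density_def
        by (simp add: exp_add[symmetric])
    qed
    have "(\<integral>\<^sup>+x. ennreal (exp (1 * x)) \<partial>?N) = (\<integral>\<^sup>+x. ennreal (exp (a + b * x)) \<partial>std_normal_distribution)"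
      by (subst nn_integral_distr) auto
    also have "\<dots> = (\<integral>\<^sup>+x. ennreal (exp (a + b\<^sup>2 / 2)) * ennreal (normal_density b 1 x) \<partial>lborel)"
      by (subst nn_integral_density) (auto simp: ennreal_mult[symmetric] eq)
    also have "\<dots> = ennreal (exp (a + b\<^sup>2 / 2)) * (\<integral>\<^sup>+x. ennreal (normal_density b 1 x) \<partial>lborel)"
      by (rule nn_integral_cmult) simp
    also have "(\<integral>\<^sup>+x. ennreal (normal_density b 1 x) \<partial>lborel) = 1"
      by (subst nn_integral_eq_integral) auto
    finally show ?thesis by simp
  qed
  ultimately show ?thesis by blast
qed

lemma integrable_indicator_mult:
  fixes f :: "real \<Rightarrow> 'b::{banach, second_countable_topology}"
  assumes "sets \<nu> = sets borel" "J \<in> sets borel" "emeasure \<nu> J < \<infinity>" "f \<in> borel_measurable borel"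
    and B: "\<And>y. y \<in> J \<Longrightarrow> norm (f y) \<le> B"
  shows "integrable \<nu> (\<lambda>y. indicator J y *\<^sub>R f y)"
proof (rule Bochner_Integration.integrable_bound)
  have [measurable_cong]: "sets \<nu> = sets borel" by fact
  have [measurable]: "J \<in> sets borel" "f \<in> borel_measurable borel" by fact+
  have "integrable \<nu> (indicator J :: real \<Rightarrow> real)" using assms by (intro integrable_real_indicator) auto
  then show "integrable \<nu> (\<lambda>y. \<bar>B\<bar> * indicator J y)" by simp
  show "(\<lambda>y. indicator J y *\<^sub>R f y) \<in> borel_measurable \<nu>" by measurable
  show "AE y in \<nu>. norm (indicator J y *\<^sub>R f y) \<le> norm (\<bar>B\<bar> * indicator J y)"
    using B by (intro AE_I2) (force split: split_indicator)
qed

text \<open>The compensated compound Poisson laws of the jumps in \<open>{y. 1 / (n + 1) < \<bar>y\<bar> \<and> \<bar>y\<bar> \<le> L}\<close> have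
  exponential moments bounded by \<open>exp (exp L * V)\<close>, where \<open>V\<close> is the second moment of \<open>\<nu>\<close> on
  \<open>{-L..L}\<close>; any cluster point has the required characteristic function.\<close>

lemma small_jumps_part:
  assumes lm: "levy_measure \<nu>" and L: "L > 0"
  shows "\<exists>N. real_distribution N \<and>
    char N = (\<lambda>t. exp (\<integral>y. indicator {-L..L} y *\<^sub>R (iexp (t * y) - 1 - \<i> * of_real (t * y)) \<partial>\<nu>)) \<and> integrable N exp"
proof -
  note sets_nu = levy_measure_sets[OF lm]
  note [measurable_cong] = sets_nu
  note m2 = levy_measure_second_moment[OF lm L]
  define V where "V = (\<integral>y. indicator {-L..L} y * y\<^sup>2 \<partial>\<nu>)"
  define J where "J n = {y::real. 1 / real (Suc n) < \<bar>y\<bar> \<and> \<bar>y\<bar> \<le> L}" for n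
  have [measurable]: "J n \<in> sets borel" for n unfolding J_def by measurable
  have fin: "emeasure \<nu> (J n) < \<infinity>" for n
    by (rule levy_measure_finite_away[OF lm, of "1 / real (Suc n)"]) (auto simp: J_def)
  have JL: "indicator (J n) y \<le> (indicator {-L..L} y :: real)" for n y
    by (auto simp: J_def split: split_indicator)
  define m where "m n = (\<integral>y. indicator (J n) y *\<^sub>R y \<partial>\<nu>)" for n
  note iJ = integrable_indicator_mult[OF sets_nu \<open>\<And>n. J n \<in> sets borel\<close> fin]
  have JD: "\<bar>y\<bar> \<le> L" if "y \<in> J n" for y n using that by (simp add: J_def)
  define K where "K n = cpoisson \<nu> (J n)" for n
  have K: "real_distribution (K n)" for n unfolding K_def by (rule real_distribution_cpoisson[OF sets_nu _ fin]) simp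
  define M where "M n = distr (K n) borel (\<lambda>x. x + (- m n))" for n
  have M: "real_distribution (M n)" for n
  proof -
    interpret real_distribution "K n" by (rule K)
    show ?thesis unfolding M_def by (rule real_distribution_distr) simp
  qed
  have i1: "integrable \<nu> (\<lambda>y. indicator (J n) y *\<^sub>R y)" for n by (rule iJ[where B = L]) (auto dest: JD)
  have chM: "char (M n) t = exp (\<integral>y. indicator (J n) y *\<^sub>R (iexp (t * y) - 1 - \<i> * of_real (t * y)) \<partial>\<nu>)" for n t
  proof -
    have i2: "integrable \<nu> (\<lambda>y. indicator (J n) y *\<^sub>R (iexp (t * y) - 1))"
      by (rule iJ[where B = 2]) (auto intro: iexp_remainder0 simp del: of_real_mult)
    have i3: "integrable \<nu> (\<lambda>y. indicator (J n) y *\<^sub>R (\<i> * of_real (t * y)))"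
      by (rule iJ[where B = "\<bar>t\<bar> * L"]) (auto simp: norm_mult dest: JD intro!: mult_left_mono)
    have "(\<integral>y. indicator (J n) y *\<^sub>R (\<i> * of_real (t * y)) \<partial>\<nu>) = (\<integral>y. (\<i> * of_real t) * of_real (indicator (J n) y *\<^sub>R y) \<partial>\<nu>)"
      by (intro Bochner_Integration.integral_cong) (auto simp: scaleR_conv_of_real)
    also have "\<dots> = (\<i> * of_real t) * of_real (m n)"
      unfolding m_def by (simp only: integral_mult_right_zero integral_complex_of_real)
    finally have "(\<integral>y. indicator (J n) y *\<^sub>R (\<i> * of_real (t * y)) \<partial>\<nu>) = \<i> * of_real (t * m n)" by simp
    then have "(\<integral>y. indicator (J n) y *\<^sub>R (iexp (t * y) - 1) \<partial>\<nu>) + \<i> * of_real (t * - m n) =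
      (\<integral>y. indicator (J n) y *\<^sub>R (iexp (t * y) - 1) - indicator (J n) y *\<^sub>R (\<i> * of_real (t * y)) \<partial>\<nu>)"
      by (subst Bochner_Integration.integral_diff[OF i2 i3]) simp
    also have "\<dots> = (\<integral>y. indicator (J n) y *\<^sub>R (iexp (t * y) - 1 - \<i> * of_real (t * y)) \<partial>\<nu>)"
      by (intro Bochner_Integration.integral_cong) (auto simp: scaleR_diff_right)
    finally show ?thesis unfolding M_def char_distr_shift[OF K]
      unfolding K_def char_cpoisson[OF sets_nu _ fin, simplified]
      by (simp add: exp_add[symmetric] add.commute)
  qed
  define C where "C = exp (exp L * V)"
  have V: "V \<ge> 0" unfolding V_def by (intro integral_nonneg_AE) auto
  have mom: "(\<integral>\<^sup>+x. ennreal (exp (\<gamma> * x)) \<partial>(M n)) \<le> ennreal C" if g: "\<bar>\<gamma>\<bar> = 1" for \<gamma> n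
  proof -
    have gL: "\<bar>\<gamma> * y\<bar> = \<bar>y\<bar>" for y using g by (simp add: abs_mult)
    have i4: "integrable \<nu> (\<lambda>y. indicator (J n) y *\<^sub>R exp (\<gamma> * y))"
    proof (rule iJ[where B = "exp L"])
      fix y assume "y \<in> J n"
      then have "\<bar>y\<bar> \<le> L" by (rule JD)
      then have "\<gamma> * y \<le> L" using gL[of y] by linarith
      then show "norm (exp (\<gamma> * y)) \<le> exp L" by simp
    qed simp
    have i5: "integrable \<nu> (\<lambda>y. indicator (J n) y * (exp (\<gamma> * y) - 1))"
    proof -
      have "integrable \<nu> (\<lambda>y. indicator (J n) y *\<^sub>R (1::real))" by (rule iJ[where B = 1]) auto
      from Bochner_Integration.integrable_diff[OF i4 this] show ?thesis by (simp add: algebra_simps)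
    qed
    have "(\<integral>\<^sup>+x. ennreal (exp (\<gamma> * x)) \<partial>(M n)) = (\<integral>\<^sup>+x. ennreal (exp (\<gamma> * (x + (- m n)))) \<partial>(K n))"
    proof -
      interpret real_distribution "K n" by (rule K)
      show ?thesis unfolding M_def by (subst nn_integral_distr) auto
    qed
    also have "\<dots> = (\<integral>\<^sup>+x. ennreal (exp (- \<gamma> * m n)) * ennreal (exp (\<gamma> * x)) \<partial>(K n))"
      by (intro nn_integral_cong) (simp add: ennreal_mult[symmetric] exp_add[symmetric] algebra_simps)
    also have "\<dots> = ennreal (exp (- \<gamma> * m n)) * (\<integral>\<^sup>+x. ennreal (exp (\<gamma> * x)) \<partial>(K n))"
      by (intro nn_integral_cmult) (simp add: real_distribution.events_eq_borel[OF K] cong: measurable_cong_sets)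
    also have "(\<integral>\<^sup>+x. ennreal (exp (\<gamma> * x)) \<partial>(K n)) = ennreal (exp (\<integral>y. indicator (J n) y * (exp (\<gamma> * y) - 1) \<partial>\<nu>))"
      unfolding K_def by (rule nn_integral_exp_cpoisson[OF sets_nu _ fin]) (use i4 in auto)
    also have "ennreal (exp (- \<gamma> * m n)) * \<dots> = ennreal (exp ((\<integral>y. indicator (J n) y * (exp (\<gamma> * y) - 1) \<partial>\<nu>) - \<gamma> * m n))"
      by (simp add: ennreal_mult[symmetric] exp_add[symmetric] algebra_simps)
    also have "(\<integral>y. indicator (J n) y * (exp (\<gamma> * y) - 1) \<partial>\<nu>) - \<gamma> * m n =
        (\<integral>y. indicator (J n) y * (exp (\<gamma> * y) - 1) - \<gamma> * (indicator (J n) y *\<^sub>R y) \<partial>\<nu>)"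
      unfolding m_def using i1[of n] i5 by (subst Bochner_Integration.integral_diff) auto
    also have "\<dots> \<le> (\<integral>y. exp L * (indicator {-L..L} y * y\<^sup>2) \<partial>\<nu>)"
    proof (rule integral_mono)
      fix y
      show "indicator (J n) y * (exp (\<gamma> * y) - 1) - \<gamma> * (indicator (J n) y *\<^sub>R y) \<le> exp L * (indicator {-L..L} y * y\<^sup>2)"
      proof (cases "y \<in> J n")
        case True
        then have yL: "\<bar>y\<bar> \<le> L" by (simp add: J_def)
        have "exp (\<gamma> * y) - 1 - \<gamma> * y \<le> (\<gamma> * y)\<^sup>2 * exp \<bar>\<gamma> * y\<bar>" by (rule exp_remainder)
        also have "(\<gamma> * y)\<^sup>2 = y\<^sup>2" using gL[of y] by (metis power2_abs)
        also have "y\<^sup>2 * exp \<bar>\<gamma> * y\<bar> \<le> y\<^sup>2 * exp L" unfolding gL using yL by (intro mult_left_mono) auto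
        finally show ?thesis using True yL by (simp add: algebra_simps indicator_def abs_le_iff)
      qed simp
    qed (use i1[of n] i5 m2 in auto)
    also have "\<dots> = exp L * V" unfolding V_def by simp
    finally show ?thesis unfolding C_def by (simp add: ennreal_leI)
  qed
  show ?thesis
  proof (rule exp_moments_limit[OF M, where C = C])
    show "(\<lambda>n. char (M n) t) \<longlonglongrightarrow> exp (\<integral>y. indicator {-L..L} y *\<^sub>R (iexp (t * y) - 1 - \<i> * of_real (t * y)) \<partial>\<nu>)" for t
      unfolding chM
    proof (intro tendsto_exp integral_dominated_convergence[where w = "\<lambda>y. t\<^sup>2 / 2 * (indicator {-L..L} y * y\<^sup>2)"])
      show "AE y in \<nu>. (\<lambda>n. indicator (J n) y *\<^sub>R (iexp (t * y) - 1 - \<i> * of_real (t * y))) \<longlonglongrightarrow>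
          indicator {-L..L} y *\<^sub>R (iexp (t * y) - 1 - \<i> * of_real (t * y))"
      proof (rule AE_I2)
        fix y
        show "(\<lambda>n. indicator (J n) y *\<^sub>R (iexp (t * y) - 1 - \<i> * of_real (t * y))) \<longlonglongrightarrow>
          indicator {-L..L} y *\<^sub>R (iexp (t * y) - 1 - \<i> * of_real (t * y))"
        proof (cases "y = 0")
          case False
          have "\<forall>\<^sub>F n in sequentially. 1 / real (Suc n) < \<bar>y\<bar>"
            by (rule order_tendstoD(2)[OF LIMSEQ_Suc[OF lim_1_over_n]]) (use False in auto)
          then have "\<forall>\<^sub>F n in sequentially. indicator (J n) y = (indicator {-L..L} y :: real)"
            by eventually_elim (auto simp: J_def split: split_indicator)
          then show ?thesis by (intro tendsto_eventually) (auto elim: eventually_mono)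
        qed simp
      qed
      show "AE y in \<nu>. norm (indicator (J n) y *\<^sub>R (iexp (t * y) - 1 - \<i> * of_real (t * y))) \<le> t\<^sup>2 / 2 * (indicator {-L..L} y * y\<^sup>2)" for n
      proof (rule AE_I2)
        fix y
        have "norm (indicator (J n) y *\<^sub>R (iexp (t * y) - 1 - \<i> * of_real (t * y))) \<le> indicator (J n) y * ((t * y)\<^sup>2 / 2)"
          using iexp_remainder[of "t * y"] by (simp split: split_indicator)
        also have "\<dots> \<le> indicator {-L..L} y * ((t * y)\<^sup>2 / 2)" using JL by (intro mult_right_mono) auto
        finally show "norm (indicator (J n) y *\<^sub>R (iexp (t * y) - 1 - \<i> * of_real (t * y))) \<le> t\<^sup>2 / 2 * (indicator {-L..L} y * y\<^sup>2)"
          by (simp add: power_mult_distrib mult_ac)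
      qed
    qed (use m2 in auto)
  qed (use mom[of 1] mom[of "-1"] in \<open>auto simp: C_def\<close>)
qed

lemma integrable_exp_nn:
  assumes "real_distribution N"
  shows "integrable N exp \<longleftrightarrow> (\<integral>\<^sup>+x. ennreal (exp (1 * x)) \<partial>N) < \<infinity>"
proof -
  interpret real_distribution N by fact
  show ?thesis by (simp add: integrable_iff_bounded)
qed

lemma integrable_exp_convolution:
  assumes "real_distribution M" "real_distribution N" "integrable M exp" "integrable N exp"
  shows "integrable (M \<star> N) exp"
  using assms unfolding integrable_exp_nn[OF assms(1)] integrable_exp_nn[OF assms(2)]
    integrable_exp_nn[OF real_distribution_convolution[OF assms(1,2)]] nn_integral_exp_convolution[OF assms(1,2)]
  by (simp add: ennreal_mult_less_top)

lemma bounded_jumps_part: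
  fixes a b :: real
  assumes lm: "levy_measure \<nu>" and L: "L > 0"
  shows "\<exists>N. real_distribution N \<and> integrable N exp \<and>
    (\<forall>t. char N t = exp ((\<integral>y. indicator {-L..L} y *\<^sub>R (iexp (t * y) - 1 - \<i> * of_real (t * y)) \<partial>\<nu>)
      + \<i> * of_real (a * t) - of_real (b\<^sup>2 * t\<^sup>2 / 2)))"
proof -
  from small_jumps_part[OF lm L] obtain N1 where N1: "real_distribution N1" "integrable N1 exp"
    "char N1 = (\<lambda>t. exp (\<integral>y. indicator {-L..L} y *\<^sub>R (iexp (t * y) - 1 - \<i> * of_real (t * y)) \<partial>\<nu>))" by blast
  from gaussian_part[of a b] obtain N2 where N2: "real_distribution N2"
    "\<And>t. char N2 t = exp (\<i> * of_real (a * t) - of_real (b\<^sup>2 * t\<^sup>2 / 2))" "(\<integral>\<^sup>+x. ennreal (exp (1 * x)) \<partial>N2) < \<infinity>" by blast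
  have "integrable N2 exp" using N2 integrable_exp_nn by blast
  then have "integrable (N1 \<star> N2) exp" by (intro integrable_exp_convolution N1 N2)
  moreover have "char (N1 \<star> N2) t = exp ((\<integral>y. indicator {-L..L} y *\<^sub>R (iexp (t * y) - 1 - \<i> * of_real (t * y)) \<partial>\<nu>)
      + \<i> * of_real (a * t) - of_real (b\<^sup>2 * t\<^sup>2 / 2))" for t
    unfolding char_convolution[OF N1(1) N2(1)] N1(3) N2(2) exp_add[symmetric] by (simp add: add_diff_eq)
  ultimately show ?thesis using real_distribution_convolution[OF N1(1) N2(1)] by blast
qed

text \<open>Moving the truncation of the compensator from \<open>1\<close> to \<open>A\<close> only changes the drift.\<close>

lemma levy_khintchine_exponent_split:
  assumes lm: "levy_measure \<nu>" and A: "A \<ge> 1"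
  shows "\<exists>a'. \<forall>t. levy_khintchine_exponent a b \<nu> t =
    (\<integral>y. indicator (- {-A..A}) y *\<^sub>R (iexp (t * y) - 1) \<partial>\<nu>) +
    ((\<integral>y. indicator {-A..A} y *\<^sub>R (iexp (t * y) - 1 - \<i> * of_real (t * y)) \<partial>\<nu>)
      + \<i> * of_real (a' * t) - of_real (b\<^sup>2 * t\<^sup>2 / 2))"
proof -
  note sets_nu = levy_measure_sets[OF lm]
  note [measurable_cong] = sets_nu
  let ?M = "{-A..A} - {-1..1}"
  have finM: "emeasure \<nu> ?M < \<infinity>" by (rule levy_measure_finite_away[OF lm, of 1]) auto
  have finT: "emeasure \<nu> (- {-A..A}) < \<infinity>" by (rule levy_measure_finite_away[OF lm, of 1]) (use A in auto)
  define d where "d = (\<integral>y. indicator ?M y *\<^sub>R y \<partial>\<nu>)"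
  show ?thesis
  proof (intro exI[of _ "a + d"] allI)
    fix t
    let ?f1 = "\<lambda>y. indicator (- {-A..A}) y *\<^sub>R (iexp (t * y) - 1)"
    let ?f2 = "\<lambda>y. indicator {-A..A} y *\<^sub>R (iexp (t * y) - 1 - \<i> * of_real (t * y))"
    let ?f3 = "\<lambda>y. (\<i> * of_real t) * of_real (indicator ?M y *\<^sub>R y)"
    have i1: "integrable \<nu> ?f1"
      by (rule integrable_indicator_mult[OF sets_nu _ finT, where B = 2]) (auto intro: iexp_remainder0 simp del: of_real_mult)
    have i2: "integrable \<nu> ?f2"
    proof (rule Bochner_Integration.integrable_bound)
      show "integrable \<nu> (\<lambda>y. t\<^sup>2 / 2 * (indicator {-A..A} y * y\<^sup>2))"
        using levy_measure_second_moment[OF lm, of A] A by simp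
      show "AE y in \<nu>. norm (?f2 y) \<le> norm (t\<^sup>2 / 2 * (indicator {-A..A} y * y\<^sup>2))"
        using iexp_remainder[of "t * y" for y]
        by (intro AE_I2) (auto simp: power_mult_distrib mult_ac split: split_indicator)
    qed simp
    have i3': "integrable \<nu> (\<lambda>y. indicator ?M y *\<^sub>R y)"
      by (rule integrable_indicator_mult[OF sets_nu _ finM, where B = A]) auto
    then have i3: "integrable \<nu> ?f3" by (intro integrable_mult_right integrable_of_real)
    have "(CLINT y|\<nu>. iexp (t * y) - 1 - \<i> * of_real (t * y * indicator {-1..1} y)) = (\<integral>y. ?f1 y + ?f2 y + ?f3 y \<partial>\<nu>)"
      using A by (intro Bochner_Integration.integral_cong refl) (auto split: split_indicator)
    also have "\<dots> = integral\<^sup>L \<nu> ?f1 + integral\<^sup>L \<nu> ?f2 + integral\<^sup>L \<nu> ?f3"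
      by (subst Bochner_Integration.integral_add[OF Bochner_Integration.integrable_add[OF i1 i2] i3])
         (subst Bochner_Integration.integral_add[OF i1 i2], rule refl)
    also have "integral\<^sup>L \<nu> ?f3 = \<i> * of_real t * of_real d"
      unfolding d_def by (simp only: integral_mult_right_zero integral_complex_of_real)
    finally show "levy_khintchine_exponent a b \<nu> t = integral\<^sup>L \<nu> ?f1 + (integral\<^sup>L \<nu> ?f2
      + \<i> * of_real ((a + d) * t) - of_real (b\<^sup>2 * t\<^sup>2 / 2))"
      unfolding levy_khintchine_exponent_def by (simp add: algebra_simps)
  qed
qed

text \<open>The jumps larger than \<open>A\<close> split off as a compound Poisson factor. Of the remaining factor both the
  exponential moment and the explicit exponent are recorded: the first serves the asymptotics, the second the
  deconvolution.\<close>

lemma levy_decomposition: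
  assumes mu: "real_distribution \<mu>" and hl: "has_levy_measure \<mu> \<nu>" and A: "A \<ge> 1"
  shows "\<exists>N a b. real_distribution N \<and> integrable N exp \<and>
    (\<forall>t. char N t = exp ((\<integral>y. indicator {-A..A} y *\<^sub>R (iexp (t * y) - 1 - \<i> * of_real (t * y)) \<partial>\<nu>)
      + \<i> * of_real (a * t) - of_real (b\<^sup>2 * t\<^sup>2 / 2))) \<and>
    \<mu> = (cpoisson \<nu> (- {-A..A}) \<star> N)"
proof -
  from hl obtain a b where lm: "levy_measure \<nu>" and ch: "\<And>z. char \<mu> z = exp (levy_khintchine_exponent a b \<nu> z)"
    unfolding has_levy_measure_def by blast
  note sets_nu = levy_measure_sets[OF lm]
  have fin: "emeasure \<nu> (- {-A..A}) < \<infinity>" by (rule levy_measure_finite_away[OF lm, of 1]) (use A in auto)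
  from levy_khintchine_exponent_split[OF lm A, of a b] obtain a' where a': "\<And>t. levy_khintchine_exponent a b \<nu> t =
    (\<integral>y. indicator (- {-A..A}) y *\<^sub>R (iexp (t * y) - 1) \<partial>\<nu>) +
    ((\<integral>y. indicator {-A..A} y *\<^sub>R (iexp (t * y) - 1 - \<i> * of_real (t * y)) \<partial>\<nu>)
      + \<i> * of_real (a' * t) - of_real (b\<^sup>2 * t\<^sup>2 / 2))" by blast
  from bounded_jumps_part[OF lm, of A a' b] A obtain N where N: "real_distribution N" "integrable N exp"
    "\<And>t. char N t = exp ((\<integral>y. indicator {-A..A} y *\<^sub>R (iexp (t * y) - 1 - \<i> * of_real (t * y)) \<partial>\<nu>)
      + \<i> * of_real (a' * t) - of_real (b\<^sup>2 * t\<^sup>2 / 2))" by auto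
  have P: "real_distribution (cpoisson \<nu> (- {-A..A}))" by (rule real_distribution_cpoisson[OF sets_nu _ fin]) simp
  have "\<mu> = (cpoisson \<nu> (- {-A..A}) \<star> N)"
  proof (rule Levy_uniqueness[OF mu real_distribution_convolution[OF P N(1)]])
    show "char \<mu> = char (cpoisson \<nu> (- {-A..A}) \<star> N)"
    proof
      fix t
      have "char (cpoisson \<nu> (- {-A..A})) t = exp (\<integral>y. indicator (- {-A..A}) y *\<^sub>R (iexp (t * y) - 1) \<partial>\<nu>)"
        by (rule char_cpoisson[OF sets_nu _ fin]) simp
      then show "char \<mu> t = char (cpoisson \<nu> (- {-A..A}) \<star> N) t"
        unfolding char_convolution[OF P N(1)] ch a' N(3) by (simp add: exp_add[symmetric])
    qed
  qed
  then show ?thesis using N by blast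
qed

text \<open>Negative jumps may be kept in the light-tailed factor, since they only decrease the exponential
  moment.\<close>

lemma positive_jumps_decomposition:
  assumes mu: "real_distribution \<mu>" and hl: "has_levy_measure \<mu> \<nu>" and A: "A \<ge> 1"
  shows "\<exists>N. real_distribution N \<and> integrable N exp \<and> \<mu> = (cpoisson \<nu> {A<..} \<star> N)"
proof -
  from hl have lm: "levy_measure \<nu>" by (simp add: has_levy_measure_def)
  note sets_nu = levy_measure_sets[OF lm]
  from levy_decomposition[OF assms] obtain N where N: "real_distribution N" "integrable N exp"
    "\<mu> = (cpoisson \<nu> (- {-A..A}) \<star> N)" by blast
  have fin: "emeasure \<nu> (- {-A..A}) < \<infinity>" "emeasure \<nu> {..<-A} < \<infinity>" "emeasure \<nu> {A<..} < \<infinity>"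
    by (rule levy_measure_finite_away[OF lm, of 1]; use A in auto)+
  have P: "real_distribution (cpoisson \<nu> {A<..})" "real_distribution (cpoisson \<nu> {..<-A})"
    "real_distribution (cpoisson \<nu> (- {-A..A}))"
    by (auto intro!: real_distribution_cpoisson sets_nu fin)
  have eq: "cpoisson \<nu> (- {-A..A}) = (cpoisson \<nu> {A<..} \<star> cpoisson \<nu> {..<-A})"
  proof (rule Levy_uniqueness[OF P(3) real_distribution_convolution[OF P(1,2)]], rule ext)
    fix t
    let ?f = "\<lambda>J y. indicator J y *\<^sub>R (iexp (t * y) - 1)"
    have "integrable \<nu> (?f {A<..})"
      by (rule integrable_indicator_mult[OF sets_nu _ fin(3), where B = 2]) (auto intro: iexp_remainder0 simp del: of_real_mult)
    moreover have "integrable \<nu> (?f {..<-A})"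
      by (rule integrable_indicator_mult[OF sets_nu _ fin(2), where B = 2]) (auto intro: iexp_remainder0 simp del: of_real_mult)
    ultimately have "integral\<^sup>L \<nu> (?f {A<..}) + integral\<^sup>L \<nu> (?f {..<-A}) = (\<integral>y. ?f {A<..} y + ?f {..<-A} y \<partial>\<nu>)" by simp
    also have "\<dots> = integral\<^sup>L \<nu> (?f (- {-A..A}))"
      using A by (intro Bochner_Integration.integral_cong refl) (auto split: split_indicator)
    finally show "char (cpoisson \<nu> (- {-A..A})) t = char (cpoisson \<nu> {A<..} \<star> cpoisson \<nu> {..<-A}) t"
      unfolding char_convolution[OF P(1,2)]
      by (simp add: char_cpoisson[OF sets_nu _ fin(1)] char_cpoisson[OF sets_nu _ fin(2)]
          char_cpoisson[OF sets_nu _ fin(3)] exp_add[symmetric])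
  qed
  have e: "integrable (cpoisson \<nu> {..<-A}) exp"
  proof -
    have [measurable_cong]: "sets \<nu> = sets borel" by (rule sets_nu)
    have "integrable \<nu> (\<lambda>y. indicator {..<-A} y *\<^sub>R exp (1 * y))"
      by (rule integrable_indicator_mult[OF sets_nu _ fin(2), where B = 1]) (use A in auto)
    then have "(\<integral>\<^sup>+x. ennreal (exp (1 * x)) \<partial>(cpoisson \<nu> {..<-A})) =
      ennreal (exp (\<integral>y. indicator {..<-A} y * (exp (1 * y) - 1) \<partial>\<nu>))"
      by (intro nn_integral_exp_cpoisson[OF sets_nu _ fin(2)]) auto
    then show ?thesis unfolding integrable_exp_nn[OF P(2)] by simp
  qed
  have "\<mu> = (cpoisson \<nu> {A<..} \<star> (cpoisson \<nu> {..<-A} \<star> N))"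
    unfolding N(3) eq using fbm_real_distribution[OF P(1)] fbm_real_distribution[OF P(2)] fbm_real_distribution[OF N(1)]
    by (intro convolution_associative[symmetric])
      (auto simp: finite_borel_measure_def finite_borel_measure_axioms_def)
  then show ?thesis
    using real_distribution_convolution[OF P(2) N(1)] integrable_exp_convolution[OF P(2) N(1) e N(2)] by blast
qed

section \<open>Deconvolution of bounded functions\<close>

lemma integrable_inverse_1_plus_square: "integrable lborel (\<lambda>x::real. inverse (1 + x\<^sup>2))"
proof -
  have "set_integrable lborel (einterval (-\<infinity>) \<infinity>) (\<lambda>x. inverse (1 + x^2))"
  proof (rule interval_integral_FTC_nonneg[where F = arctan and A = "- pi / 2" and B = "pi / 2"])
    show "((arctan \<circ> real_of_ereal) \<longlongrightarrow> - pi / 2) (at_right (- \<infinity>))"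
      "((arctan \<circ> real_of_ereal) \<longlongrightarrow> pi / 2) (at_left \<infinity>)"
      using tendsto_arctan_at_bot tendsto_arctan_at_top by (simp_all add: ereal_tendsto_simps1)
  qed (auto intro!: derivative_eq_intros continuous_intros simp: add_nonneg_eq_0_iff field_simps)
  then show ?thesis by (simp add: set_integrable_def einterval_def)
qed

lemma integrable_of_inverse_square_bound:
  fixes f :: "real \<Rightarrow> complex"
  assumes "f \<in> borel_measurable borel" and le: "\<And>x. cmod (f x) \<le> C * inverse (1 + x\<^sup>2)"
  shows "integrable lborel f"
proof (rule Bochner_Integration.integrable_bound[where f = "\<lambda>x. C * inverse (1 + x\<^sup>2)"])
  show "integrable lborel (\<lambda>x. C * inverse (1 + x\<^sup>2))" using integrable_inverse_1_plus_square by simp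
  show "AE x in lborel. norm (f x) \<le> norm (C * inverse (1 + x\<^sup>2))"
    using order_trans[OF le abs_ge_self] by (intro AE_I2) (simp only: real_norm_def)
qed (use assms in simp)

lemma integral_whole_line_derivative_zero:
  fixes F f :: "real \<Rightarrow> complex"
  assumes F: "\<And>x. (F has_vector_derivative f x) (at x)" and f: "continuous_on UNIV f" "integrable lborel f"
    and lim: "(F \<longlongrightarrow> 0) at_top" "(F \<longlongrightarrow> 0) at_bot"
  shows "(\<integral>x. f x \<partial>lborel) = 0"
proof -
  have e: "einterval (-\<infinity>) \<infinity> = UNIV" by (auto simp: einterval_def)
  have "(LBINT x=-\<infinity>..\<infinity>. f x) = 0 - 0"
  proof (rule interval_integral_FTC_integrable[where F = F])
    show "isCont f x" for x using f(1) by (simp add: continuous_on_eq_continuous_at)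
    show "set_integrable lborel (einterval (-\<infinity>) \<infinity>) f" using f(2) by (simp add: e set_integrable_def)
    show "((F \<circ> real_of_ereal) \<longlongrightarrow> 0) (at_right (- \<infinity>))" "((F \<circ> real_of_ereal) \<longlongrightarrow> 0) (at_left \<infinity>)"
      using lim by (simp_all add: ereal_tendsto_simps1)
  qed (use F in auto)
  then show ?thesis by (simp add: interval_lebesgue_integral_def e set_lebesgue_integral_def)
qed

lemma tendsto_inverse_1_plus_square:
  "((\<lambda>x::real. C * inverse (1 + x\<^sup>2)) \<longlongrightarrow> 0) at_top" "((\<lambda>x::real. C * inverse (1 + x\<^sup>2)) \<longlongrightarrow> 0) at_bot"
proof -
  have t: "filterlim (\<lambda>x::real. 1 + x\<^sup>2) at_top F" if "filterlim (\<lambda>x::real. x\<^sup>2) at_top F" for F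
    by (rule filterlim_tendsto_add_at_top[OF tendsto_const that])
  have i: "((\<lambda>x::real. C * inverse (1 + x\<^sup>2)) \<longlongrightarrow> 0) F" if "filterlim (\<lambda>x::real. x\<^sup>2) at_top F" for F
    using tendsto_mult[OF tendsto_const[of C] tendsto_inverse_0_at_top[OF t[OF that]]] by simp
  show "((\<lambda>x::real. C * inverse (1 + x\<^sup>2)) \<longlongrightarrow> 0) at_top"
    by (rule i, rule filterlim_pow_at_top) (auto simp: filterlim_ident)
  show "((\<lambda>x::real. C * inverse (1 + x\<^sup>2)) \<longlongrightarrow> 0) at_bot"
    by (rule i, rule filterlim_pow_at_bot_even) (auto simp: filterlim_ident)
qed

lemma of_real_has_vector_derivative:
  "(h has_real_derivative h') (at t) \<Longrightarrow> ((\<lambda>x. complex_of_real (h x)) has_vector_derivative of_real h') (at t)"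
  by (rule has_vector_derivative_of_real) (simp add: has_real_derivative_iff_has_vector_derivative)

text \<open>Two integrations by parts, performed as one application of the fundamental theorem to
  \<open>iexp (u * x) * (q' x - \<i> * u * q x)\<close>.\<close>

lemma fourier_integral_decay:
  fixes q q1 q2 :: "real \<Rightarrow> complex"
  assumes d: "\<And>x. (q has_vector_derivative q1 x) (at x)" "\<And>x. (q1 has_vector_derivative q2 x) (at x)"
    and c2: "continuous_on UNIV q2"
    and b: "\<And>x. cmod (q x) \<le> C * inverse (1 + x\<^sup>2)" "\<And>x. cmod (q1 x) \<le> C * inverse (1 + x\<^sup>2)"
      "\<And>x. cmod (q2 x) \<le> C * inverse (1 + x\<^sup>2)"
  shows "\<exists>D. \<forall>u. cmod (\<integral>x. iexp (u * x) * q x \<partial>lborel) \<le> D * inverse (1 + u\<^sup>2)"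
proof -
  have c: "continuous_on UNIV q" "continuous_on UNIV q1"
    using d by (auto intro!: continuous_at_imp_continuous_on has_vector_derivative_continuous)
  have [measurable]: "q \<in> borel_measurable borel" "q1 \<in> borel_measurable borel" "q2 \<in> borel_measurable borel"
    using c c2 by (auto intro: borel_measurable_continuous_onI)
  note int = integrable_of_inverse_square_bound
  define I where "I = (\<integral>x. C * inverse (1 + x\<^sup>2) \<partial>lborel)"
  have bound: "cmod (\<integral>x. iexp (u * x) * f x \<partial>lborel) \<le> I"
    if "f \<in> borel_measurable borel" "\<And>x. cmod (f x) \<le> C * inverse (1 + x\<^sup>2)" for f u
  proof -
    have "cmod (\<integral>x. iexp (u * x) * f x \<partial>lborel) \<le> (\<integral>x. cmod (iexp (u * x) * f x) \<partial>lborel)" by simp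
    also have "\<dots> = (\<integral>x. cmod (f x) \<partial>lborel)" by (simp add: norm_mult)
    also have "\<dots> \<le> I" unfolding I_def
      using that integrable_inverse_1_plus_square by (intro integral_mono integrable_norm int) auto
    finally show ?thesis .
  qed
  have "cmod (\<integral>x. iexp (u * x) * q x \<partial>lborel) \<le> (2 * I) * inverse (1 + u\<^sup>2)" for u
  proof -
    let ?G = "\<lambda>x. iexp (u * x) * (q1 x - \<i> * of_real u * q x)"
    let ?g = "\<lambda>x. iexp (u * x) * (of_real (u\<^sup>2) * q x + q2 x)"
    have de: "((\<lambda>x. iexp (u * x)) has_vector_derivative \<i> * of_real u * iexp (u * x)) (at x)" for x
    proof -
      have "((\<lambda>x. \<i> * of_real (u * x)) has_vector_derivative \<i> * of_real u) (at x)"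
        by (intro has_vector_derivative_mult_right of_real_has_vector_derivative)
           (auto intro!: derivative_eq_intros)
      from field_vector_diff_chain_at[OF this DERIV_exp] show ?thesis by (simp add: o_def)
    qed
    have i0: "integrable lborel (\<lambda>x. iexp (u * x) * q x)" "integrable lborel (\<lambda>x. iexp (u * x) * q2 x)"
      using b by (auto intro!: int simp: norm_mult)
    have geq: "?g = (\<lambda>x. of_real (u\<^sup>2) * (iexp (u * x) * q x) + iexp (u * x) * q2 x)"
      by (auto simp: fun_eq_iff algebra_simps)
    have ig: "integrable lborel ?g" unfolding geq using i0 by auto
    have Gb: "cmod (?G x) \<le> (C + \<bar>u\<bar> * C) * inverse (1 + x\<^sup>2)" for x
    proof -
      have "cmod (?G x) = cmod (q1 x - \<i> * of_real u * q x)" by (simp add: norm_mult)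
      also have "\<dots> \<le> cmod (q1 x) + \<bar>u\<bar> * cmod (q x)"
        by (rule order_trans[OF norm_triangle_ineq4]) (simp add: norm_mult)
      also have "\<dots> \<le> C * inverse (1 + x\<^sup>2) + \<bar>u\<bar> * (C * inverse (1 + x\<^sup>2))"
        using b by (intro add_mono mult_left_mono) auto
      finally show ?thesis by (simp add: algebra_simps)
    qed
    have "(\<integral>x. ?g x \<partial>lborel) = 0"
    proof (rule integral_whole_line_derivative_zero[where F = ?G, OF _ _ ig])
      show "(?G has_vector_derivative ?g x) (at x)" for x
      proof -
        have "(?G has_vector_derivative (iexp (u * x) * (q2 x - \<i> * of_real u * q1 x) +
           (\<i> * of_real u * iexp (u * x)) * (q1 x - \<i> * of_real u * q x))) (at x)"
          by (intro has_vector_derivative_mult de has_vector_derivative_diff has_vector_derivative_mult_right d)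
        also have "iexp (u * x) * (q2 x - \<i> * of_real u * q1 x) +
           (\<i> * of_real u * iexp (u * x)) * (q1 x - \<i> * of_real u * q x) = ?g x"
          by (simp add: algebra_simps power2_eq_square)
        finally show ?thesis .
      qed
      show "continuous_on UNIV ?g" by (intro continuous_intros c c2)
      show "(?G \<longlongrightarrow> 0) at_top" "(?G \<longlongrightarrow> 0) at_bot"
        by (rule Lim_null_comparison[OF always_eventually[OF allI[OF Gb]] tendsto_inverse_1_plus_square(1)],
            rule Lim_null_comparison[OF always_eventually[OF allI[OF Gb]] tendsto_inverse_1_plus_square(2)])
    qed
    then have "of_real (u\<^sup>2) * (\<integral>x. iexp (u * x) * q x \<partial>lborel) + (\<integral>x. iexp (u * x) * q2 x \<partial>lborel) = 0"
      unfolding geq using i0 by simp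
    then have "of_real (1 + u\<^sup>2) * (\<integral>x. iexp (u * x) * q x \<partial>lborel) =
        (\<integral>x. iexp (u * x) * q x \<partial>lborel) - (\<integral>x. iexp (u * x) * q2 x \<partial>lborel)"
      by (simp add: algebra_simps eq_neg_iff_add_eq_0)
    then have "cmod (of_real (1 + u\<^sup>2) * (\<integral>x. iexp (u * x) * q x \<partial>lborel)) \<le> I + I"
      using norm_triangle_ineq4[of "\<integral>x. iexp (u * x) * q x \<partial>lborel" "\<integral>x. iexp (u * x) * q2 x \<partial>lborel"]
        bound[of q u] bound[of q2 u] b by simp
    moreover have "cmod (of_real (1 + u\<^sup>2)) = 1 + u\<^sup>2" by (simp only: norm_of_real) simp
    ultimately have "(1 + u\<^sup>2) * cmod (\<integral>x. iexp (u * x) * q x \<partial>lborel) \<le> 2 * I" by (simp only: norm_mult)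
    moreover have "1 + u\<^sup>2 > 0" by (simp add: add_pos_nonneg)
    ultimately show ?thesis by (simp add: field_simps)
  qed
  then show ?thesis by blast
qed

lemma has_vector_derivative_quadratic_remainder:
  fixes F :: "real \<Rightarrow> complex"
  assumes "\<And>h. cmod (F (t + h) - F t - of_real h * D) \<le> C * h\<^sup>2"
  shows "(F has_vector_derivative D) (at t)"
  unfolding has_vector_derivative_def has_derivative_at
proof (intro conjI bounded_linear_scaleR_left)
  show "(\<lambda>h. norm (F (t + h) - F t - h *\<^sub>R D) / norm h) \<midarrow>0\<rightarrow> 0"
  proof (rule Lim_null_comparison)
    show "\<forall>\<^sub>F h in at 0. norm (norm (F (t + h) - F t - h *\<^sub>R D) / norm h) \<le> C * \<bar>h\<bar>"
    proof (rule eventually_at_filter[THEN iffD2], rule always_eventually, intro allI impI)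
      fix h :: real assume "h \<noteq> 0"
      then show "norm (norm (F (t + h) - F t - h *\<^sub>R D) / norm h) \<le> C * \<bar>h\<bar>"
        using assms[of h] by (simp add: scaleR_conv_of_real divide_le_eq power2_eq_square abs_mult_self_eq mult.assoc)
    qed
    show "((\<lambda>h. C * \<bar>h\<bar>) \<longlongrightarrow> 0) (at 0)" by (auto intro!: tendsto_eq_intros)
  qed
qed

lemma exp_quadratic_bound: "(1 + x\<^sup>2) * exp (- (x\<^sup>2 / 2)) \<le> 8 * inverse (1 + x\<^sup>2)" for x :: real
proof -
  define y where "y = x\<^sup>2 / 2"
  have y: "y \<ge> 0" by (simp add: y_def)
  have "1 + y + y\<^sup>2 / 2 \<le> exp y" using exp_lower_Taylor_quadratic[OF y] .
  then have "(1 + 2 * y)\<^sup>2 \<le> 8 * exp y" using y by (simp add: power2_eq_square algebra_simps)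
  then have "(1 + 2 * y) * exp (- y) \<le> 8 * inverse (1 + 2 * y)"
    using y by (simp add: exp_minus field_simps power2_eq_square)
  then show ?thesis by (simp add: y_def)
qed

text \<open>The exponent of a law with bounded jumps is twice differentiable, because \<open>\<nu>\<close> has a finite second moment
  on \<open>{-L..L}\<close>. The derivatives are obtained from quadratic remainder estimates of the integrand.\<close>

lemma bounded_jumps_exponent:
  fixes \<nu> :: "real measure" and L a b :: real
  assumes lm: "levy_measure \<nu>" and L: "L > 0"
  defines "\<psi> \<equiv> \<lambda>t. (\<integral>y. indicator {-L..L} y *\<^sub>R (iexp (t * y) - 1 - \<i> * of_real (t * y)) \<partial>\<nu>)
      + \<i> * of_real (a * t) - of_real (b\<^sup>2 * t\<^sup>2 / 2)"
  shows "\<exists>\<psi>1 \<psi>2 \<sigma>. \<sigma> \<ge> 0 \<and> (\<forall>t. (\<psi> has_vector_derivative \<psi>1 t) (at t)) \<and> (\<forall>t. (\<psi>1 has_vector_derivative \<psi>2 t) (at t)) \<and>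
    continuous_on UNIV \<psi>2 \<and> (\<forall>t. cmod (\<psi>1 t) \<le> \<bar>a\<bar> + \<sigma> * \<bar>t\<bar>) \<and> (\<forall>t. cmod (\<psi>2 t) \<le> \<sigma>) \<and>
    (\<forall>t. - Re (\<psi> t) \<le> \<sigma> * t\<^sup>2 / 2)"
proof -
  note [measurable_cong] = levy_measure_sets[OF lm]
  note m2 = levy_measure_second_moment[OF lm L]
  let ?I = "indicator {-L..L} :: real \<Rightarrow> real"
  define V where "V = (\<integral>y. ?I y * y\<^sup>2 \<partial>\<nu>)"
  have V: "V \<ge> 0" unfolding V_def by (intro integral_nonneg_AE) auto
  define \<sigma> where "\<sigma> = V + b\<^sup>2"
  define f0 where "f0 t y = ?I y *\<^sub>R (iexp (t * y) - 1 - \<i> * of_real (t * y))" for t y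
  define f1 where "f1 t y = ?I y *\<^sub>R (\<i> * of_real y * (iexp (t * y) - 1))" for t y
  define f2 where "f2 t y = ?I y *\<^sub>R (- of_real (y\<^sup>2) * iexp (t * y))" for t y
  have [measurable]: "f0 t \<in> borel_measurable borel" "f1 t \<in> borel_measurable borel" "f2 t \<in> borel_measurable borel" for t
    unfolding f0_def f1_def f2_def by measurable
  have bnd: "integrable \<nu> f \<and> cmod (\<integral>y. f y \<partial>\<nu>) \<le> B * V"
    if [measurable]: "f \<in> borel_measurable borel" and le: "\<And>y. cmod (f y) \<le> B * (?I y * y\<^sup>2)" for f :: "real \<Rightarrow> complex" and B
  proof
    show i: "integrable \<nu> f"
    proof (rule Bochner_Integration.integrable_bound)
      show "integrable \<nu> (\<lambda>y. B * (?I y * y\<^sup>2))" using m2 by simp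
      show "AE y in \<nu>. norm (f y) \<le> norm (B * (?I y * y\<^sup>2))"
        using order_trans[OF le abs_ge_self] by (intro AE_I2) (simp only: real_norm_def)
    qed simp
    have "cmod (\<integral>y. f y \<partial>\<nu>) \<le> (\<integral>y. cmod (f y) \<partial>\<nu>)" by simp
    also have "\<dots> \<le> (\<integral>y. B * (?I y * y\<^sup>2) \<partial>\<nu>)" using i m2 le by (intro integral_mono) auto
    finally show "cmod (\<integral>y. f y \<partial>\<nu>) \<le> B * V" by (simp add: V_def)
  qed
  have iexp1: "cmod (iexp x - 1) \<le> \<bar>x\<bar>" for x using iexp_approx1[of x 0] by simp
  have b0: "cmod (f0 t y) \<le> (t\<^sup>2 / 2) * (?I y * y\<^sup>2)" for t y
    using iexp_remainder[of "t * y"] by (auto simp: f0_def power_mult_distrib mult_ac split: split_indicator)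
  have b1: "cmod (f1 t y) \<le> \<bar>t\<bar> * (?I y * y\<^sup>2)" for t y
  proof -
    have "cmod (\<i> * of_real y * (iexp (t * y) - 1)) \<le> \<bar>y\<bar> * \<bar>t * y\<bar>"
      unfolding norm_mult using iexp1[of "t * y"] by (simp add: mult_left_mono)
    then show ?thesis by (auto simp: f1_def power2_eq_square abs_mult mult_ac split: split_indicator)
  qed
  have b2: "cmod (f2 t y) \<le> 1 * (?I y * y\<^sup>2)" for t y
    by (auto simp: f2_def norm_mult norm_power split: split_indicator)
  note i0 = bnd[OF _ b0, simplified, THEN conjunct1] and i1 = bnd[OF _ b1, simplified, THEN conjunct1]
    and i2 = bnd[OF _ b2, simplified, THEN conjunct1]
  define g0 g1 g2 where "g0 t = (\<integral>y. f0 t y \<partial>\<nu>)" and "g1 t = (\<integral>y. f1 t y \<partial>\<nu>)" and "g2 t = (\<integral>y. f2 t y \<partial>\<nu>)" for t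
  have d0: "(g0 has_vector_derivative g1 t) (at t)" for t
  proof (rule has_vector_derivative_quadratic_remainder)
    fix h :: real
    have "cmod (\<integral>y. f0 (t + h) y - f0 t y - of_real h * f1 t y \<partial>\<nu>) \<le> (h\<^sup>2 / 2) * V"
    proof (rule bnd[THEN conjunct2])
      fix y
      have "f0 (t + h) y - f0 t y - of_real h * f1 t y = ?I y *\<^sub>R (iexp (t * y) * (iexp (h * y) - 1 - \<i> * of_real (h * y)))"
        by (auto simp: f0_def f1_def exp_add algebra_simps split: split_indicator)
      then show "cmod (f0 (t + h) y - f0 t y - of_real h * f1 t y) \<le> (h\<^sup>2 / 2) * (?I y * y\<^sup>2)"
        using iexp_remainder[of "h * y"] by (auto simp: norm_mult power_mult_distrib mult_ac split: split_indicator)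
    qed measurable
    also have "(\<integral>y. f0 (t + h) y - f0 t y - of_real h * f1 t y \<partial>\<nu>) = g0 (t + h) - g0 t - of_real h * g1 t"
      unfolding g0_def g1_def by (simp add: i0 i1)
    finally show "cmod (g0 (t + h) - g0 t - of_real h * g1 t) \<le> (V / 2) * h\<^sup>2" by (simp add: mult_ac)
  qed
  have d1: "(g1 has_vector_derivative g2 t) (at t)" for t
  proof (rule has_vector_derivative_quadratic_remainder)
    fix h :: real
    have "cmod (\<integral>y. f1 (t + h) y - f1 t y - of_real h * f2 t y \<partial>\<nu>) \<le> (L * h\<^sup>2 / 2) * V"
    proof (rule bnd[THEN conjunct2])
      fix y
      have eq: "f1 (t + h) y - f1 t y - of_real h * f2 t y = ?I y *\<^sub>R (\<i> * of_real y * iexp (t * y) * (iexp (h * y) - 1 - \<i> * of_real (h * y)))"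
        by (auto simp: f1_def f2_def exp_add algebra_simps power2_eq_square split: split_indicator)
      show "cmod (f1 (t + h) y - f1 t y - of_real h * f2 t y) \<le> (L * h\<^sup>2 / 2) * (?I y * y\<^sup>2)"
      proof (cases "y \<in> {-L..L}")
        case True
        then have "\<bar>y\<bar> \<le> L" by auto
        have "cmod (f1 (t + h) y - f1 t y - of_real h * f2 t y) = \<bar>y\<bar> * cmod (iexp (h * y) - 1 - \<i> * of_real (h * y))"
          unfolding eq using True by (simp add: norm_mult)
        also have "\<dots> \<le> L * ((h * y)\<^sup>2 / 2)"
          using \<open>\<bar>y\<bar> \<le> L\<close> L iexp_remainder[of "h * y"] by (intro mult_mono) auto
        finally show ?thesis using True by (simp add: power_mult_distrib mult_ac)
      qed (simp add: eq)
    qed measurable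
    also have "(\<integral>y. f1 (t + h) y - f1 t y - of_real h * f2 t y \<partial>\<nu>) = g1 (t + h) - g1 t - of_real h * g2 t"
      unfolding g1_def g2_def by (simp add: i1 i2)
    finally show "cmod (g1 (t + h) - g1 t - of_real h * g2 t) \<le> (L * V / 2) * h\<^sup>2" by (simp add: mult_ac)
  qed
  have "isCont g2 t" for t
    unfolding continuous_at_sequentially
  proof safe
    fix X :: "nat \<Rightarrow> real" assume X: "X \<longlonglongrightarrow> t"
    show "(g2 \<circ> X) \<longlonglongrightarrow> g2 t" unfolding o_def g2_def
    proof (rule integral_dominated_convergence[where w = "\<lambda>y. ?I y * y\<^sup>2"])
      show "AE y in \<nu>. (\<lambda>n. f2 (X n) y) \<longlonglongrightarrow> f2 t y"
        unfolding f2_def by (intro AE_I2 tendsto_intros X)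
      show "AE y in \<nu>. norm (f2 (X n) y) \<le> ?I y * y\<^sup>2" for n using b2 by simp
    qed (use m2 in auto)
  qed
  then have c2: "continuous_on UNIV g2" by (intro continuous_at_imp_continuous_on) auto
  define \<psi>1 where "\<psi>1 t = g1 t + \<i> * of_real a - of_real (b\<^sup>2 * t)" for t
  define \<psi>2 where "\<psi>2 t = g2 t - of_real (b\<^sup>2)" for t
  have \<psi>: "\<psi> = (\<lambda>t. g0 t + \<i> * of_real (a * t) - of_real (b\<^sup>2 * t\<^sup>2 / 2))"
    by (simp add: \<psi>_def g0_def f0_def)
  note ofr = of_real_has_vector_derivative
  show ?thesis
  proof (rule exI[of _ \<psi>1], rule exI[of _ \<psi>2], rule exI[of _ \<sigma>], intro conjI allI)
    show "\<sigma> \<ge> 0" using V by (simp add: \<sigma>_def)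
    fix t
    have "(\<psi> has_vector_derivative (g1 t + \<i> * of_real a - of_real (b\<^sup>2 * (2 * t) / 2))) (at t)"
      unfolding \<psi> by (intro has_vector_derivative_add has_vector_derivative_diff d0 has_vector_derivative_mult_right ofr)
        (auto intro!: derivative_eq_intros)
    then show "(\<psi> has_vector_derivative \<psi>1 t) (at t)" by (simp add: \<psi>1_def)
    have "(\<psi>1 has_vector_derivative (g2 t + 0 - of_real (b\<^sup>2 * 1))) (at t)"
      unfolding \<psi>1_def
      by (intro has_vector_derivative_add has_vector_derivative_diff d1 has_vector_derivative_const ofr)
         (auto intro!: derivative_eq_intros)
    then show "(\<psi>1 has_vector_derivative \<psi>2 t) (at t)" by (simp add: \<psi>2_def)
    show "continuous_on UNIV \<psi>2" unfolding \<psi>2_def by (intro continuous_intros c2)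
    have "cmod (g1 t) \<le> \<bar>t\<bar> * V" unfolding g1_def by (rule bnd[THEN conjunct2, OF _ b1]) simp
    then show "cmod (\<psi>1 t) \<le> \<bar>a\<bar> + \<sigma> * \<bar>t\<bar>"
      using norm_triangle_ineq4[of "g1 t + \<i> * of_real a" "of_real (b\<^sup>2 * t)"] norm_triangle_ineq[of "g1 t" "\<i> * of_real a"]
      by (simp add: \<psi>1_def \<sigma>_def norm_mult norm_power algebra_simps)
    have "cmod (g2 t) \<le> 1 * V" unfolding g2_def by (rule bnd[THEN conjunct2, OF _ b2]) simp
    then show "cmod (\<psi>2 t) \<le> \<sigma>"
      using norm_triangle_ineq4[of "g2 t" "of_real (b\<^sup>2)"] by (simp add: \<psi>2_def \<sigma>_def norm_power)
    have "cmod (g0 t) \<le> (t\<^sup>2 / 2) * V" unfolding g0_def by (rule bnd[THEN conjunct2, OF _ b0]) simp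
    then have "- Re (g0 t) \<le> (t\<^sup>2 / 2) * V" using abs_Re_le_cmod[of "g0 t"] by linarith
    moreover have "- Re (\<psi> t) = - Re (g0 t) + b\<^sup>2 * t\<^sup>2 / 2" unfolding \<psi>
      by (simp only: minus_complex.simps plus_complex.simps Re_complex_of_real) simp
    ultimately show "- Re (\<psi> t) \<le> \<sigma> * t\<^sup>2 / 2" by (simp add: \<sigma>_def algebra_simps)
  qed
qed

text \<open>A Gaussian narrow enough to absorb the growth of \<open>exp (- \<psi>)\<close>, which is at most Gaussian by the bound on
  the real part. The derivatives of the quotient only bring in polynomial factors, so that its Fourier
  integral is integrable.\<close>

lemma gaussian_quotient_decay:
  fixes \<psi> \<psi>1 \<psi>2 :: "real \<Rightarrow> complex" and p \<sigma> \<alpha> \<tau> :: real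
  assumes d: "\<And>t. (\<psi> has_vector_derivative \<psi>1 t) (at t)" "\<And>t. (\<psi>1 has_vector_derivative \<psi>2 t) (at t)"
    and c2: "continuous_on UNIV \<psi>2"
    and b: "\<And>t. cmod (\<psi>1 t) \<le> \<alpha> + \<sigma> * \<bar>t\<bar>" "\<And>t. cmod (\<psi>2 t) \<le> \<sigma>" "\<And>t. - Re (\<psi> t) \<le> \<sigma> * t\<^sup>2 / 2"
    and \<sigma>: "\<sigma> \<ge> 0" "\<alpha> \<ge> 0" and p: "p \<ge> \<sigma> + 1"
  defines "q \<equiv> \<lambda>x. exp (of_real (- p * (x - \<tau>)\<^sup>2) - \<psi> x)"
  shows "\<exists>D. \<forall>u. cmod (\<integral>x. iexp (u * x) * q x \<partial>lborel) \<le> D * inverse (1 + u\<^sup>2)"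
    and "\<exists>C. \<forall>x. cmod (q x) \<le> C * inverse (1 + x\<^sup>2)" and "continuous_on UNIV q"
proof -
  define G1 where "G1 x = of_real (- 2 * p * (x - \<tau>)) - \<psi>1 x" for x
  define G2 where "G2 x = of_real (- 2 * p) - \<psi>2 x" for x
  define q1 where "q1 x = q x * G1 x" for x
  define q2 where "q2 x = q x * (G1 x * G1 x + G2 x)" for x
  have p0: "p > 0" using p \<sigma> by linarith
  note ofr = of_real_has_vector_derivative
  have dG: "((\<lambda>x. of_real (- p * (x - \<tau>)\<^sup>2) - \<psi> x) has_vector_derivative G1 x) (at x)" for x
    unfolding G1_def by (intro has_vector_derivative_diff d ofr) (auto intro!: derivative_eq_intros)
  have dG1: "(G1 has_vector_derivative G2 x) (at x)" for x
    unfolding G1_def G2_def by (intro has_vector_derivative_diff d ofr) (auto intro!: derivative_eq_intros)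
  have dq: "(q has_vector_derivative q1 x) (at x)" for x
  proof -
    have "(exp has_field_derivative q x) (at (of_real (- p * (x - \<tau>)\<^sup>2) - \<psi> x))"
      unfolding q_def by (rule DERIV_exp)
    from field_vector_diff_chain_at[OF dG this] show ?thesis by (simp add: q1_def q_def o_def mult.commute)
  qed
  have dq1: "(q1 has_vector_derivative q2 x) (at x)" for x
  proof -
    have "(q1 has_vector_derivative (q x * G2 x + q1 x * G1 x)) (at x)"
      unfolding q1_def[abs_def] by (rule has_vector_derivative_mult[OF dq[unfolded q1_def] dG1])
    then show ?thesis by (simp add: q2_def q1_def algebra_simps)
  qed
  show cq: "continuous_on UNIV q"
    using dq by (auto intro!: continuous_at_imp_continuous_on has_vector_derivative_continuous)
  have "continuous_on UNIV G1"
    using dG1 by (auto intro!: continuous_at_imp_continuous_on has_vector_derivative_continuous)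
  then have cq2: "continuous_on UNIV q2"
    unfolding q2_def G2_def by (intro continuous_intros cq c2)
  define K where "K = \<alpha> + 2 * p * \<bar>\<tau>\<bar> + 2 * p + \<sigma> + 1"
  have K: "K \<ge> 1" using \<sigma> p0 by (simp add: K_def)
  have bG1: "cmod (G1 x) \<le> K * (1 + \<bar>x\<bar>)" for x
  proof -
    have "cmod (G1 x) \<le> \<bar>2 * p * (x - \<tau>)\<bar> + cmod (\<psi>1 x)"
      unfolding G1_def by (rule order_trans[OF norm_triangle_ineq4]) (simp only: norm_of_real mult_minus_left abs_minus_cancel order_refl)
    also have "\<bar>2 * p * (x - \<tau>)\<bar> = 2 * p * \<bar>x - \<tau>\<bar>" using p0 by (simp add: abs_mult)
    also have "2 * p * \<bar>x - \<tau>\<bar> \<le> 2 * p * (\<bar>x\<bar> + \<bar>\<tau>\<bar>)" using p0 by (intro mult_left_mono) auto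
    finally have "cmod (G1 x) \<le> 2 * p * (\<bar>x\<bar> + \<bar>\<tau>\<bar>) + (\<alpha> + \<sigma> * \<bar>x\<bar>)" using b(1)[of x] by linarith
    also have "\<dots> = (2 * p * \<bar>\<tau>\<bar> + \<alpha>) + (2 * p + \<sigma>) * \<bar>x\<bar>" by (simp add: algebra_simps)
    also have "\<dots> \<le> K + K * \<bar>x\<bar>" using \<sigma> p0 by (intro add_mono mult_right_mono) (auto simp: K_def)
    finally show ?thesis by (simp add: algebra_simps)
  qed
  have sq: "(1 + \<bar>x\<bar>)\<^sup>2 \<le> 2 * (1 + x\<^sup>2)" for x :: real
    using zero_le_power2[of "1 - \<bar>x\<bar>"] by (simp add: power2_eq_square algebra_simps)
  have one: "1 + \<bar>x\<bar> \<le> 2 * (1 + x\<^sup>2)" for x :: real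
  proof -
    have "1 + \<bar>x\<bar> \<le> (1 + \<bar>x\<bar>)\<^sup>2" by (simp add: power2_eq_square algebra_simps)
    then show ?thesis using sq[of x] by linarith
  qed
  define E where "E = exp (p * \<tau>\<^sup>2)"
  have E: "E > 0" by (simp add: E_def)
  have bq: "cmod (q x) \<le> E * exp (- (x\<^sup>2 / 2))" for x
  proof -
    have "(x - \<tau>)\<^sup>2 \<ge> x\<^sup>2 / 2 - \<tau>\<^sup>2"
      using zero_le_power2[of "x - 2 * \<tau>"] by (simp add: power2_eq_square algebra_simps)
    then have "p * (x\<^sup>2 / 2 - \<tau>\<^sup>2) \<le> p * (x - \<tau>)\<^sup>2" using p0 by (intro mult_left_mono) auto
    moreover have "(\<sigma> + 1) * (x\<^sup>2 / 2) \<le> p * (x\<^sup>2 / 2)" using p by (intro mult_right_mono) auto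
    ultimately have "- p * (x - \<tau>)\<^sup>2 - Re (\<psi> x) \<le> p * \<tau>\<^sup>2 - x\<^sup>2 / 2" using b(3)[of x] by (simp add: algebra_simps)
    then have "exp (- p * (x - \<tau>)\<^sup>2 - Re (\<psi> x)) \<le> exp (p * \<tau>\<^sup>2 + - (x\<^sup>2 / 2))" by simp
    moreover have "cmod (q x) = exp (- p * (x - \<tau>)\<^sup>2 - Re (\<psi> x))"
      unfolding q_def norm_exp_eq_Re by (simp only: minus_complex.simps Re_complex_of_real)
    ultimately show ?thesis by (simp only: exp_add E_def)
  qed
  define C where "C = 8 * E * (2 * K\<^sup>2 + K)"
  have bnd: "cmod (q x * f) \<le> C * inverse (1 + x\<^sup>2)" if "cmod f \<le> (2 * K\<^sup>2 + K) * (1 + x\<^sup>2)" for x f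
  proof -
    have "cmod (q x * f) \<le> (E * exp (- (x\<^sup>2 / 2))) * ((2 * K\<^sup>2 + K) * (1 + x\<^sup>2))"
      unfolding norm_mult using that bq E by (intro mult_mono) auto
    also have "\<dots> = (E * (2 * K\<^sup>2 + K)) * ((1 + x\<^sup>2) * exp (- (x\<^sup>2 / 2)))" by simp
    also have "\<dots> \<le> (E * (2 * K\<^sup>2 + K)) * (8 * inverse (1 + x\<^sup>2))"
      using E K by (intro mult_left_mono exp_quadratic_bound) auto
    finally show ?thesis by (simp add: C_def)
  qed
  have K2: "K \<le> K\<^sup>2" using K by (simp add: power2_eq_square)
  have x1: "1 \<le> 1 + x\<^sup>2" for x :: real by simp
  have bb0: "cmod (q x) \<le> C * inverse (1 + x\<^sup>2)" for x
  proof -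
    have "1 * 1 \<le> (2 * K\<^sup>2 + K) * (1 + x\<^sup>2)" using K K2 x1[of x] by (intro mult_mono) auto
    then show ?thesis using bnd[of 1 x] by simp
  qed
  then show "\<exists>C. \<forall>x. cmod (q x) \<le> C * inverse (1 + x\<^sup>2)" by blast
  have bb1: "cmod (q1 x) \<le> C * inverse (1 + x\<^sup>2)" for x
    unfolding q1_def
  proof (rule bnd)
    have "K * (1 + \<bar>x\<bar>) \<le> K * (2 * (1 + x\<^sup>2))" using one K by (intro mult_left_mono) auto
    also have "\<dots> = (2 * K) * (1 + x\<^sup>2)" by simp
    also have "\<dots> \<le> (2 * K\<^sup>2 + K) * (1 + x\<^sup>2)" using K2 K by (intro mult_right_mono) auto
    finally show "cmod (G1 x) \<le> (2 * K\<^sup>2 + K) * (1 + x\<^sup>2)" using bG1[of x] by linarith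
  qed
  have bb2: "cmod (q2 x) \<le> C * inverse (1 + x\<^sup>2)" for x
    unfolding q2_def
  proof (rule bnd)
    have "cmod (G1 x * G1 x) \<le> (K * (1 + \<bar>x\<bar>)) * (K * (1 + \<bar>x\<bar>))"
      unfolding norm_mult using bG1[of x] K by (intro mult_mono) auto
    also have "\<dots> = K\<^sup>2 * (1 + \<bar>x\<bar>)\<^sup>2" by (simp add: power2_eq_square mult_ac)
    also have "\<dots> \<le> K\<^sup>2 * (2 * (1 + x\<^sup>2))" using sq by (intro mult_left_mono) auto
    also have "\<dots> = 2 * K\<^sup>2 * (1 + x\<^sup>2)" by (rule mult.left_commute[THEN trans]) simp
    finally have "cmod (G1 x * G1 x) \<le> 2 * K\<^sup>2 * (1 + x\<^sup>2)" .
    moreover have "cmod (G2 x) \<le> K * (1 + x\<^sup>2)"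
    proof -
      have "cmod (G2 x) \<le> \<bar>2 * p\<bar> + cmod (\<psi>2 x)"
        unfolding G2_def by (rule order_trans[OF norm_triangle_ineq4]) (simp only: norm_of_real mult_minus_left abs_minus_cancel order_refl)
      moreover have "0 \<le> 2 * p * \<bar>\<tau>\<bar>" using p0 by simp
      ultimately have "cmod (G2 x) \<le> K" using b(2)[of x] p0 \<sigma> unfolding K_def by linarith
      moreover have "K * 1 \<le> K * (1 + x\<^sup>2)" using K by (intro mult_left_mono x1) auto
      ultimately show ?thesis by linarith
    qed
    ultimately show "cmod (G1 x * G1 x + G2 x) \<le> (2 * K\<^sup>2 + K) * (1 + x\<^sup>2)"
      using norm_triangle_ineq[of "G1 x * G1 x" "G2 x"] by (simp add: algebra_simps)
  qed
  show "\<exists>D. \<forall>u. cmod (\<integral>x. iexp (u * x) * q x \<partial>lborel) \<le> D * inverse (1 + u\<^sup>2)"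
    by (rule fourier_integral_decay[OF dq dq1 cq2 bb0 bb1 bb2])
qed

lemma gaussian_fourier_integral:
  fixes p \<tau> t :: real
  assumes p: "p > 0"
  shows "integrable lborel (\<lambda>x. iexp (t * x) * of_real (exp (- p * (x - \<tau>)\<^sup>2)))"
    and "(\<integral>x. iexp (t * x) * of_real (exp (- p * (x - \<tau>)\<^sup>2)) \<partial>lborel) =
      of_real (sqrt (pi / p)) * (iexp (t * \<tau>) * of_real (exp (- (t\<^sup>2 / (4 * p)))))"
proof -
  define s where "s = 1 / sqrt (2 * p)"
  have s: "s > 0" "s\<^sup>2 = 1 / (2 * p)" using p by (simp_all add: s_def power_divide)
  have nd: "normal_density \<tau> s x = sqrt (p / pi) * exp (- p * (x - \<tau>)\<^sup>2)" for x
    using p by (simp add: normal_density_def s real_sqrt_divide real_sqrt_mult field_simps)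
  have e: "exp (- p * (x - \<tau>)\<^sup>2) = sqrt (pi / p) * normal_density \<tau> s x" for x
    unfolding nd using p by (simp add: real_sqrt_divide)
  interpret S: real_distribution std_normal_distribution by (rule real_dist_normal_dist)
  have i: "integrable lborel (\<lambda>x. of_real (normal_density \<tau> s x) * iexp (t * x))"
  proof (rule Bochner_Integration.integrable_bound)
    show "integrable lborel (normal_density \<tau> s)" using s by simp
  qed (auto simp: norm_mult)
  then show "integrable lborel (\<lambda>x. iexp (t * x) * of_real (exp (- p * (x - \<tau>)\<^sup>2)))"
    unfolding e using integrable_mult_right[OF i, of "of_real (sqrt (pi / p))"] by (simp add: mult_ac)
  have "(\<integral>x. of_real (normal_density \<tau> s x) * iexp (t * x) \<partial>lborel) =
    of_real \<bar>s\<bar> * (\<integral>x. of_real (normal_density \<tau> s (\<tau> + s * x)) * iexp (t * (\<tau> + s * x)) \<partial>lborel)"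
    using s by (subst lborel_integral_real_affine[where c = s and t = \<tau>]) (auto simp: scaleR_conv_of_real)
  also have "\<dots> = (\<integral>x. iexp (t * \<tau>) * (of_real (std_normal_density x) * iexp ((t * s) * x)) \<partial>lborel)"
  proof -
    have "s * normal_density \<tau> s (\<tau> + s * x) = std_normal_density x" for x
      using s(1) by (simp add: normal_density_def power_mult_distrib real_sqrt_mult field_simps)
    then have *: "of_real \<bar>s\<bar> * of_real (normal_density \<tau> s (\<tau> + s * x)) = (of_real (std_normal_density x) :: complex)" for x
      using s(1) unfolding of_real_mult[symmetric] by simp
    have **: "iexp (t * (\<tau> + s * x)) = iexp (t * \<tau>) * iexp ((t * s) * x)" for x
      by (simp add: exp_add[symmetric] algebra_simps)
    have "of_real \<bar>s\<bar> * (of_real (normal_density \<tau> s (\<tau> + s * x)) * iexp (t * (\<tau> + s * x))) =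
      iexp (t * \<tau>) * (of_real (std_normal_density x) * iexp ((t * s) * x))" for x
      unfolding **  mult.assoc[symmetric] * by (simp only: mult_ac)
    then show ?thesis unfolding integral_mult_right_zero[symmetric] by presburger
  qed
  also have "\<dots> = iexp (t * \<tau>) * char std_normal_distribution (t * s)"
  proof -
    have "char std_normal_distribution (t * s) = (\<integral>x. of_real (std_normal_density x) * iexp ((t * s) * x) \<partial>lborel)"
      unfolding char_def by (subst integral_density) (auto simp: scaleR_conv_of_real normal_density_nonneg)
    then show ?thesis by (simp only: integral_mult_right_zero)
  qed
  also have "char std_normal_distribution (t * s) = of_real (exp (- (t\<^sup>2 / (4 * p))))"
    using s(2) by (simp add: char_std_normal_distribution power_mult_distrib)
  finally have nf: "(\<integral>x. of_real (normal_density \<tau> s x) * iexp (t * x) \<partial>lborel) =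
     iexp (t * \<tau>) * of_real (exp (- (t\<^sup>2 / (4 * p))))" .
  have "(\<integral>x. iexp (t * x) * of_real (exp (- p * (x - \<tau>)\<^sup>2)) \<partial>lborel) =
    (\<integral>x. of_real (sqrt (pi / p)) * (of_real (normal_density \<tau> s x) * iexp (t * x)) \<partial>lborel)"
    unfolding e of_real_mult by (simp only: mult_ac)
  then show "(\<integral>x. iexp (t * x) * of_real (exp (- p * (x - \<tau>)\<^sup>2)) \<partial>lborel) =
      of_real (sqrt (pi / p)) * (iexp (t * \<tau>) * of_real (exp (- (t\<^sup>2 / (4 * p)))))"
    using nf by (simp only: integral_mult_right_zero)
qed

text \<open>A bounded function is determined by the Fourier transform of its product with a Gaussian:
  perturbing the normal density by a multiple of the function leaves the characteristic function
  unchanged.\<close>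

lemma gaussian_weighted_fourier_unique:
  fixes g :: "real \<Rightarrow> real"
  assumes [measurable]: "g \<in> borel_measurable borel" and B: "\<And>x. \<bar>g x\<bar> \<le> B" and r: "r > 0"
    and zero: "\<And>\<tau>. (\<integral>x. of_real (g x) * (iexp (\<tau> * x) * of_real (exp (- r * x\<^sup>2))) \<partial>lborel) = 0"
  shows "AE x in lborel. g x = 0"
proof -
  define s where "s = 1 / sqrt (2 * r)"
  have s: "s > 0" "s\<^sup>2 = 1 / (2 * r)" using r by (simp_all add: s_def power_divide)
  have nd: "normal_density 0 s x = sqrt (r / pi) * exp (- r * x\<^sup>2)" for x
    using r by (simp add: normal_density_def s real_sqrt_divide real_sqrt_mult field_simps)
  define B' where "B' = B + 1"
  have B': "B' > 0" "\<bar>g x\<bar> < B'" for x using B[of 0] B[of x] by (auto simp: B'_def)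
  define f where "f x = normal_density 0 s x * (1 + g x / B')" for x
  have [measurable]: "f \<in> borel_measurable borel" unfolding f_def by measurable
  have gB: "\<bar>g x / B'\<bar> < 1" for x using B'(1) B'(2)[of x] by simp
  have f0: "f x \<ge> 0" for x
  proof -
    have "1 + g x / B' \<ge> 0" using gB[of x] unfolding abs_less_iff by linarith
    then show ?thesis unfolding f_def by (intro mult_nonneg_nonneg) auto
  qed
  have i1: "integrable lborel (\<lambda>x. of_real (normal_density 0 s x) * iexp (\<tau> * x))" for \<tau>
  proof (rule Bochner_Integration.integrable_bound)
    show "integrable lborel (normal_density 0 s)" using s by simp
  qed (auto simp: norm_mult)
  have i2: "integrable lborel (\<lambda>x. of_real (g x / B') * (of_real (normal_density 0 s x) * iexp (\<tau> * x)))" for \<tau>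
  proof (rule Bochner_Integration.integrable_bound)
    show "integrable lborel (normal_density 0 s)" using s by simp
    have "\<bar>g x / B'\<bar> * normal_density 0 s x \<le> 1 * normal_density 0 s x" for x
      using gB[of x] by (intro mult_right_mono) auto
    then show "AE x in lborel. norm (of_real (g x / B') * (of_real (normal_density 0 s x) * iexp (\<tau> * x))) \<le> norm (normal_density 0 s x)"
      by (intro AE_I2) (simp add: norm_mult norm_divide)
  qed auto
  have zero': "(\<integral>x. of_real (g x / B') * (of_real (normal_density 0 s x) * iexp (\<tau> * x)) \<partial>lborel) = 0" for \<tau>
  proof -
    have "of_real (g x / B') * (of_real (normal_density 0 s x) * iexp (\<tau> * x)) =
      of_real (sqrt (r / pi) / B') * (of_real (g x) * (iexp (\<tau> * x) * of_real (exp (- r * x\<^sup>2))))" for x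
      unfolding nd by (simp add: mult_ac)
    then show ?thesis using zero[of \<tau>] by (simp only: integral_mult_right_zero) simp
  qed
  have fchar: "(\<integral>x. of_real (f x) * iexp (\<tau> * x) \<partial>lborel) = (\<integral>x. of_real (normal_density 0 s x) * iexp (\<tau> * x) \<partial>lborel)" for \<tau>
  proof -
    have "(\<integral>x. of_real (f x) * iexp (\<tau> * x) \<partial>lborel) =
      (\<integral>x. of_real (normal_density 0 s x) * iexp (\<tau> * x) + of_real (g x / B') * (of_real (normal_density 0 s x) * iexp (\<tau> * x)) \<partial>lborel)"
      by (intro Bochner_Integration.integral_cong refl) (simp add: f_def algebra_simps)
    then show ?thesis using Bochner_Integration.integral_add[OF i1 i2, of \<tau> \<tau>] zero'[of \<tau>] by simp
  qed
  have P1: "real_distribution (density lborel (normal_density 0 s))"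
    using prob_space_normal_density[OF s(1)] by (auto simp: real_distribution_def real_distribution_axioms_def)
  have if': "integrable lborel f"
  proof -
    have "integrable lborel (\<lambda>x. Re (of_real (normal_density 0 s x) * iexp (0 * x) + of_real (g x / B') * (of_real (normal_density 0 s x) * iexp (0 * x))))"
      by (intro integrable_Re Bochner_Integration.integrable_add i1 i2)
    then show ?thesis by (simp add: f_def[abs_def] algebra_simps)
  qed
  have tot: "(\<integral>x. f x \<partial>lborel) = 1"
  proof -
    have "complex_of_real (\<integral>x. f x \<partial>lborel) = complex_of_real (\<integral>x. normal_density 0 s x \<partial>lborel)"
      using fchar[of 0] by (simp only: mult_zero_left of_real_0 mult_zero_right exp_zero mult_1_right integral_complex_of_real)
    then show ?thesis using s by simp
  qed
  have "emeasure (density lborel f) UNIV = 1"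
    using nn_integral_eq_integral[OF if'] f0 tot by (simp add: emeasure_density)
  then have P2: "real_distribution (density lborel f)"
    by (auto simp: real_distribution_def real_distribution_axioms_def intro!: prob_spaceI)
  have "char (density lborel (normal_density 0 s)) = char (density lborel f)"
    using fchar f0 by (auto simp: fun_eq_iff char_def integral_density scaleR_conv_of_real normal_density_nonneg)
  then have "density lborel (normal_density 0 s) = density lborel f" by (rule Levy_uniqueness[OF P1 P2])
  then have "AE x in lborel. ennreal (normal_density 0 s x) = ennreal (f x)"
    by (intro sigma_finite_measure.density_unique[OF lborel.sigma_finite_measure_axioms]) auto
  then show ?thesis
  proof eventually_elim
    case (elim x)
    then have "normal_density 0 s x = f x" using f0[of x] by (simp add: ennreal_inj normal_density_nonneg)
    then show ?case using normal_density_pos[OF s(1), of 0 x] B'(1) by (simp add: f_def algebra_simps)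
  qed
qed

text \<open>Let \<open>m\<close> be the Fourier integral of a Gaussian centred at \<open>\<tau>\<close> divided by the characteristic function of
  \<open>M\<close>. Then \<open>m\<close> is integrable, and averaging \<open>m (t + w)\<close> over \<open>w\<close> with respect to \<open>M\<close> gives back a modulated
  Gaussian in \<open>t\<close>. Integrating the hypothesis on \<open>g\<close> against \<open>m\<close> therefore shows that the Fourier transform
  of \<open>g\<close> times a Gaussian vanishes at \<open>\<tau>\<close>. The width of the Gaussian does not depend on \<open>\<tau>\<close>.\<close>

lemma deconvolution_bounded_jumps:
  fixes g :: "real \<Rightarrow> real"
  assumes lm: "levy_measure \<nu>" and L: "L > 0" and M: "real_distribution M"
    and ch: "\<And>t. char M t = exp ((\<integral>y. indicator {-L..L} y *\<^sub>R (iexp (t * y) - 1 - \<i> * of_real (t * y)) \<partial>\<nu>)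
      + \<i> * of_real (a * t) - of_real (b\<^sup>2 * t\<^sup>2 / 2))"
    and [measurable]: "g \<in> borel_measurable borel" and B: "\<And>x. \<bar>g x\<bar> \<le> B"
    and zero: "\<And>x. (\<integral>w. g (x - w) \<partial>M) = 0"
  shows "AE x in lborel. g x = 0"
proof -
  interpret M: real_distribution M by fact
  interpret P: pair_sigma_finite M lborel ..
  define \<psi> where "\<psi> = (\<lambda>t. (\<integral>y. indicator {-L..L} y *\<^sub>R (iexp (t * y) - 1 - \<i> * of_real (t * y)) \<partial>\<nu>)
      + \<i> * of_real (a * t) - of_real (b\<^sup>2 * t\<^sup>2 / 2))"
  have ch': "char M t = exp (\<psi> t)" for t unfolding ch \<psi>_def ..
  from bounded_jumps_exponent[OF lm L, of a b] obtain \<psi>1 \<psi>2 \<sigma> where \<psi>: "\<sigma> \<ge> 0"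
    "\<And>t. (\<psi> has_vector_derivative \<psi>1 t) (at t)" "\<And>t. (\<psi>1 has_vector_derivative \<psi>2 t) (at t)"
    "continuous_on UNIV \<psi>2" "\<And>t. cmod (\<psi>1 t) \<le> \<bar>a\<bar> + \<sigma> * \<bar>t\<bar>" "\<And>t. cmod (\<psi>2 t) \<le> \<sigma>" "\<And>t. - Re (\<psi> t) \<le> \<sigma> * t\<^sup>2 / 2"
    unfolding \<psi>_def by blast
  define p where "p = \<sigma> + 1"
  have p: "p > 0" "p \<ge> \<sigma> + 1" using \<psi>(1) by (auto simp: p_def)
  have B0: "B \<ge> 0" using B[of 0] by simp
  show ?thesis
  proof (rule gaussian_weighted_fourier_unique[OF _ B, where r = "1 / (4 * p)"])
    fix \<tau> :: real
    define q where "q x = exp (of_real (- p * (x - \<tau>)\<^sup>2) - \<psi> x)" for x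
    define m where "m u = (\<integral>x. iexp (u * x) * q x \<partial>lborel)" for u
    note qd = gaussian_quotient_decay[OF \<psi>(2-7,1) _ p(2), where \<tau> = \<tau>, folded q_def]
    from qd(1) obtain D where D: "\<And>u. cmod (m u) \<le> D * inverse (1 + u\<^sup>2)" unfolding m_def by auto
    from qd(2) obtain C where C: "\<And>x. cmod (q x) \<le> C * inverse (1 + x\<^sup>2)" by auto
    have [measurable]: "q \<in> borel_measurable borel" using qd(3) by (auto intro: borel_measurable_continuous_onI)
    have [measurable]: "m \<in> borel_measurable borel" unfolding m_def by measurable
    note int = integrable_of_inverse_square_bound
    have iq: "integrable lborel q" and im: "integrable lborel m" by (rule int, simp, rule C) (rule int, simp, rule D)
    \<comment> \<open>\<open>m\<close> deconvolves the Gaussian: integrate \<open>iexp ((t + w) * x)\<close> over \<open>w\<close> first.\<close>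
    have conv: "(\<integral>w. m (t + w) \<partial>M) = of_real (sqrt (pi / p)) * (iexp (t * \<tau>) * of_real (exp (- (t\<^sup>2 / (4 * p)))))" for t
    proof -
      have "integrable (M \<Otimes>\<^sub>M lborel) (\<lambda>(w, x). iexp ((t + w) * x) * q x)"
      proof (rule P.Fubini_integrable)
        show "integrable M (\<lambda>w. \<integral>x. norm (case (w, x) of (w, x) \<Rightarrow> iexp ((t + w) * x) * q x) \<partial>lborel)"
          by (simp add: norm_mult)
        show "AE w in M. integrable lborel (\<lambda>x. case (w, x) of (w, x) \<Rightarrow> iexp ((t + w) * x) * q x)"
          by (intro AE_I2, simp only: prod.case, rule int[where C = C]) (use C in \<open>auto simp: norm_mult\<close>)
      qed measurable
      from P.Fubini_integral[OF this]
      have "(\<integral>w. m (t + w) \<partial>M) = (\<integral>x. \<integral>w. iexp ((t + w) * x) * q x \<partial>M \<partial>lborel)"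
        unfolding m_def by simp
      also have "\<dots> = (\<integral>x. iexp (t * x) * of_real (exp (- p * (x - \<tau>)\<^sup>2)) \<partial>lborel)"
      proof (rule Bochner_Integration.integral_cong[OF refl])
        fix x
        have "(\<integral>w. iexp ((t + w) * x) * q x \<partial>M) = (\<integral>w. (iexp (t * x) * q x) * iexp (x * w) \<partial>M)"
          by (intro Bochner_Integration.integral_cong refl) (simp add: exp_add algebra_simps)
        also have "\<dots> = (iexp (t * x) * q x) * char M x" unfolding char_def by (rule integral_mult_right_zero)
        also have "\<dots> = iexp (t * x) * (q x * exp (\<psi> x))" by (simp add: ch')
        also have "q x * exp (\<psi> x) = of_real (exp (- p * (x - \<tau>)\<^sup>2))"
          unfolding q_def exp_add[symmetric] by (simp only: diff_add_cancel exp_of_real)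
        finally show "(\<integral>w. iexp ((t + w) * x) * q x \<partial>M) = iexp (t * x) * of_real (exp (- p * (x - \<tau>)\<^sup>2))" .
      qed
      finally show ?thesis using gaussian_fourier_integral(2)[OF p(1)] by simp
    qed
    \<comment> \<open>Both sides of the next equation are the integral of \<open>g (u - w) * m u\<close> over \<open>u\<close> and \<open>w\<close>.\<close>
    have trans: "(\<integral>u. of_real (g (u - w)) * m u \<partial>lborel) = (\<integral>t. of_real (g t) * m (t + w) \<partial>lborel)" for w
      by (subst lborel_integral_real_affine[where c = 1 and t = w]) (auto simp: add.commute)
    have gm: "cmod (of_real (g v) * m u) \<le> B * cmod (m u)" for u v
      unfolding norm_mult using B by (intro mult_right_mono) auto
    have int1: "integrable (M \<Otimes>\<^sub>M lborel) (\<lambda>(w, u). of_real (g (u - w)) * m u)"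
    proof (rule P.Fubini_integrable)
      have b: "(\<integral>u. norm (of_real (g (u - w)) * m u) \<partial>lborel) \<le> (\<integral>u. B * cmod (m u) \<partial>lborel)" for w
        by (intro integral_mono_AE' AE_I2 gm) (use im B0 in auto)
      show "integrable M (\<lambda>w. \<integral>u. norm (case (w, u) of (w, u) \<Rightarrow> of_real (g (u - w)) * m u) \<partial>lborel)"
        using b by (intro M.integrable_const_bound[where B = "\<integral>u. B * cmod (m u) \<partial>lborel"] AE_I2) auto
      show "AE w in M. integrable lborel (\<lambda>u. case (w, u) of (w, u) \<Rightarrow> of_real (g (u - w)) * m u)"
      proof (intro AE_I2, simp only: prod.case)
        fix w
        show "integrable lborel (\<lambda>u. of_real (g (u - w)) * m u)"
          by (rule Bochner_Integration.integrable_bound[where f = "\<lambda>u. B * cmod (m u)"])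
            (use im gm B0 in \<open>auto simp: abs_mult\<close>)
      qed
    qed measurable
    have int2: "integrable (M \<Otimes>\<^sub>M lborel) (\<lambda>(w, t). of_real (g t) * m (t + w))"
    proof (rule P.Fubini_integrable)
      have im': "integrable lborel (\<lambda>t. m (t + w))" for w
        using lborel_integrable_real_affine[OF im, of 1 w] by (simp add: add.commute)
      have b: "(\<integral>t. norm (of_real (g t) * m (t + w)) \<partial>lborel) \<le> (\<integral>u. B * cmod (m u) \<partial>lborel)" for w
      proof -
        have "(\<integral>t. norm (of_real (g t) * m (t + w)) \<partial>lborel) \<le> (\<integral>t. B * cmod (m (t + w)) \<partial>lborel)"
          by (intro integral_mono_AE' AE_I2 gm) (use im' B0 in auto)
        also have "\<dots> = (\<integral>u. B * cmod (m u) \<partial>lborel)"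
          by (subst (2) lborel_integral_real_affine[where c = 1 and t = w]) (auto simp: add.commute)
        finally show ?thesis .
      qed
      show "integrable M (\<lambda>w. \<integral>t. norm (case (w, t) of (w, t) \<Rightarrow> of_real (g t) * m (t + w)) \<partial>lborel)"
        using b by (intro M.integrable_const_bound[where B = "\<integral>u. B * cmod (m u) \<partial>lborel"] AE_I2) auto
      show "AE w in M. integrable lborel (\<lambda>t. case (w, t) of (w, t) \<Rightarrow> of_real (g t) * m (t + w))"
      proof (intro AE_I2, simp only: prod.case)
        fix w
        show "integrable lborel (\<lambda>t. of_real (g t) * m (t + w))"
          by (rule Bochner_Integration.integrable_bound[where f = "\<lambda>t. B * cmod (m (t + w))"])
            (use im'[of w] gm B0 in \<open>auto simp: abs_mult\<close>)
      qed
    qed measurable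
    have "0 = (\<integral>u. \<integral>w. of_real (g (u - w)) * m u \<partial>M \<partial>lborel)"
      using zero by simp
    also have "\<dots> = (\<integral>w. \<integral>u. of_real (g (u - w)) * m u \<partial>lborel \<partial>M)"
      using P.Fubini_integral[OF int1] by simp
    also have "\<dots> = (\<integral>w. \<integral>t. of_real (g t) * m (t + w) \<partial>lborel \<partial>M)" unfolding trans ..
    also have "\<dots> = (\<integral>t. \<integral>w. of_real (g t) * m (t + w) \<partial>M \<partial>lborel)"
      using P.Fubini_integral[OF int2] by simp
    also have "\<dots> = (\<integral>t. of_real (g t) * (\<integral>w. m (t + w) \<partial>M) \<partial>lborel)"
      by (simp only: integral_mult_right_zero)
    also have "\<dots> = (\<integral>t. of_real (sqrt (pi / p)) * (of_real (g t) * (iexp (\<tau> * t) * of_real (exp (- (1 / (4 * p)) * t\<^sup>2)))) \<partial>lborel)"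
      unfolding conv by (intro Bochner_Integration.integral_cong refl) (simp add: mult_ac)
    also have "\<dots> = of_real (sqrt (pi / p)) * (\<integral>t. of_real (g t) * (iexp (\<tau> * t) * of_real (exp (- (1 / (4 * p)) * t\<^sup>2))) \<partial>lborel)"
      by (rule integral_mult_right_zero)
    finally have "of_real (sqrt (pi / p)) * (\<integral>t. of_real (g t) * (iexp (\<tau> * t) * of_real (exp (- (1 / (4 * p)) * t\<^sup>2))) \<partial>lborel) = 0"
      by (rule sym)
    then show "(\<integral>t. of_real (g t) * (iexp (\<tau> * t) * of_real (exp (- (1 / (4 * p)) * t\<^sup>2))) \<partial>lborel) = 0"
      using p(1) by (simp only: mult_eq_0_iff of_real_eq_0_iff) simp
  qed (use p in auto)
qed

lemma levy_measure_tail_small: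
  assumes lm: "levy_measure \<nu>" and e: "\<epsilon> > 0"
  shows "\<exists>A0\<ge>1. \<forall>A\<ge>A0. measure \<nu> (- {-A..A}) < \<epsilon>"
proof -
  note sets_nu = levy_measure_sets[OF lm]
  have sp: "space \<nu> = UNIV" using sets_eq_imp_space_eq[OF sets_nu] by simp
  let ?T = "\<lambda>n::nat. - {- real (Suc n)..real (Suc n)}"
  have fin: "emeasure \<nu> (- {-A..A}) < \<infinity>" if "A \<ge> 1" for A
    by (rule levy_measure_finite_away[OF lm, of 1]) (use that in auto)
  have "(\<lambda>n. measure \<nu> (?T n)) \<longlonglongrightarrow> measure \<nu> (\<Inter>n. ?T n)"
  proof (rule Lim_measure_decseq)
    show "range ?T \<subseteq> sets \<nu>" unfolding sets_nu by (intro image_subsetI) measurable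
    show "decseq ?T" by (auto simp: decseq_def)
    show "emeasure \<nu> (?T n) \<noteq> \<infinity>" for n using fin[of "real (Suc n)"] by simp
  qed
  moreover have "(\<Inter>n. ?T n) = {}"
  proof (rule equals0I)
    fix x :: real assume x: "x \<in> (\<Inter>n. ?T n)"
    obtain n where "\<bar>x\<bar> \<le> real n" using real_arch_simple by blast
    moreover have "x \<in> ?T n" using x by blast
    ultimately show False by (simp add: abs_le_iff)
  qed
  ultimately have "\<forall>\<^sub>F n in sequentially. measure \<nu> (?T n) < \<epsilon>"
    using e by (intro order_tendstoD(2)[where y = 0]) auto
  then obtain n where n: "measure \<nu> (?T n) < \<epsilon>"
    using eventually_happens'[OF sequentially_bot] by blast
  show ?thesis
  proof (intro exI[of _ "real (Suc n)"] conjI allI impI)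
    fix A assume A: "A \<ge> real (Suc n)"
    have "measure \<nu> (- {-A..A}) \<le> measure \<nu> (?T n)"
      using A sets_nu fin[of "real (Suc n)"] by (intro measure_mono_fmeasurable fmeasurableI) auto
    then show "measure \<nu> (- {-A..A}) < \<epsilon>" using n by linarith
  qed simp
qed

text \<open>The jumps exceeding \<open>L\<close> form a compound Poisson factor; for large \<open>L\<close> its rate is so small that
  convolution with it is invertible by contraction.\<close>

lemma deconvolution_infinitely_divisible:
  fixes g :: "real \<Rightarrow> real"
  assumes mu: "real_distribution \<mu>" and hl: "has_levy_measure \<mu> \<nu>"
    and [measurable]: "g \<in> borel_measurable borel" and B: "\<And>x. \<bar>g x\<bar> \<le> B"
    and zero: "\<And>x. (\<integral>w. g (x - w) \<partial>\<mu>) = 0"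
  shows "AE x in lborel. g x = 0"
proof -
  from hl have lm: "levy_measure \<nu>" by (simp add: has_levy_measure_def)
  note sets_nu = levy_measure_sets[OF lm]
  from levy_measure_tail_small[OF lm, of "1/4"] obtain L where L: "L \<ge> 1" "measure \<nu> (- {-L..L}) < 1/4" by auto
  from levy_decomposition[OF mu hl L(1)] obtain N a b where N: "real_distribution N"
    "\<And>t. char N t = exp ((\<integral>y. indicator {-L..L} y *\<^sub>R (iexp (t * y) - 1 - \<i> * of_real (t * y)) \<partial>\<nu>)
      + \<i> * of_real (a * t) - of_real (b\<^sup>2 * t\<^sup>2 / 2))" "\<mu> = (cpoisson \<nu> (- {-L..L}) \<star> N)"
    by (elim exE conjE) (rule that, assumption, erule spec, assumption)
  interpret N: real_distribution N by (rule N)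
  have fin: "emeasure \<nu> (- {-L..L}) < \<infinity>" by (rule levy_measure_finite_away[OF lm, of 1]) (use L in auto)
  have J: "- {-L..L} \<in> sets borel" by simp
  let ?K = "cpoisson \<nu> (- {-L..L})"
  have K: "real_distribution ?K" by (rule real_distribution_cpoisson[OF sets_nu J fin])
  define h where "h x = (\<integral>w. g (x - w) \<partial>N)" for x
  have [measurable]: "h \<in> borel_measurable borel" unfolding h_def by measurable
  have B0: "B \<ge> 0" using B[of 0] by simp
  have hB: "\<bar>h x\<bar> \<le> B" for x
  proof -
    have "\<bar>h x\<bar> \<le> (\<integral>w. \<bar>g (x - w)\<bar> \<partial>N)" unfolding h_def by simp
    also have "\<dots> \<le> (\<integral>w. B \<partial>N)"
      using B B0 by (intro integral_mono N.integrable_const_bound[where B = B]) auto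
    finally show ?thesis using N.prob_space by simp
  qed
  have hK: "(\<integral>s. h (x - s) \<partial>?K) = 0" for x
  proof -
    have "(\<integral>w. g (x - w) \<partial>\<mu>) = (\<integral>s. \<integral>w. g (x - (s + w)) \<partial>N \<partial>?K)"
      unfolding N(3) by (rule integral_convolution[where B = B]) (use B in \<open>auto simp: fbm_real_distribution K N\<close>)
    then show ?thesis using zero[of x] by (simp add: h_def diff_diff_eq)
  qed
  have half: "\<bar>h x\<bar> \<le> B / 2 ^ n" for x n
  proof (induction n arbitrary: x)
    case (Suc n)
    note R = real_distribution_dirac
    have "\<bar>(\<integral>s. h (x - s) \<partial>(?K \<star> return borel 0)) - (\<integral>s. h (x - s) \<partial>(return borel 0))\<bar>
      \<le> 2 * (B / 2 ^ n) * (1 - exp (- measure \<nu> (- {-L..L})))"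
      by (rule cpoisson_perturbation[OF sets_nu J fin R]) (use Suc in auto)
    then have "\<bar>h x\<bar> \<le> 2 * (B / 2 ^ n) * (1 - exp (- measure \<nu> (- {-L..L})))"
      unfolding convolution_return_0[OF K] by (simp add: hK integral_return)
    also have "\<dots> \<le> 2 * (B / 2 ^ n) * (1/4)"
      using B0 L(2) exp_ge_add_one_self[of "- measure \<nu> (- {-L..L})"] by (intro mult_left_mono) auto
    finally show ?case by simp
  qed (use hB in simp)
  have h0: "h x = 0" for x
  proof -
    have "(\<lambda>n. B * (1/2) ^ n) \<longlonglongrightarrow> B * 0" by (intro tendsto_mult_left LIMSEQ_power_zero) auto
    then have "(\<lambda>n. B / 2 ^ n) \<longlonglongrightarrow> 0" by (simp add: power_divide)
    then have "\<bar>h x\<bar> \<le> 0" by (rule LIMSEQ_le_const) (use half in auto)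
    then show ?thesis by simp
  qed
  show ?thesis
    by (rule deconvolution_bounded_jumps[OF lm _ N(1,2), where B = B]) (use L B h0 in \<open>auto simp: h_def\<close>)
qed

section \<open>The decomposition at a high jump threshold\<close>

lemma levy_measure_tail_finite:
  assumes "levy_measure \<nu>" "A \<ge> 1"
  shows "emeasure \<nu> {A<..} < \<infinity>"
  by (rule levy_measure_finite_away[OF assms(1), of 1]) (use assms in auto)

lemma fbm_levy_tail_part:
  assumes "levy_measure \<nu>" "A \<ge> 1"
  shows "finite_borel_measure (tail_part \<nu> A)"
  unfolding tail_part_def
  by (rule fbm_density_indicator[OF levy_measure_sets[OF assms(1)] _ levy_measure_tail_finite[OF assms]]) simp

lemma local_mass_levy_tail_part_mono:
  assumes lm: "levy_measure \<nu>" and A: "A \<ge> 1" "A \<le> A'"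
  shows "local_mass (tail_part \<nu> A') c z \<le> local_mass (tail_part \<nu> A) c z"
proof -
  note sets_nu = levy_measure_sets[OF lm]
  have "emeasure \<nu> ({A<..} \<inter> {z<..z + c}) \<le> emeasure \<nu> {A<..}" using sets_nu by (intro emeasure_mono) auto
  then have "emeasure \<nu> ({A<..} \<inter> {z<..z + c}) < \<infinity>" using levy_measure_tail_finite[OF lm A(1)] by (rule le_less_trans)
  then show ?thesis unfolding local_mass_tail_part[OF sets_nu]
    using A sets_nu by (intro measure_mono_fmeasurable fmeasurableI) auto
qed

lemma integral_uniform_tail:
  fixes f :: "real \<Rightarrow> real"
  assumes lm: "levy_measure \<nu>" and A: "A \<ge> 1" and l: "measure \<nu> {A<..} > 0" and f: "f \<in> borel_measurable borel"
  shows "measure \<nu> {A<..} * (\<integral>x. f x \<partial>(uniform_measure \<nu> {A<..})) = (\<integral>x. f x \<partial>(tail_part \<nu> A))"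
  using integral_uniform_measure[OF levy_measure_sets[OF lm] _ levy_measure_tail_finite[OF lm A] l f]
    integral_tail_part[OF levy_measure_sets[OF lm] f] by simp

lemma local_mass_uniform_tail:
  assumes lm: "levy_measure \<nu>" and A: "A \<ge> 1" and l: "measure \<nu> {A<..} > 0"
  shows "measure \<nu> {A<..} * local_mass (uniform_measure \<nu> {A<..}) c x = local_mass (tail_part \<nu> A) c x"
proof -
  note U = real_distribution_uniform_measure[OF levy_measure_sets[OF lm] _ levy_measure_tail_finite[OF lm A] l]
  show ?thesis
    unfolding local_mass_integral[OF fbm_real_distribution[OF U[simplified]]] local_mass_integral[OF fbm_levy_tail_part[OF lm A]]
    by (rule integral_uniform_tail[OF lm A l]) simp
qed

lemma local_mass_uniform_tail_square:
  assumes lm: "levy_measure \<nu>" and A: "A \<ge> 1" and l: "measure \<nu> {A<..} > 0"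
  shows "(measure \<nu> {A<..})\<^sup>2 * local_mass (uniform_measure \<nu> {A<..} \<star> uniform_measure \<nu> {A<..}) c x =
    local_mass (tail_part \<nu> A \<star> tail_part \<nu> A) c x"
proof -
  let ?l = "measure \<nu> {A<..}" and ?F = "uniform_measure \<nu> {A<..}"
  have U: "real_distribution ?F"
    using real_distribution_uniform_measure[OF levy_measure_sets[OF lm] _ levy_measure_tail_finite[OF lm A] l] by simp
  note FU = fbm_real_distribution[OF U] and T = fbm_levy_tail_part[OF lm A]
  have [measurable]: "local_mass (tail_part \<nu> A) c \<in> borel_measurable borel" using T by measurable
  have "?l\<^sup>2 * local_mass (?F \<star> ?F) c x = ?l * (\<integral>s. ?l * local_mass ?F c (x - s) \<partial>?F)"
    unfolding local_mass_convolution[OF FU FU] by (simp add: power2_eq_square)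
  also have "\<dots> = ?l * (\<integral>s. local_mass (tail_part \<nu> A) c (x - s) \<partial>?F)"
    by (simp only: local_mass_uniform_tail[OF lm A l])
  also have "\<dots> = (\<integral>s. local_mass (tail_part \<nu> A) c (x - s) \<partial>(tail_part \<nu> A))"
    by (rule integral_uniform_tail[OF lm A l]) measurable
  also have "\<dots> = local_mass (tail_part \<nu> A \<star> tail_part \<nu> A) c x"
    by (rule local_mass_convolution[OF T T, symmetric])
  finally show ?thesis .
qed

lemma conv_power_supported:
  assumes F: "real_distribution F" and supp: "emeasure F {..A} = 0" and A: "A \<ge> 0"
  shows "emeasure (conv_power F k) {..<0} = 0" and "k \<ge> 1 \<Longrightarrow> emeasure (conv_power F k) {..A} = 0"
proof -
  interpret F: real_distribution F by (rule F)
  have step: "emeasure (F \<star> G) {..A} = 0" if G: "real_distribution G" "emeasure G {..<0} = 0" for G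
  proof -
    interpret G: real_distribution G by (rule G)
    have "emeasure (F \<star> G) {..A} = (\<integral>\<^sup>+s. emeasure G {a. a + s \<in> {..A}} \<partial>F)"
      by (rule convolution_emeasure) (auto simp: F.finite_measure_axioms G.finite_measure_axioms)
    also have "\<dots> = (\<integral>\<^sup>+s. 0 \<partial>F)"
    proof (rule nn_integral_cong_AE)
      have "AE s in F. s \<notin> {..A}" using supp by (intro AE_not_in) auto
      then show "AE s in F. emeasure G {a. a + s \<in> {..A}} = 0"
      proof eventually_elim
        case (elim s)
        have "emeasure G {a. a + s \<in> {..A}} \<le> emeasure G {..<0}"
          using elim by (intro emeasure_mono) auto
        then show ?case using G(2) by simp
      qed
    qed
    finally show ?thesis by simp
  qed
  show neg: "emeasure (conv_power F k) {..<0} = 0" for k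
  proof (induction k)
    case (Suc k)
    have "emeasure (F \<star> conv_power F k) {..<0} \<le> emeasure (F \<star> conv_power F k) {..A}"
      using A by (intro emeasure_mono) auto
    then show ?case using step[OF real_distribution_conv_power[OF F] Suc] by simp
  qed simp
  show "emeasure (conv_power F k) {..A} = 0" if "k \<ge> 1"
  proof -
    obtain j where "k = Suc j" using \<open>k \<ge> 1\<close> by (cases k) auto
    then show ?thesis using step[OF real_distribution_conv_power[OF F] neg[of j]] by simp
  qed
qed

text \<open>A geometric bound, valid for all \<open>x\<close>: every further jump above \<open>A\<close> costs a factor \<open>\<rho>\<close>, which is
  small because two jumps above \<open>A\<close> are unlikely. The induction works without a lower bound on
  \<open>x\<close> because the convolution powers vanish on \<open>{..A}\<close>.\<close>

lemma local_mass_conv_power_le: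
  assumes lm: "levy_measure \<nu>" and A: "A \<ge> 1" and l: "measure \<nu> {A<..} > 0"
    and R: "finite_borel_measure R" and c: "c > 0" and C: "C \<ge> 0" and \<rho>: "\<rho> \<ge> 0"
    and le: "\<And>z. z > A - c \<Longrightarrow> local_mass (tail_part \<nu> 1) c z \<le> C * local_mass R c z"
    and two: "\<And>x. C * two_big_jumps R c (A - c) x \<le> \<rho> * local_mass R c x"
    and k: "k \<ge> 1"
  shows "measure \<nu> {A<..} ^ k * local_mass (conv_power (uniform_measure \<nu> {A<..}) k) c x \<le> C * \<rho> ^ (k - 1) * local_mass R c x"
proof -
  let ?l = "measure \<nu> {A<..}" and ?F = "uniform_measure \<nu> {A<..}"
  note sets_nu = levy_measure_sets[OF lm] and fin = levy_measure_tail_finite[OF lm A]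
  have U: "real_distribution ?F"
    using real_distribution_uniform_measure[OF sets_nu _ fin l] by simp
  note FU = fbm_real_distribution[OF U] and T = fbm_levy_tail_part[OF lm A]
  note Uk = real_distribution_conv_power[OF U]
  note TR = fbm_tail_part[OF R, of "A - c"]
  have F_le: "?l * local_mass ?F c z \<le> C * local_mass R c z" if "z + c > A" for z
  proof -
    have "?l * local_mass ?F c z = local_mass (tail_part \<nu> A) c z" by (rule local_mass_uniform_tail[OF lm A l])
    also have "\<dots> \<le> local_mass (tail_part \<nu> 1) c z" by (rule local_mass_levy_tail_part_mono[OF lm _ A]) simp
    also have "\<dots> \<le> C * local_mass R c z" using that by (intro le) auto
    finally show ?thesis .
  qed
  have supp: "emeasure ?F {..A} = 0"
  proof -
    have "{A<..} \<inter> {..A} = {}" by auto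
    then show ?thesis using sets_nu by simp
  qed
  have zero: "local_mass (conv_power ?F k) c z = 0" if "z + c \<le> A" "k \<ge> 1" for z k
  proof -
    interpret K: real_distribution "conv_power ?F k" by (rule Uk)
    have "emeasure (conv_power ?F k) {z<..z + c} \<le> emeasure (conv_power ?F k) {..A}"
      using that by (intro emeasure_mono) auto
    then show ?thesis using conv_power_supported(2)[OF U supp _ that(2)] A by (simp add: local_mass_def measure_def)
  qed
  have F_TR: "?l * local_mass (?F \<star> tail_part R (A - c)) c x \<le> \<rho> * local_mass R c x" for x
  proof -
    have "local_mass (?F \<star> tail_part R (A - c)) c x \<le> (C / ?l) * local_mass (tail_part R (A - c) \<star> tail_part R (A - c)) c x"
    proof (rule local_mass_convolution_tail_le[OF FU TR R c])
      show "local_mass ?F c z = 0" if "z + c \<le> A" for z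
        using zero[OF that, of 1] by (simp add: convolution_return_0[OF U])
      show "local_mass ?F c z \<le> C / ?l * local_mass R c z" if "z + c > A" for z
        using F_le[OF that] l by (simp add: field_simps)
    qed (use C l in auto)
    then have "?l * local_mass (?F \<star> tail_part R (A - c)) c x \<le> C * two_big_jumps R c (A - c) x"
      using l by (simp add: two_big_jumps_def field_simps)
    also have "\<dots> \<le> \<rho> * local_mass R c x" by (rule two)
    finally show ?thesis .
  qed
  show ?thesis
    using k
  proof (induction k arbitrary: x rule: nat_induct_at_least)
    case base
    show ?case
    proof (cases "x + c > A")
      case True then show ?thesis using F_le[OF True] by (simp add: convolution_return_0[OF U])
    next
      case False then show ?thesis using zero[of x 1] C by simp
    qed
  next
    case (Suc k)
    have "local_mass (conv_power ?F (Suc k)) c x = local_mass (conv_power ?F k \<star> ?F) c x"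
      by (simp add: convolution_commutative_fbm[OF FU fbm_real_distribution[OF Uk]])
    also have "\<dots> \<le> (C * \<rho> ^ (k - 1) / ?l ^ k) * local_mass (tail_part R (A - c) \<star> ?F) c x"
    proof (rule local_mass_convolution_tail_le[OF fbm_real_distribution[OF Uk] FU R c])
      show "0 \<le> C * \<rho> ^ (k - 1) / ?l ^ k" using C \<rho> l by simp
      show "local_mass (conv_power ?F k) c z = 0" if "z + c \<le> A" for z using that Suc by (intro zero) auto
      show "local_mass (conv_power ?F k) c z \<le> C * \<rho> ^ (k - 1) / ?l ^ k * local_mass R c z" for z
        using Suc.IH[of z] l by (simp add: field_simps)
    qed
    finally have "?l ^ k * local_mass (conv_power ?F (Suc k)) c x \<le> C * \<rho> ^ (k - 1) * local_mass (tail_part R (A - c) \<star> ?F) c x"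
      using l by (simp add: field_simps)
    then have "?l * (?l ^ k * local_mass (conv_power ?F (Suc k)) c x) \<le> ?l * (C * \<rho> ^ (k - 1) * local_mass (tail_part R (A - c) \<star> ?F) c x)"
      using l by (intro mult_left_mono) auto
    also have "\<dots> = (C * \<rho> ^ (k - 1)) * (?l * local_mass (?F \<star> tail_part R (A - c)) c x)"
      by (simp add: convolution_commutative_fbm[OF TR FU])
    also have "\<dots> \<le> (C * \<rho> ^ (k - 1)) * (\<rho> * local_mass R c x)"
      using C \<rho> by (intro mult_left_mono F_TR) auto
    also have "\<dots> = C * \<rho> ^ (Suc k - 1) * local_mass R c x"
      using \<open>1 \<le> k\<close> by (cases k) auto
    finally show ?case by (simp add: mult_ac)
  qed
qed

lemma light_tail_negligible:
  assumes lt: "long_tailed_fun \<phi>" and ad: "almost_decreasing \<phi>"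
    and N: "real_distribution N" "integrable N exp"
  shows "((\<lambda>x. local_mass N c x / \<phi> x) \<longlongrightarrow> 0) at_top"
proof -
  interpret N: real_distribution N by fact
  note FD = fbm_real_distribution[OF real_distribution_dirac] and FN = fbm_real_distribution[OF N(1)]
  have [measurable]: "local_mass (return borel 0) c \<in> borel_measurable borel" using FD by measurable
  have "\<forall>\<^sub>F x in at_top. local_mass (return borel 0) c x / \<phi> x = 0"
    using eventually_gt_at_top[of 0] by eventually_elim (simp add: local_mass_def measure_return)
  then have "((\<lambda>x. local_mass (return borel 0) c x / \<phi> x) \<longlongrightarrow> 0) at_top" by (rule tendsto_eventually)
  from light_convolution_limit[OF lt ad _ _ local_mass_le[OF FD] this FN N(2)]
  have "((\<lambda>x. local_mass (return borel 0 \<star> N) c x / \<phi> x) \<longlongrightarrow> 0) at_top"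
    unfolding local_mass_convolution[OF FD FN] by simp
  then show ?thesis
    using convolution_return_0[OF N(1)] convolution_commutative_fbm[OF FD FN] by simp
qed

text \<open>For a high threshold \<open>A\<close>, the compound Poisson factor may be replaced by its part with a single jump: the
  part without a jump is light-tailed, and the parts with several jumps are controlled by
  \<open>local_mass_conv_power_le\<close>. The threshold is chosen before the factor \<open>N\<close>, which in the applications
  depends on it.\<close>

lemma one_big_jump_principle:
  assumes lm: "levy_measure \<nu>" and R: "real_distribution R" and c: "c > 0"
    and lt: "long_tailed_fun (local_mass R c)" and ad: "almost_decreasing (local_mass R c)"
    and neg: "negligible_two_big_jumps R c"
    and le: "\<forall>\<^sub>F z in at_top. local_mass (tail_part \<nu> 1) c z \<le> C * local_mass R c z"
    and e: "\<epsilon> > 0"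
  shows "\<exists>A1\<ge>1. \<forall>A\<ge>A1. \<forall>N. measure \<nu> {A<..} > 0 \<longrightarrow> real_distribution N \<longrightarrow> integrable N exp \<longrightarrow>
    (\<forall>\<^sub>F x in at_top. local_mass (cpoisson \<nu> {A<..} \<star> N) c x \<le>
      exp (- measure \<nu> {A<..}) * local_mass (tail_part \<nu> A \<star> N) c x + \<epsilon> * local_mass R c x)"
proof -
  note FR = fbm_real_distribution[OF R]
  note sets_nu = levy_measure_sets[OF lm]
  define C' where "C' = max C 1"
  have C': "C' > 0" by (simp add: C'_def)
  from le obtain y where y: "\<And>z. z \<ge> y \<Longrightarrow> local_mass (tail_part \<nu> 1) c z \<le> C * local_mass R c z"
    unfolding eventually_at_top_linorder by blast
  have y': "local_mass (tail_part \<nu> 1) c z \<le> C' * local_mass R c z" if "z \<ge> y" for z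
    using y[OF that] mult_right_mono[of C C' "local_mass R c z"] by (simp add: C'_def)
  define \<rho> where "\<rho> = min 1 (\<epsilon> / (6 * C'))"
  have \<rho>: "\<rho> > 0" "\<rho> \<le> 1" "6 * C' * \<rho> \<le> \<epsilon>" using e C' by (auto simp: \<rho>_def min_def field_simps)
  have "\<rho> / C' > 0" using \<rho> C' by simp
  with neg obtain A0 where A0: "\<And>A x. A \<ge> A0 \<Longrightarrow> two_big_jumps R c A x \<le> \<rho> / C' * local_mass R c x"
    unfolding negligible_two_big_jumps_def by blast
  define A1 where "A1 = max 1 (max (A0 + c) (y + c))"
  show ?thesis
  proof (intro exI[of _ A1] conjI allI impI)
    show "A1 \<ge> 1" by (simp add: A1_def)
    fix A N assume A1: "A \<ge> A1" and l: "measure \<nu> {A<..} > 0" and N: "real_distribution N" "integrable N exp"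
    have A: "A \<ge> 1" "A - c \<ge> A0" "A - c \<ge> y" using A1 by (auto simp: A1_def)
    let ?l = "measure \<nu> {A<..}" and ?F = "uniform_measure \<nu> {A<..}" and ?K = "cpoisson \<nu> {A<..}"
    note fin = levy_measure_tail_finite[OF lm A(1)]
    note T = fbm_levy_tail_part[OF lm A(1)] and FN = fbm_real_distribution[OF N(1)]
    interpret N: real_distribution N by (rule N)
    have K: "real_distribution ?K" by (rule real_distribution_cpoisson[OF sets_nu _ fin]) simp
    note FD = fbm_real_distribution[OF real_distribution_dirac]
    have pw: "?l ^ k * local_mass (conv_power ?F k) c x \<le> C' * \<rho> ^ (k - 1) * local_mass R c x" if "k \<ge> 1" for k x
    proof (rule local_mass_conv_power_le[OF lm A(1) l FR c _ _ _ _ that])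
      show "C' * two_big_jumps R c (A - c) x \<le> \<rho> * local_mass R c x" for x
        using A0[OF A(2), of x] C' by (simp add: field_simps)
    qed (use y' A C' \<rho> in auto)
    have Kle: "local_mass ?K c x \<le> local_mass (return borel 0) c x + exp (- ?l) * local_mass (tail_part \<nu> A) c x + 3 * C' * \<rho> * local_mass R c x" for x
    proof -
      have "local_mass ?K c x \<le> indicator {x<..x + c} 0 + exp (- ?l) * (?l * local_mass ?F c x) + 3 * (C' * \<rho> * local_mass R c x)"
        unfolding local_mass_def
      proof (rule cpoisson_le[OF sets_nu _ fin l])
        fix k :: nat assume k: "k \<ge> 2"
        have "?l ^ k * measure (conv_power ?F k) {x<..x + c} \<le> C' * \<rho> ^ (k - 1) * local_mass R c x"
          using pw[of k x] k by (simp add: local_mass_def)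
        also have "\<dots> \<le> C' * \<rho> * local_mass R c x"
          using \<rho> k C' power_decreasing[of 1 "k - 1" \<rho>] by (intro mult_right_mono mult_left_mono) auto
        finally show "?l ^ k * measure (conv_power ?F k) {x<..x + c} \<le> C' * \<rho> * measure R {x<..x + c}"
          by (simp add: local_mass_def)
      qed (use C' \<rho> in auto)
      then show ?thesis
        by (simp add: local_mass_uniform_tail[OF lm A(1) l] local_mass_def[of "return borel 0"] measure_return mult.assoc)
    qed
    have conv: "local_mass (?K \<star> N) c x \<le> local_mass N c x + exp (- ?l) * local_mass (tail_part \<nu> A \<star> N) c x
        + 3 * C' * \<rho> * local_mass (R \<star> N) c x" for x
    proof -
      note i = integrable_local_mass_shift[OF FD FN] integrable_local_mass_shift[OF T FN]
        integrable_local_mass_shift[OF FR FN] integrable_local_mass_shift[OF fbm_real_distribution[OF K] FN]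
      have "local_mass (?K \<star> N) c x \<le> (\<integral>s. local_mass (return borel 0) c (x - s) + exp (- ?l) * local_mass (tail_part \<nu> A) c (x - s)
           + 3 * C' * \<rho> * local_mass R c (x - s) \<partial>N)"
        unfolding local_mass_convolution[OF fbm_real_distribution[OF K] FN] using Kle
        by (intro integral_mono Bochner_Integration.integrable_add integrable_mult_right i)
      also have "\<dots> = local_mass (return borel 0 \<star> N) c x + exp (- ?l) * local_mass (tail_part \<nu> A \<star> N) c x
        + 3 * C' * \<rho> * local_mass (R \<star> N) c x"
        unfolding local_mass_convolution[OF FD FN] local_mass_convolution[OF T FN] local_mass_convolution[OF FR FN]
        using i by simp
      finally show ?thesis
        using convolution_return_0[OF N(1)] convolution_commutative_fbm[OF FD FN] by simp
    qed
    have [measurable]: "local_mass R c \<in> borel_measurable borel" using FR by measurable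
    have "((\<lambda>x. local_mass R c x / local_mass R c x) \<longlongrightarrow> 1) at_top"
      using long_tailed_fun_pos[OF lt] by (intro tendsto_eventually) (auto elim: eventually_mono)
    from light_convolution_limit[OF lt ad _ _ local_mass_le[OF FR] this FN N(2)]
    have "((\<lambda>x. local_mass (R \<star> N) c x / local_mass R c x) \<longlongrightarrow> 1) at_top"
      unfolding local_mass_convolution[OF FR FN] using N.prob_space by simp
    then have "((\<lambda>x. local_mass N c x / local_mass R c x + 3 * C' * \<rho> * (local_mass (R \<star> N) c x / local_mass R c x)) \<longlongrightarrow> 0 + 3 * C' * \<rho> * 1) at_top"
      by (intro tendsto_intros light_tail_negligible[OF lt ad N])
    then have "\<forall>\<^sub>F x in at_top. local_mass N c x / local_mass R c x + 3 * C' * \<rho> * (local_mass (R \<star> N) c x / local_mass R c x) < \<epsilon>"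
      by (rule order_tendstoD(2)) (use \<rho> C' e mult_pos_pos[OF C' \<rho>(1)] in linarith)
    with long_tailed_fun_pos[OF lt]
    show "\<forall>\<^sub>F x in at_top. local_mass (?K \<star> N) c x \<le>
      exp (- ?l) * local_mass (tail_part \<nu> A \<star> N) c x + \<epsilon> * local_mass R c x"
    proof eventually_elim
      case (elim x)
      have "local_mass N c x + 3 * C' * \<rho> * local_mass (R \<star> N) c x \<le> \<epsilon> * local_mass R c x"
        using elim by (simp add: field_simps)
      then show ?case using conv[of x] by linarith
    qed
  qed
qed

lemma cpoisson_convolution_ge:
  assumes lm: "levy_measure \<nu>" and A: "A \<ge> 1" and l: "measure \<nu> {A<..} > 0"
    and N: "real_distribution N"
  shows "exp (- measure \<nu> {A<..}) * (local_mass (tail_part \<nu> A \<star> N) c x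
      + local_mass ((tail_part \<nu> A \<star> tail_part \<nu> A) \<star> N) c x / 2) \<le> local_mass (cpoisson \<nu> {A<..} \<star> N) c x"
proof -
  let ?l = "measure \<nu> {A<..}" and ?F = "uniform_measure \<nu> {A<..}" and ?K = "cpoisson \<nu> {A<..}"
  note sets_nu = levy_measure_sets[OF lm] and fin = levy_measure_tail_finite[OF lm A]
  have K: "real_distribution ?K" by (rule real_distribution_cpoisson[OF sets_nu _ fin]) simp
  note T = fbm_levy_tail_part[OF lm A] and FN = fbm_real_distribution[OF N] and FK = fbm_real_distribution[OF K]
  note T2 = fbm_convolution[OF T T]
  have "exp (- ?l) * (local_mass (tail_part \<nu> A) c z + local_mass (tail_part \<nu> A \<star> tail_part \<nu> A) c z / 2) \<le> local_mass ?K c z" for z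
    using cpoisson_ge[OF sets_nu _ fin l, of "{z<..z + c}"]
    unfolding local_mass_def[symmetric] local_mass_uniform_tail[OF lm A l] local_mass_uniform_tail_square[OF lm A l, symmetric]
    by simp
  then have "(\<integral>s. exp (- ?l) * (local_mass (tail_part \<nu> A) c (x - s) + local_mass (tail_part \<nu> A \<star> tail_part \<nu> A) c (x - s) / 2) \<partial>N)
     \<le> (\<integral>s. local_mass ?K c (x - s) \<partial>N)"
    by (intro integral_mono integrable_mult_right Bochner_Integration.integrable_add integrable_divide_zero
        integrable_local_mass_shift T T2 FN FK) auto
  then show ?thesis
    unfolding local_mass_convolution[OF T FN] local_mass_convolution[OF T2 FN] local_mass_convolution[OF FK FN]
    using integrable_local_mass_shift[OF T FN] integrable_local_mass_shift[OF T2 FN] by simp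
qed

lemma cpoisson_convolution_ge_single:
  assumes lm: "levy_measure \<nu>" and A: "A \<ge> 1" and l: "measure \<nu> {A<..} > 0"
    and N: "real_distribution N"
  shows "exp (- measure \<nu> {A<..}) * local_mass (tail_part \<nu> A \<star> N) c x \<le> local_mass (cpoisson \<nu> {A<..} \<star> N) c x"
proof -
  have "exp (- measure \<nu> {A<..}) * local_mass (tail_part \<nu> A \<star> N) c x \<le> exp (- measure \<nu> {A<..}) *
    (local_mass (tail_part \<nu> A \<star> N) c x + local_mass ((tail_part \<nu> A \<star> tail_part \<nu> A) \<star> N) c x / 2)"
    by (intro mult_left_mono) auto
  then show ?thesis using cpoisson_convolution_ge[OF assms, of c x] by linarith
qed

text \<open>A local mass of \<open>G\<close> can be read off from \<open>G \<star> N\<close> on a window of twice the length.\<close>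

lemma local_mass_le_convolution:
  assumes G: "finite_borel_measure G" and N: "real_distribution N" and c: "c > 0"
  shows "measure N {w<..w + c} * local_mass G c x \<le> local_mass (G \<star> N) (2 * c) (x + w)"
proof -
  interpret N: real_distribution N by fact
  interpret G: finite_borel_measure G by fact
  note FN = fbm_real_distribution[OF N]
  have "measure N {w<..w + c} * local_mass G c x = (\<integral>s. indicator {w<..w + c} s * local_mass G c x \<partial>N)" by simp
  also have "\<dots> \<le> (\<integral>s. local_mass G (2 * c) (x + w - s) \<partial>N)"
  proof (rule integral_mono)
    show "indicator {w<..w + c} s * local_mass G c x \<le> local_mass G (2 * c) (x + w - s)" for s
    proof (cases "s \<in> {w<..w + c}")
      case True
      then show ?thesis unfolding local_mass_def
        by (simp, intro G.finite_measure_mono) (auto simp: G.M_is_borel)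
    qed simp
  qed (use integrable_local_mass_shift[OF G FN] in \<open>auto intro!: N.integrable_const_bound[where B = 1]\<close>)
  also have "\<dots> = local_mass (G \<star> N) (2 * c) (x + w)" by (rule local_mass_convolution[OF G FN, symmetric])
  finally show ?thesis .
qed

lemma levy_tail_mass:
  assumes lm: "levy_measure \<nu>" and l: "measure \<nu> {1<..} > 0"
  shows "real_distribution (levy_tail \<nu>)"
    and "local_mass (tail_part \<nu> 1) c x = measure \<nu> {1<..} * local_mass (levy_tail \<nu>) c x"
    and "x \<ge> 1 \<Longrightarrow> local_mass \<nu> c x = measure \<nu> {1<..} * local_mass (levy_tail \<nu>) c x"
proof -
  show "real_distribution (levy_tail \<nu>)"
    using real_distribution_uniform_measure[OF levy_measure_sets[OF lm] _ levy_measure_tail_finite[OF lm order_refl] l]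
    by (simp add: levy_tail_def)
  show eq: "local_mass (tail_part \<nu> 1) c x = measure \<nu> {1<..} * local_mass (levy_tail \<nu>) c x"
    using local_mass_uniform_tail[OF lm order_refl l] by (simp add: levy_tail_def)
  show "x \<ge> 1 \<Longrightarrow> local_mass \<nu> c x = measure \<nu> {1<..} * local_mass (levy_tail \<nu>) c x"
    using local_mass_tail_part_eq[OF levy_measure_sets[OF lm], of 1 x c] eq by simp
qed

lemma two_big_jumps_levy_tail:
  assumes lm: "levy_measure \<nu>" and l: "measure \<nu> {1<..} > 0" and A: "A \<ge> 1"
  shows "(measure \<nu> {1<..})\<^sup>2 * two_big_jumps (levy_tail \<nu>) c A x = local_mass (tail_part \<nu> A \<star> tail_part \<nu> A) c x"
proof -
  let ?R = "levy_tail \<nu>" and ?\<kappa> = "measure \<nu> {1<..}"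
  note sets_nu = levy_measure_sets[OF lm]
  have R: "real_distribution ?R" by (rule levy_tail_mass(1)[OF lm l])
  interpret R: real_distribution ?R by (rule R)
  note TR = fbm_tail_part[OF fbm_real_distribution[OF R], of A] and T = fbm_levy_tail_part[OF lm A]
  have int: "?\<kappa> * (\<integral>s. f s \<partial>(tail_part ?R A)) = (\<integral>s. f s \<partial>(tail_part \<nu> A))"
    if [measurable]: "f \<in> borel_measurable borel" for f :: "real \<Rightarrow> real"
  proof -
    have "?\<kappa> * (\<integral>s. f s \<partial>(tail_part ?R A)) = ?\<kappa> * (\<integral>s. indicator {A<..} s * f s \<partial>?R)"
      by (subst integral_tail_part) auto
    also have "\<dots> = (\<integral>s. indicator {A<..} s * f s \<partial>(tail_part \<nu> 1))"
      unfolding levy_tail_def by (rule integral_uniform_tail[OF lm order_refl l]) measurable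
    also have "\<dots> = (\<integral>s. indicator {1<..} s * (indicator {A<..} s * f s) \<partial>\<nu>)"
      by (rule integral_tail_part[OF sets_nu]) measurable
    also have "\<dots> = (\<integral>s. indicator {A<..} s * f s \<partial>\<nu>)"
      using A by (intro Bochner_Integration.integral_cong refl) (auto split: split_indicator)
    also have "\<dots> = (\<integral>s. f s \<partial>(tail_part \<nu> A))" by (rule integral_tail_part[OF sets_nu, symmetric]) measurable
    finally show ?thesis .
  qed
  have lmass: "?\<kappa> * local_mass (tail_part ?R A) c z = local_mass (tail_part \<nu> A) c z" for z
    unfolding local_mass_integral[OF TR] local_mass_integral[OF T] by (rule int) simp
  have [measurable]: "local_mass (tail_part \<nu> A) c \<in> borel_measurable borel" using T by measurable
  have "?\<kappa>\<^sup>2 * two_big_jumps ?R c A x = ?\<kappa> * (\<integral>s. ?\<kappa> * local_mass (tail_part ?R A) c (x - s) \<partial>(tail_part ?R A))"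
    unfolding two_big_jumps_def local_mass_convolution[OF TR TR] by (simp add: power2_eq_square)
  also have "\<dots> = ?\<kappa> * (\<integral>s. local_mass (tail_part \<nu> A) c (x - s) \<partial>(tail_part ?R A))" by (simp only: lmass)
  also have "\<dots> = (\<integral>s. local_mass (tail_part \<nu> A) c (x - s) \<partial>(tail_part \<nu> A))" by (rule int) measurable
  also have "\<dots> = local_mass (tail_part \<nu> A \<star> tail_part \<nu> A) c x" by (rule local_mass_convolution[OF T T, symmetric])
  finally show ?thesis .
qed

lemma levy_measure_tail_pos:
  assumes lm: "levy_measure \<nu>" and A: "A \<ge> 1"
    and pos: "\<forall>\<^sub>F x in at_top. 0 < local_mass (tail_part \<nu> 1) c x"
  shows "measure \<nu> {A<..} > 0"
proof -
  note sets_nu = levy_measure_sets[OF lm]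
  from pos eventually_ge_at_top[of A] have "\<forall>\<^sub>F x in at_top. 0 < local_mass (tail_part \<nu> 1) c x \<and> A \<le> x"
    by eventually_elim auto
  then obtain x where x: "0 < local_mass (tail_part \<nu> 1) c x" "A \<le> x"
    using eventually_happens'[OF trivial_limit_at_top_linorder] by blast
  have "local_mass (tail_part \<nu> 1) c x = measure \<nu> {x<..x + c}"
    using local_mass_tail_part_eq[OF sets_nu, of 1 x c] x(2) A by (simp add: local_mass_def)
  also have "\<dots> \<le> measure \<nu> {A<..}"
    using x(2) sets_nu levy_measure_tail_finite[OF lm A] by (intro measure_mono_fmeasurable fmeasurableI) auto
  finally show ?thesis using x(1) by linarith
qed

lemma single_jump_limit:
  assumes lm: "levy_measure \<nu>" and A: "A \<ge> 1"
    and lt: "long_tailed_fun \<phi>" and ad: "almost_decreasing \<phi>"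
    and lim: "((\<lambda>x. local_mass (tail_part \<nu> 1) c x / \<phi> x) \<longlongrightarrow> \<kappa>) at_top"
    and N: "real_distribution N" "integrable N exp"
  shows "((\<lambda>x. local_mass (tail_part \<nu> A \<star> N) c x / \<phi> x) \<longlongrightarrow> \<kappa>) at_top"
proof -
  interpret N: real_distribution N by fact
  note T = fbm_levy_tail_part[OF lm A] and FN = fbm_real_distribution[OF N(1)]
  note sets_nu = levy_measure_sets[OF lm]
  have [measurable]: "local_mass (tail_part \<nu> A) c \<in> borel_measurable borel" using T by measurable
  have "\<forall>\<^sub>F x in at_top. local_mass (tail_part \<nu> 1) c x / \<phi> x = local_mass (tail_part \<nu> A) c x / \<phi> x"
    using eventually_ge_at_top[of A]
  proof eventually_elim
    case (elim x)
    then show ?case using local_mass_tail_part_eq[OF sets_nu, of 1 x c] local_mass_tail_part_eq[OF sets_nu, of A x c] A by simp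
  qed
  with lim have "((\<lambda>x. local_mass (tail_part \<nu> A) c x / \<phi> x) \<longlongrightarrow> \<kappa>) at_top" by (rule Lim_transform_eventually)
  from light_convolution_limit[OF lt ad _ _ local_mass_le[OF T] this FN N(2)]
  show ?thesis unfolding local_mass_convolution[OF T FN] using N.prob_space by simp
qed

lemma tail_rate_small:
  assumes lm: "levy_measure \<nu>" and e: "\<epsilon> > 0"
  shows "\<exists>A0\<ge>1. \<forall>A\<ge>A0. measure \<nu> {A<..} < \<epsilon>"
proof -
  note sets_nu = levy_measure_sets[OF lm]
  from levy_measure_tail_small[OF lm e] obtain A0 where A0: "A0 \<ge> 1" "\<And>A. A \<ge> A0 \<Longrightarrow> measure \<nu> (- {-A..A}) < \<epsilon>" by blast
  show ?thesis
  proof (intro exI[of _ A0] conjI allI impI A0(1))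
    fix A assume A: "A \<ge> A0"
    have "emeasure \<nu> (- {-A..A}) < \<infinity>" by (rule levy_measure_finite_away[OF lm, of 1]) (use A A0(1) in auto)
    then have "measure \<nu> {A<..} \<le> measure \<nu> (- {-A..A})"
      using A A0(1) sets_nu by (intro measure_mono_fmeasurable fmeasurableI) auto
    then show "measure \<nu> {A<..} < \<epsilon>" using A0(2)[OF A] by linarith
  qed
qed

section \<open>Subexponential Levy tails\<close>

text \<open>The part of \<open>\<mu>\<close> with one jump above \<open>A\<close> has mass \<open>exp (- \<nu> {A<..})\<close> times that of \<open>\<nu>\<close>, asymptotically: the
  light-tailed factor is invisible because \<open>\<nu>\<close> itself is long-tailed. Let \<open>A\<close> tend to infinity.\<close>

lemma subexponential_levy_tail_imp_local_equivalence:
  assumes mu: "real_distribution \<mu>" and hl: "has_levy_measure \<mu> \<nu>" and l: "measure \<nu> {1<..} > 0" and c: "c > 0"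
    and S: "levy_tail \<nu> \<in> S_Delta c" and D: "levy_tail \<nu> \<in> D_Delta c"
  shows "((\<lambda>x. local_mass \<mu> c x / local_mass (levy_tail \<nu>) c x) \<longlongrightarrow> measure \<nu> {1<..}) at_top"
proof -
  from hl have lm: "levy_measure \<nu>" by (simp add: has_levy_measure_def)
  let ?R = "levy_tail \<nu>" and ?\<kappa> = "measure \<nu> {1<..}"
  note R = levy_tail_mass(1)[OF lm l]
  have lt: "long_tailed_fun (local_mass ?R c)" and ad: "almost_decreasing (local_mass ?R c)"
    using S D by (auto simp: S_Delta_def L_Delta_def D_Delta_def)
  note pos = long_tailed_fun_pos[OF lt]
  have neg: "negligible_two_big_jumps ?R c"
    using S local_subexponential_iff[OF R c lt ad] by (simp add: S_Delta_def)
  have lim: "((\<lambda>x. local_mass (tail_part \<nu> 1) c x / local_mass ?R c x) \<longlongrightarrow> ?\<kappa>) at_top"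
    by (intro tendsto_eventually) (use pos in eventually_elim, simp add: levy_tail_mass(2)[OF lm l])
  have pos1: "\<forall>\<^sub>F x in at_top. 0 < local_mass (tail_part \<nu> 1) c x"
    using pos by eventually_elim (simp add: levy_tail_mass(2)[OF lm l] l)
  have le: "\<forall>\<^sub>F z in at_top. local_mass (tail_part \<nu> 1) c z \<le> ?\<kappa> * local_mass ?R c z"
    by (simp add: levy_tail_mass(2)[OF lm l])
  show ?thesis
  proof (rule tendstoI)
    fix \<epsilon> :: real assume e: "\<epsilon> > 0"
    have "\<epsilon> / 4 > 0" using e by simp
    from one_big_jump_principle[OF lm R c lt ad neg le this] obtain A1 where A1: "A1 \<ge> 1"
      "\<And>A N. A \<ge> A1 \<Longrightarrow> measure \<nu> {A<..} > 0 \<Longrightarrow> real_distribution N \<Longrightarrow> integrable N exp \<Longrightarrow>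
        \<forall>\<^sub>F x in at_top. local_mass (cpoisson \<nu> {A<..} \<star> N) c x \<le>
          exp (- measure \<nu> {A<..}) * local_mass (tail_part \<nu> A \<star> N) c x + \<epsilon> / 4 * local_mass ?R c x" by blast
    have "\<epsilon> / (4 * ?\<kappa>) > 0" using e l by simp
    from tail_rate_small[OF lm this] obtain A2 where A2: "\<And>A. A \<ge> A2 \<Longrightarrow> measure \<nu> {A<..} < \<epsilon> / (4 * ?\<kappa>)" by blast
    define A where "A = max A1 A2"
    have A: "A \<ge> A1" "A \<ge> A2" "A \<ge> 1" using A1(1) by (auto simp: A_def)
    let ?l = "measure \<nu> {A<..}"
    have lA: "?l > 0" by (rule levy_measure_tail_pos[OF lm A(3) pos1])
    from positive_jumps_decomposition[OF mu hl A(3)] obtain N where N: "real_distribution N" "integrable N exp"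
      "\<mu> = (cpoisson \<nu> {A<..} \<star> N)" by blast
    have ub: "\<forall>\<^sub>F x in at_top. local_mass \<mu> c x \<le> exp (- ?l) * local_mass (tail_part \<nu> A \<star> N) c x + \<epsilon> / 4 * local_mass ?R c x"
      unfolding N(3) by (rule A1(2)[OF A(1) lA N(1,2)])
    have lb: "exp (- ?l) * local_mass (tail_part \<nu> A \<star> N) c x \<le> local_mass \<mu> c x" for x
      unfolding N(3) by (rule cpoisson_convolution_ge_single[OF lm A(3) lA N(1)])
    have el: "?\<kappa> * (1 - exp (- ?l)) < \<epsilon> / 4"
    proof -
      have "1 - exp (- ?l) \<le> ?l" using exp_ge_add_one_self[of "- ?l"] by simp
      then have "?\<kappa> * (1 - exp (- ?l)) \<le> ?\<kappa> * ?l" using l by (intro mult_left_mono) auto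
      also have "\<dots> < ?\<kappa> * (\<epsilon> / (4 * ?\<kappa>))" using A2[OF A(2)] l by (intro mult_strict_left_mono) auto
      finally show ?thesis using l by simp
    qed
    have "\<forall>\<^sub>F x in at_top. dist (local_mass (tail_part \<nu> A \<star> N) c x / local_mass ?R c x) ?\<kappa> < \<epsilon> / 4"
      by (rule tendstoD[OF single_jump_limit[OF lm A(3) lt ad lim N(1,2)]]) (use e in auto)
    with ub pos show "\<forall>\<^sub>F x in at_top. dist (local_mass \<mu> c x / local_mass ?R c x) ?\<kappa> < \<epsilon>"
    proof eventually_elim
      case (elim x)
      define t where "t = local_mass (tail_part \<nu> A \<star> N) c x / local_mass ?R c x"
      define m where "m = local_mass \<mu> c x / local_mass ?R c x"
      have t: "\<bar>t - ?\<kappa>\<bar> < \<epsilon> / 4" using elim(3) by (simp add: t_def dist_real_def)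
      have "exp (- ?l) * t \<le> m" using lb[of x] elim(2) by (simp add: t_def m_def divide_right_mono)
      moreover have "m \<le> exp (- ?l) * t + \<epsilon> / 4" using elim(1,2) by (simp add: t_def m_def field_simps)
      moreover have "\<bar>exp (- ?l) * t - t\<bar> \<le> \<epsilon> / 4 + \<epsilon> / 4"
      proof -
        have e1: "0 \<le> 1 - exp (- ?l)" "1 - exp (- ?l) \<le> 1" using lA by auto
        have "\<bar>exp (- ?l) * t - t\<bar> = (1 - exp (- ?l)) * \<bar>t\<bar>"
          using e1(1) by (subst abs_of_nonneg[OF e1(1), symmetric], subst abs_mult[symmetric]) (simp add: algebra_simps abs_minus_commute)
        also have "\<dots> \<le> (1 - exp (- ?l)) * (?\<kappa> + \<epsilon> / 4)"
        proof (rule mult_left_mono[OF _ e1(1)])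
          show "\<bar>t\<bar> \<le> ?\<kappa> + \<epsilon> / 4" using t l by linarith
        qed
        also have "\<dots> = ?\<kappa> * (1 - exp (- ?l)) + (1 - exp (- ?l)) * (\<epsilon> / 4)" by (simp add: algebra_simps)
        also have "\<dots> \<le> \<epsilon> / 4 + 1 * (\<epsilon> / 4)" using el e1 e by (intro add_mono mult_right_mono) auto
        finally show ?thesis by simp
      qed
      ultimately have "\<bar>m - ?\<kappa>\<bar> < \<epsilon>" using t by linarith
      then show ?case by (simp add: m_def dist_real_def)
    qed
  qed
qed

section \<open>From local equivalence to subexponentiality\<close>

lemma local_mass_double:
  assumes "finite_borel_measure R" "c > 0"
  shows "local_mass R (2 * c) x = local_mass R c x + local_mass R c (x + c)"
  using local_mass_cdf[OF assms(1), of "2 * c" x] local_mass_cdf[OF assms(1), of c x]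
    local_mass_cdf[OF assms(1), of c "x + c"] assms(2) by (simp add: algebra_simps)

lemma double_window_limit:
  assumes R: "finite_borel_measure R" and c: "c > 0" and lt: "long_tailed_fun (local_mass R c)"
  shows "((\<lambda>x. local_mass R (2 * c) (x + w) / local_mass R c x) \<longlongrightarrow> 2) at_top"
  using tendsto_add[OF long_tailed_fun_shift[OF lt, of w] long_tailed_fun_shift[OF lt, of "w + c"]]
  by (simp add: local_mass_double[OF R c] add_divide_distrib add.assoc)

lemma charged_window:
  assumes mu: "real_distribution \<mu>" and c: "c > 0"
  obtains w where "measure \<mu> {w<..w + c} > 0"
proof -
  interpret real_distribution \<mu> by fact
  have "\<exists>w. measure \<mu> {w<..w + c} > 0"
  proof (rule ccontr)
    assume "\<not> ?thesis"
    then have z: "measure \<mu> {w<..w + c} = 0" for w using zero_less_measure_iff by blast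
    have cover: "(\<Union>k::int. {of_int k * c<..of_int k * c + c}) = (UNIV :: real set)"
    proof (intro set_eqI iffI UNIV_I)
      fix x :: real
      define k where "k = \<lceil>x / c\<rceil> - 1"
      have "of_int k < x / c" "x / c \<le> of_int k + 1" by (auto simp: k_def, linarith+)
      then have "of_int k * c < x" "x \<le> of_int k * c + c" using c by (auto simp: field_simps)
      then show "x \<in> (\<Union>k::int. {of_int k * c<..of_int k * c + c})" by auto
    qed
    have "(\<Union>k::int. {of_int k * c<..of_int k * c + c}) \<in> null_sets \<mu>"
      by (rule null_sets_UN) (simp add: null_sets_def emeasure_eq_measure z)
    then have "emeasure \<mu> (\<Union>k::int. {of_int k * c<..of_int k * c + c}) = 0" by (rule null_setsD1)
    then show False using cover emeasure_space_1 by simp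
  qed
  then show ?thesis using that by blast
qed

text \<open>The factor \<open>N\<close> charges the same window as \<open>\<mu>\<close>, up to the small rate of the jumps above
  \<open>A\<close>.\<close>

lemma factor_charges_window:
  assumes lm: "levy_measure \<nu>" and A: "A \<ge> 1" and N: "real_distribution N"
    and X: "X \<in> sets borel"
  shows "measure (cpoisson \<nu> {A<..} \<star> N) X - 2 * measure \<nu> {A<..} \<le> measure N X"
proof -
  note sets_nu = levy_measure_sets[OF lm] and fin = levy_measure_tail_finite[OF lm A]
  have K: "real_distribution (cpoisson \<nu> {A<..})" by (rule real_distribution_cpoisson[OF sets_nu _ fin]) simp
  interpret N: real_distribution N by fact
  interpret M: real_distribution "cpoisson \<nu> {A<..} \<star> N" by (rule real_distribution_convolution[OF K N])
  have "\<bar>(\<integral>x. indicator X x \<partial>(cpoisson \<nu> {A<..} \<star> N)) - (\<integral>x. indicator X x \<partial>N)\<bar> \<le> 2 * 1 * (1 - exp (- measure \<nu> {A<..}))"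
    by (rule cpoisson_perturbation[OF sets_nu _ fin N]) (use X in \<open>auto split: split_indicator\<close>)
  then have "measure (cpoisson \<nu> {A<..} \<star> N) X - measure N X \<le> 2 * (1 - exp (- measure \<nu> {A<..}))"
    using X by (simp add: abs_le_iff)
  also have "2 * (1 - exp (- measure \<nu> {A<..})) \<le> 2 * measure \<nu> {A<..}"
    using exp_ge_add_one_self[of "- measure \<nu> {A<..}"] by simp
  finally show ?thesis by simp
qed

text \<open>If \<open>\<mu>\<close> and \<open>\<nu>\<close> are locally equivalent, the part of \<open>\<mu>\<close> with a single jump above \<open>A\<close> exhausts almost all of the
  local mass, so that little is left for two jumps. This bounds two big jumps smoothed by the factor \<open>N\<close>;
  the smoothing is undone at the price of doubling the window, and the constants stay bounded because \<open>N\<close>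
  approaches \<open>\<mu>\<close> as \<open>A\<close> grows.\<close>

lemma local_equivalence_imp_negligible_two_big_jumps:
  assumes mu: "real_distribution \<mu>" and hl: "has_levy_measure \<mu> \<nu>" and l: "measure \<nu> {1<..} > 0" and c: "c > 0"
    and L: "levy_tail \<nu> \<in> L_Delta c" "levy_tail \<nu> \<in> L_Delta (2 * c)" and D: "levy_tail \<nu> \<in> D_Delta (2 * c)"
    and eq: "((\<lambda>x. local_mass \<mu> (2 * c) x / local_mass (levy_tail \<nu>) (2 * c) x) \<longlongrightarrow> measure \<nu> {1<..}) at_top"
  shows "negligible_two_big_jumps (levy_tail \<nu>) c"
proof -
  from hl have lm: "levy_measure \<nu>" by (simp add: has_levy_measure_def)
  let ?R = "levy_tail \<nu>" and ?\<kappa> = "measure \<nu> {1<..}"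
  note R = levy_tail_mass(1)[OF lm l]
  note FR = fbm_real_distribution[OF R]
  interpret mu: real_distribution \<mu> by fact
  have lt: "long_tailed_fun (local_mass ?R c)" and lt2: "long_tailed_fun (local_mass ?R (2 * c))"
    and ad2: "almost_decreasing (local_mass ?R (2 * c))"
    using L D by (auto simp: L_Delta_def D_Delta_def)
  note pos = long_tailed_fun_pos[OF lt] and pos2 = long_tailed_fun_pos[OF lt2]
  have pos1: "\<forall>\<^sub>F x in at_top. 0 < local_mass (tail_part \<nu> 1) c x"
    using pos by eventually_elim (simp add: levy_tail_mass(2)[OF lm l] l)
  have lim: "((\<lambda>x. local_mass (tail_part \<nu> 1) (2 * c) x / local_mass ?R (2 * c) x) \<longlongrightarrow> ?\<kappa>) at_top"
    by (intro tendsto_eventually) (use pos2 in eventually_elim, simp add: levy_tail_mass(2)[OF lm l])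
  obtain w where w: "measure \<mu> {w<..w + c} > 0" by (rule charged_window[OF mu c])
  define p where "p = measure \<mu> {w<..w + c} / 2"
  have p: "p > 0" using w by (simp add: p_def)
  show ?thesis
  proof (rule negligible_two_big_jumpsI[OF FR])
    fix \<epsilon> :: real assume e: "\<epsilon> > 0"
    define \<delta> where "\<delta> = min 1 (min (p / 2) (\<epsilon> * ?\<kappa> * p / 24))"
    have "\<delta> > 0" "\<delta> \<le> 1" "\<delta> \<le> p / 2" "\<delta> \<le> \<epsilon> * ?\<kappa> * p / 24"
      using p e l by (auto simp: \<delta>_def)
    then have \<delta>: "\<delta> > 0" "\<delta> \<le> 1" "2 * \<delta> \<le> p" "24 * \<delta> \<le> \<epsilon> * ?\<kappa> * p" by linarith+
    from tail_rate_small[OF lm \<delta>(1)] obtain A where A: "A \<ge> 1" "measure \<nu> {A<..} < \<delta>" by auto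
    let ?l = "measure \<nu> {A<..}" and ?T = "tail_part \<nu> A"
    have lA: "?l > 0" by (rule levy_measure_tail_pos[OF lm A(1) pos1])
    from positive_jumps_decomposition[OF mu hl A(1)] obtain N where N: "real_distribution N" "integrable N exp"
      "\<mu> = (cpoisson \<nu> {A<..} \<star> N)" by blast
    note T = fbm_levy_tail_part[OF lm A(1)]
    note T2 = fbm_convolution[OF T T]
    have pN: "p \<le> measure N {w<..w + c}"
    proof -
      have "measure \<mu> {w<..w + c} - 2 * ?l \<le> measure N {w<..w + c}"
        unfolding N(3) by (rule factor_charges_window[OF lm A(1) N(1)]) simp
      then show ?thesis using A(2) \<delta>(3) unfolding p_def by linarith
    qed
    have el: "exp ?l - 1 \<le> 2 * \<delta>"
    proof -
      have "exp ?l \<le> 1 + ?l + ?l\<^sup>2" using A(2) \<delta>(2) by (intro exp_bound) auto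
      moreover have "?l\<^sup>2 \<le> ?l" using A(2) \<delta>(2) lA by (simp add: power2_eq_square mult_left_le)
      ultimately show ?thesis using A(2) by linarith
    qed
    \<comment> \<open>The mass of two big jumps is what remains of \<open>\<mu>\<close> after removing one big jump.\<close>
    have "((\<lambda>x. 2 * (exp ?l * (local_mass \<mu> (2 * c) x / local_mass ?R (2 * c) x) - local_mass (?T \<star> N) (2 * c) x / local_mass ?R (2 * c) x))
       \<longlongrightarrow> 2 * (exp ?l * ?\<kappa> - ?\<kappa>)) at_top"
      by (intro tendsto_intros eq single_jump_limit[OF lm A(1) lt2 ad2 lim N(1,2)])
    moreover have "2 * (exp ?l * ?\<kappa> - ?\<kappa>) < 8 * \<delta> * ?\<kappa>"
    proof -
      have "2 * (exp ?l * ?\<kappa> - ?\<kappa>) = 2 * ?\<kappa> * (exp ?l - 1)" by (simp add: algebra_simps)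
      also have "\<dots> \<le> 2 * ?\<kappa> * (2 * \<delta>)" using el l by (intro mult_left_mono) auto
      also have "\<dots> < 8 * \<delta> * ?\<kappa>" using \<delta>(1) l by simp
      finally show ?thesis .
    qed
    ultimately have "\<forall>\<^sub>F x in at_top. 2 * (exp ?l * (local_mass \<mu> (2 * c) x / local_mass ?R (2 * c) x) - local_mass (?T \<star> N) (2 * c) x / local_mass ?R (2 * c) x) < 8 * \<delta> * ?\<kappa>"
      by (rule order_tendstoD(2))
    with pos2 have smooth: "\<forall>\<^sub>F x in at_top. local_mass ((?T \<star> ?T) \<star> N) (2 * c) x \<le> 8 * \<delta> * ?\<kappa> * local_mass ?R (2 * c) x"
    proof eventually_elim
      case (elim x)
      have "exp (- ?l) * (local_mass (?T \<star> N) (2 * c) x + local_mass ((?T \<star> ?T) \<star> N) (2 * c) x / 2) \<le> local_mass \<mu> (2 * c) x"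
        unfolding N(3) by (rule cpoisson_convolution_ge[OF lm A(1) lA N(1)])
      then have "local_mass (?T \<star> N) (2 * c) x + local_mass ((?T \<star> ?T) \<star> N) (2 * c) x / 2 \<le> exp ?l * local_mass \<mu> (2 * c) x"
        by (simp add: exp_minus field_simps)
      moreover have "2 * (exp ?l * local_mass \<mu> (2 * c) x - local_mass (?T \<star> N) (2 * c) x) < 8 * \<delta> * ?\<kappa> * local_mass ?R (2 * c) x"
        using elim by (simp add: field_simps)
      moreover have "b \<le> v" if "a + b / 2 \<le> u" "2 * (u - a) < v" for a b u v :: real
        using that unfolding right_diff_distrib by linarith
      ultimately show ?case by blast
    qed
    have "\<forall>\<^sub>F x in at_top. local_mass ((?T \<star> ?T) \<star> N) (2 * c) (x + w) \<le> 8 * \<delta> * ?\<kappa> * local_mass ?R (2 * c) (x + w)"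
      using smooth filterlim_shift_at_top by (rule eventually_compose_filterlim)
    moreover have "\<forall>\<^sub>F x in at_top. local_mass ?R (2 * c) (x + w) / local_mass ?R c x < 3"
      by (rule order_tendstoD(2)[OF double_window_limit[OF FR c lt]]) simp
    ultimately have "\<forall>\<^sub>F x in at_top. two_big_jumps ?R c A x \<le> \<epsilon> * local_mass ?R c x"
      using pos
    proof eventually_elim
      case (elim x)
      have "p * local_mass (?T \<star> ?T) c x \<le> measure N {w<..w + c} * local_mass (?T \<star> ?T) c x"
        using pN by (intro mult_right_mono) auto
      also have "\<dots> \<le> local_mass ((?T \<star> ?T) \<star> N) (2 * c) (x + w)" by (rule local_mass_le_convolution[OF T2 N(1) c])
      also have "\<dots> \<le> 8 * \<delta> * ?\<kappa> * local_mass ?R (2 * c) (x + w)" by (rule elim(1))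
      also have "\<dots> \<le> 8 * \<delta> * ?\<kappa> * (3 * local_mass ?R c x)"
        using elim(2,3) \<delta>(1) l by (intro mult_left_mono) (auto simp: field_simps)
      also have "\<dots> = (24 * \<delta>) * (?\<kappa> * local_mass ?R c x)" by simp
      also have "\<dots> \<le> (\<epsilon> * ?\<kappa> * p) * (?\<kappa> * local_mass ?R c x)" using \<delta>(4) by (intro mult_right_mono) auto
      finally have "local_mass (?T \<star> ?T) c x \<le> ?\<kappa>\<^sup>2 * (\<epsilon> * local_mass ?R c x)" using p by (simp add: power2_eq_square field_simps)
      moreover have "?\<kappa>\<^sup>2 * two_big_jumps ?R c A x = local_mass (?T \<star> ?T) c x"
        by (rule two_big_jumps_levy_tail[OF lm l A(1)])
      ultimately have "?\<kappa>\<^sup>2 * two_big_jumps ?R c A x \<le> ?\<kappa>\<^sup>2 * (\<epsilon> * local_mass ?R c x)" by simp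
      then show ?case by (rule mult_left_le_imp_le) (use l in simp)
    qed
    then show "\<exists>A. \<forall>\<^sub>F x in at_top. two_big_jumps ?R c A x \<le> \<epsilon> * local_mass ?R c x" by blast
  qed
qed

section \<open>Cluster points of the rescaled Levy measure\<close>

lemma window_multiple_limit:
  assumes R: "finite_borel_measure R" and d: "d > 0" and lt: "long_tailed_fun (local_mass R d)"
  shows "((\<lambda>x. local_mass R (real k * d) x / local_mass R d x) \<longlongrightarrow> real k) at_top"
proof (induction k)
  case 0
  then show ?case by (simp add: local_mass_def)
next
  case (Suc k)
  have eq: "local_mass R (real (Suc k) * d) x = local_mass R (real k * d) x + local_mass R d (x + real k * d)" for x
    using local_mass_cdf[OF R, of "real (Suc k) * d" x] local_mass_cdf[OF R, of "real k * d" x]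
      local_mass_cdf[OF R, of d "x + real k * d"] d by (simp add: algebra_simps)
  from tendsto_add[OF Suc long_tailed_fun_shift[OF lt, of "real k * d"]]
  show ?case unfolding eq by (simp add: add_divide_distrib add.commute)
qed

text \<open>Helly's selection theorem for increments that are only locally bounded: it is applied to the
  composition with \<open>arctan\<close>.\<close>

lemma helly_selection_locally_bounded:
  fixes f :: "nat \<Rightarrow> real \<Rightarrow> real"
  assumes rc: "\<And>n x. continuous (at_right x) (f n)" and mono: "\<And>n. mono (f n)"
    and bdd: "\<And>x. \<exists>K. \<forall>\<^sub>F n in sequentially. \<bar>f n x\<bar> \<le> K"
  shows "\<exists>s F. strict_mono (s :: nat \<Rightarrow> nat) \<and> (\<forall>x. continuous (at_right x) F) \<and> mono F \<and>
    (\<forall>x. isCont F x \<longrightarrow> (\<lambda>n. f (s n) x) \<longlonglongrightarrow> F x)"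
proof -
  define h where "h n x = arctan (f n x)" for n x
  have "\<exists>s. strict_mono (s :: nat \<Rightarrow> nat) \<and> (\<exists>F. (\<forall>x. continuous (at_right x) F) \<and> mono F \<and> (\<forall>x. \<bar>F x\<bar> \<le> 2) \<and>
    (\<forall>x. continuous (at x) F \<longrightarrow> (\<lambda>n. h (s n) x) \<longlonglongrightarrow> F x))"
  proof (rule Helly_selection)
    show "continuous (at_right x) (h n)" for n x
      unfolding h_def continuous_within
      by (rule isCont_tendsto_compose[OF isCont_arctan]) (use rc[of x n] in \<open>simp add: continuous_within\<close>)
    show "mono (h n)" for n
      unfolding h_def by (intro monoI arctan_monotone' monoD[OF mono])
    show "\<bar>h n x\<bar> \<le> 2" for n x
      using arctan_bounded[of "f n x"] pi_less_4 by (auto simp: h_def abs_le_iff)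
  qed
  then obtain s G where s: "strict_mono s" and G: "\<And>x. continuous (at_right x) G" "mono G"
    "\<And>x. isCont G x \<Longrightarrow> (\<lambda>n. h (s n) x) \<longlonglongrightarrow> G x" by blast
  have dense: "\<exists>u. a < u \<and> u < b \<and> isCont G u" if "a < b" for a b
  proof -
    have "countable {x. \<not> isCont G x}" by (rule mono_ctble_discont[OF G(2)])
    moreover have "uncountable {a<..<b}" using that by (simp add: uncountable_open_interval)
    ultimately have "\<not> {a<..<b} \<subseteq> {x. \<not> isCont G x}" using countable_subset by blast
    then show ?thesis by auto
  qed
  have bounded_cont: "- (pi / 2) < G u \<and> G u < pi / 2" if u: "isCont G u" for u
  proof -
    from bdd[of u] obtain K where "\<forall>\<^sub>F n in sequentially. \<bar>f n u\<bar> \<le> K" by blast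
    then have "\<forall>\<^sub>F n in sequentially. \<bar>f (s n) u\<bar> \<le> K"
      using filterlim_subseq[OF s] by (rule eventually_compose_filterlim)
    then have ev: "\<forall>\<^sub>F n in sequentially. arctan (- K) \<le> h (s n) u \<and> h (s n) u \<le> arctan K"
    proof eventually_elim
      case (elim n)
      then have "- K \<le> f (s n) u" "f (s n) u \<le> K" by linarith+
      then show ?case unfolding h_def by (intro conjI arctan_monotone')
    qed
    have "arctan (- K) \<le> G u"
      by (rule tendsto_lowerbound[OF G(3)[OF u]]) (use ev in \<open>auto elim: eventually_mono\<close>)
    moreover have "G u \<le> arctan K"
      by (rule tendsto_upperbound[OF G(3)[OF u]]) (use ev in \<open>auto elim: eventually_mono\<close>)
    ultimately show ?thesis using arctan_lbound[of "- K"] arctan_ubound[of K] by linarith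
  qed
  have bnd: "- (pi / 2) < G x \<and> G x < pi / 2" for x
  proof -
    obtain u where u: "x - 1 < u" "u < x" "isCont G u" using dense[of "x - 1" x] by auto
    obtain v where v: "x < v" "v < x + 1" "isCont G v" using dense[of x "x + 1"] by auto
    have "G u \<le> G x" "G x \<le> G v" using G(2) u v by (auto simp: mono_def)
    then show ?thesis using bounded_cont[OF u(3)] bounded_cont[OF v(3)] by linarith
  qed
  have cosG: "cos (G x) \<noteq> 0" for x using cos_gt_zero_pi[of "G x"] bnd[of x] by auto
  define F where "F x = tan (G x)" for x
  have GF: "G = (\<lambda>x. arctan (F x))" using bnd by (auto simp: F_def fun_eq_iff arctan_tan)
  show ?thesis
  proof (intro exI conjI allI impI)
    show "strict_mono s" by (rule s)
    show "continuous (at_right x) F" for x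
      unfolding F_def continuous_within
      by (rule tendsto_tan) (use G(1)[of x] cosG in \<open>auto simp: continuous_within\<close>)
    show "mono F"
    proof (rule monoI)
      fix x y :: real assume "x \<le> y"
      then have "G x \<le> G y" using G(2) by (auto simp: mono_def)
      then show "F x \<le> F y" unfolding F_def using bnd[of x] bnd[of y] by (intro tan_mono_le) auto
    qed
    fix x assume "isCont F x"
    then have "isCont G x" unfolding GF by (rule isCont_o2) (rule isCont_arctan)
    then have "(\<lambda>n. h (s n) x) \<longlonglongrightarrow> G x" by (rule G(3))
    with isCont_tan[OF cosG] have "(\<lambda>n. tan (h (s n) x)) \<longlonglongrightarrow> tan (G x)"
      by (rule isCont_tendsto_compose)
    then show "(\<lambda>n. f (s n) x) \<longlonglongrightarrow> F x" by (simp add: h_def F_def tan_arctan)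
  qed
qed

lemma right_dense_cocountable:
  assumes "countable (E :: real set)"
  obtains X where "\<And>n. X n > t" "\<And>n. X n \<notin> E" "X \<longlonglongrightarrow> t"
proof -
  have "\<exists>u. t < u \<and> u < t + 1 / real (Suc n) \<and> u \<notin> E" for n
  proof -
    have "uncountable {t<..<t + 1 / real (Suc n)}" by (simp add: uncountable_open_interval)
    then have "\<not> {t<..<t + 1 / real (Suc n)} \<subseteq> E" using assms countable_subset by blast
    then show ?thesis by auto
  qed
  then obtain X where X: "\<And>n. t < X n \<and> X n < t + 1 / real (Suc n) \<and> X n \<notin> E" by metis
  have "X \<longlonglongrightarrow> t"
  proof (rule tendsto_sandwich[of "\<lambda>_. t" _ _ "\<lambda>n. t + 1 / real (Suc n)"])
    show "(\<lambda>n. t + 1 / real (Suc n)) \<longlonglongrightarrow> t"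
      using tendsto_add[OF tendsto_const[of t] LIMSEQ_Suc[OF lim_1_over_n]] by simp
  qed (use X in \<open>auto intro!: always_eventually less_imp_le\<close>)
  then show ?thesis using that X by blast
qed

lemma right_continuous_sequentially:
  fixes F :: "real \<Rightarrow> real"
  assumes "continuous (at_right t) F" "\<And>n. X n > t" "X \<longlonglongrightarrow> t"
  shows "(\<lambda>n. F (X n)) \<longlonglongrightarrow> F t"
proof -
  have "filterlim X (at_right t) sequentially"
    unfolding filterlim_at using assms(2,3) by (auto intro!: always_eventually)
  then show ?thesis using assms(1) unfolding continuous_within by (rule filterlim_compose[rotated])
qed

text \<open>Pointwise statements about cluster points hold outside countable or null sets at first; right
  continuity extends them to all points.\<close>

lemma right_continuous_AE_zero:
  fixes F :: "real \<Rightarrow> real"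
  assumes rc: "\<And>t. continuous (at_right t) F" and ae: "AE x in lborel. F x = 0"
  shows "F t = 0"
proof -
  have "\<exists>u. t < u \<and> u < t + 1 / real (Suc n) \<and> F u = 0" for n
  proof (rule ccontr)
    assume "\<not> ?thesis"
    then have nz: "F x \<noteq> 0" if "x \<in> {t<..<t + 1 / real (Suc n)}" for x using that by auto
    have "AE x in lborel. x \<notin> {t<..<t + 1 / real (Suc n)}" using ae by eventually_elim (use nz in blast)
    then have "{t<..<t + 1 / real (Suc n)} \<in> null_sets lborel" by (subst AE_iff_null_sets) auto
    then have "emeasure lborel {t<..<t + 1 / real (Suc n)} = 0" by (rule null_setsD1)
    moreover have "emeasure lborel {t<..<t + 1 / real (Suc n)} = ennreal (1 / real (Suc n))"
      by (subst emeasure_lborel_Ioo) simp_all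
    moreover have "ennreal (1 / real (Suc n)) \<noteq> 0" unfolding ennreal_eq_0_iff by simp
    ultimately show False by argo
  qed
  then have "\<forall>n. \<exists>u. t < u \<and> u < t + 1 / real (Suc n) \<and> F u = 0" by (rule allI)
  from choice[OF this] obtain X where X: "\<And>n. t < X n \<and> X n < t + 1 / real (Suc n) \<and> F (X n) = 0" by (elim exE) (rule that, erule spec)
  have "X \<longlonglongrightarrow> t"
  proof (rule tendsto_sandwich[of "\<lambda>_. t" _ _ "\<lambda>n. t + 1 / real (Suc n)"])
    show "(\<lambda>n. t + 1 / real (Suc n)) \<longlonglongrightarrow> t"
      using tendsto_add[OF tendsto_const[of t] LIMSEQ_Suc[OF lim_1_over_n]] by simp
  qed (use X in \<open>auto intro!: always_eventually less_imp_le\<close>)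
  then have "(\<lambda>n. F (X n)) \<longlonglongrightarrow> F t"
    by (intro right_continuous_sequentially[OF rc]) (use X in blast)+
  moreover have "(\<lambda>n. F (X n)) = (\<lambda>n. 0)" using X by blast
  ultimately have "(\<lambda>n. 0) \<longlonglongrightarrow> F t" by simp
  then show ?thesis by (rule LIMSEQ_unique[OF _ tendsto_const])
qed

lemma continuous_at_right_shift:
  fixes F :: "real \<Rightarrow> real"
  assumes "continuous (at_right (t + a)) F"
  shows "continuous (at_right t) (\<lambda>t. F (t + a))"
proof -
  have "filterlim (\<lambda>u. u + a) (at_right (t + a)) (at_right t)"
    unfolding filterlim_at
  proof
    show "\<forall>\<^sub>F u in at_right t. u + a \<in> {t + a<..} \<and> u + a \<noteq> t + a"
      using eventually_at_right_less[of t] by eventually_elim auto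
    show "((\<lambda>u. u + a) \<longlongrightarrow> t + a) (at_right t)" by (intro tendsto_intros)
  qed
  then show ?thesis using assms unfolding continuous_within by (rule filterlim_compose[rotated])
qed

text \<open>Only sums of an atom of \<open>N\<close> and a point of \<open>D\<close> are exceptional.\<close>

lemma countable_shift_null:
  assumes N: "real_distribution N" and D: "countable D"
  obtains E where "countable E" "\<And>t. t \<notin> E \<Longrightarrow> AE s in N. t - s \<notin> D"
proof -
  interpret N: real_distribution N by fact
  define E where "E = (\<lambda>(a, d). a + d) ` ({x. measure N {x} \<noteq> 0} \<times> D)"
  have "countable E" unfolding E_def using N.countable_support D by auto
  moreover have "AE s in N. t - s \<notin> D" if t: "t \<notin> E" for t
  proof -
    have "measure N {t - d} = 0" if "d \<in> D" for d
    proof (rule ccontr)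
      assume "measure N {t - d} \<noteq> 0"
      then have "(t - d) + d \<in> E" unfolding E_def using that by (intro image_eqI[of _ _ "(t - d, d)"]) auto
      then show False using t by simp
    qed
    then have "{t - d} \<in> null_sets N" if "d \<in> D" for d
      using that by (simp add: null_sets_def N.emeasure_eq_measure)
    then have "(\<Union>d\<in>D. {t - d}) \<in> null_sets N" by (intro null_sets_UN' D)
    then have "AE s in N. s \<notin> (\<Union>d\<in>D. {t - d})" by (rule AE_not_in)
    then show ?thesis
    proof eventually_elim
      case (elim s)
      show ?case
      proof
        assume "t - s \<in> D"
        then have "s \<in> (\<Union>d\<in>D. {t - d})" by (intro UN_I[of "t - s"]) auto
        then show False using elim by contradiction
      qed
    qed
  qed
  ultimately show ?thesis using that by blast
qed

section \<open>Subexponential infinitely divisible distributions\<close>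

lemma exp_integrable_not_long_tailed:
  assumes mu: "real_distribution \<mu>" and "integrable \<mu> exp"
    and lt: "long_tailed_fun (local_mass \<mu> c)" and ad: "almost_decreasing (local_mass \<mu> c)"
  shows False
proof -
  have "((\<lambda>x. local_mass \<mu> c x / local_mass \<mu> c x) \<longlongrightarrow> 0) at_top"
    by (rule light_tail_negligible[OF lt ad mu assms(2)])
  moreover have "((\<lambda>x. local_mass \<mu> c x / local_mass \<mu> c x) \<longlongrightarrow> 1) at_top"
    using long_tailed_fun_pos[OF lt] by (intro tendsto_eventually) (auto elim: eventually_mono)
  ultimately show False using tendsto_unique[OF trivial_limit_at_top_linorder] by fastforce
qed

lemma levy_tail_charged:
  assumes mu: "real_distribution \<mu>" and hl: "has_levy_measure \<mu> \<nu>" and A: "A \<ge> 1"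
    and lt: "long_tailed_fun (local_mass \<mu> c)" and ad: "almost_decreasing (local_mass \<mu> c)"
  shows "measure \<nu> {A<..} > 0"
proof (rule ccontr)
  assume "\<not> ?thesis"
  then have z: "measure \<nu> {A<..} = 0" using zero_less_measure_iff by blast
  from positive_jumps_decomposition[OF mu hl A] obtain N where N: "real_distribution N" "integrable N exp"
    "\<mu> = (cpoisson \<nu> {A<..} \<star> N)" by blast
  have "\<mu> = N" using N(3) z convolution_return_0[OF N(1)]
      convolution_commutative_fbm[OF fbm_real_distribution[OF real_distribution_dirac] fbm_real_distribution[OF N(1)]]
    by (simp add: cpoisson_def)
  then show False using exp_integrable_not_long_tailed[OF mu _ lt ad] N(2) by simp
qed

text \<open>One jump together with the factor \<open>N\<close> landing in a window that \<open>N\<close> charges already accounts for a fixed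
  fraction of the Levy measure.\<close>

lemma levy_tail_local_mass_bounded:
  assumes mu: "real_distribution \<mu>" and hl: "has_levy_measure \<mu> \<nu>" and c: "c > 0"
    and lt: "long_tailed_fun (local_mass \<mu> c)" and ad: "almost_decreasing (local_mass \<mu> c)"
  shows "\<exists>C>0. \<forall>\<^sub>F x in at_top. local_mass (tail_part \<nu> 1) c x \<le> C * local_mass \<mu> c x"
proof -
  from hl have lm: "levy_measure \<nu>" by (simp add: has_levy_measure_def)
  let ?l = "measure \<nu> {1<..}"
  have l: "?l > 0" by (rule levy_tail_charged[OF mu hl order_refl lt ad])
  note T = fbm_levy_tail_part[OF lm order_refl]
  from positive_jumps_decomposition[OF mu hl order_refl] obtain N where N: "real_distribution N" "integrable N exp"
    "\<mu> = (cpoisson \<nu> {1<..} \<star> N)" by blast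
  obtain w where w: "measure N {w<..w + c} > 0" by (rule charged_window[OF N(1) c])
  let ?p = "measure N {w<..w + c}"
  have "\<forall>\<^sub>F x in at_top. local_mass \<mu> (2 * c) (x + w) / local_mass \<mu> c x < 3"
    by (rule order_tendstoD(2)[OF double_window_limit[OF fbm_real_distribution[OF mu] c lt]]) simp
  with long_tailed_fun_pos[OF lt]
  have "\<forall>\<^sub>F x in at_top. local_mass (tail_part \<nu> 1) c x \<le> (3 * exp ?l / ?p) * local_mass \<mu> c x"
  proof eventually_elim
    case (elim x)
    have "?p * local_mass (tail_part \<nu> 1) c x \<le> local_mass (tail_part \<nu> 1 \<star> N) (2 * c) (x + w)"
      by (rule local_mass_le_convolution[OF T N(1) c])
    also have "\<dots> \<le> exp ?l * local_mass \<mu> (2 * c) (x + w)"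
      using cpoisson_convolution_ge_single[OF lm order_refl l N(1), of "2 * c" "x + w"]
      unfolding N(3)[symmetric] by (simp add: exp_minus field_simps)
    also have "\<dots> \<le> exp ?l * (3 * local_mass \<mu> c x)" using elim by (intro mult_left_mono) (auto simp: field_simps)
    finally show ?case using w by (simp add: field_simps)
  qed
  then show ?thesis using w by (intro exI[of _ "3 * exp ?l / ?p"]) auto
qed

text \<open>\<open>F\<close> is a cluster point of the distribution functions of the Levy tail seen from \<open>X n\<close>, in units of
  the local mass of \<open>\<mu>\<close>. Averaging its increments with respect to \<open>\<mu>\<close> gives the increments that \<open>\<mu>\<close> itself has in these units.
  With \<open>\<mu>\<close> replaced by its factor \<open>N\<close> without jumps above a high threshold, this holds up to \<open>\<epsilon>\<close> by the one big
  jump principle, and the exponential moment of \<open>N\<close> permits the passage to the limit under the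
  integral.\<close>

lemma cluster_point_equation:
  fixes F :: "real \<Rightarrow> real"
  assumes mu: "real_distribution \<mu>" and hl: "has_levy_measure \<mu> \<nu>" and d: "d > 0"
    and SD: "\<mu> \<in> S_loc \<inter> D_loc" and k: "k \<ge> 1"
    and X: "filterlim X at_top sequentially"
    and F: "\<And>t. continuous (at_right t) F" "mono F"
    and conv: "\<And>t. isCont F t \<Longrightarrow> (\<lambda>n. (cdf (tail_part \<nu> 1) (X n + t) - cdf (tail_part \<nu> 1) (X n)) / local_mass \<mu> d (X n)) \<longlonglongrightarrow> F t"
    and B: "\<And>t. F (t + d / real k) - F t \<le> B"
  shows "(\<integral>s. F (t - s + d / real k) - F (t - s) \<partial>\<mu>) = 1 / real k"
proof -
  from hl have lm: "levy_measure \<nu>" by (simp add: has_levy_measure_def)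
  interpret mu: real_distribution \<mu> by fact
  note Fmu = fbm_real_distribution[OF mu]
  define c where "c = d / real k"
  have c: "c > 0" "real k * c = d" using d k by (auto simp: c_def)
  have cls: "long_tailed_fun (local_mass \<mu> e)" "almost_decreasing (local_mass \<mu> e)"
      "negligible_two_big_jumps \<mu> e" if "e > 0" for e
  proof -
    show lt: "long_tailed_fun (local_mass \<mu> e)" and ad: "almost_decreasing (local_mass \<mu> e)"
      using SD that by (auto simp: S_loc_def D_loc_def S_Delta_def L_Delta_def D_Delta_def)
    show "negligible_two_big_jumps \<mu> e"
      using SD that local_subexponential_iff[OF mu that lt ad] by (auto simp: S_loc_def S_Delta_def)
  qed
  note pos = long_tailed_fun_pos[OF cls(1)[OF d]]
  define H where "H t = F (t + c) - F t" for t
  have H0: "H t \<ge> 0" for t using F(2) c(1) by (simp add: H_def mono_def)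
  have HB: "H t \<le> B" for t using B by (simp add: H_def c_def)
  have B0: "B \<ge> 0" using H0[of 0] HB[of 0] by linarith
  have [measurable]: "F \<in> borel_measurable borel" by (rule borel_measurable_mono[OF F(2)])
  have [measurable]: "H \<in> borel_measurable borel" unfolding H_def by measurable
  have Hrc: "continuous (at_right t) H" for t
    unfolding H_def by (intro continuous_diff F continuous_at_right_shift)
  define D where "D = {t. \<not> isCont F t} \<union> (\<lambda>t. t - c) ` {t. \<not> isCont F t}"
  have D: "countable D" unfolding D_def using mono_ctble_discont[OF F(2)] by simp
  have approx: "\<bar>(\<integral>s. H (t - s) \<partial>\<mu>) - 1 / real k\<bar> \<le> \<epsilon> * (3 * B + 1)" if e: "0 < \<epsilon>" "\<epsilon> < 1" for \<epsilon>
  proof -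
    from levy_tail_local_mass_bounded[OF mu hl c(1) cls(1,2)[OF c(1)]] obtain C where
      C: "\<forall>\<^sub>F x in at_top. local_mass (tail_part \<nu> 1) c x \<le> C * local_mass \<mu> c x" by blast
    from one_big_jump_principle[OF lm mu c(1) cls[OF c(1)] C e(1)] obtain A1 where A1:
      "\<And>A N. A \<ge> A1 \<Longrightarrow> measure \<nu> {A<..} > 0 \<Longrightarrow> real_distribution N \<Longrightarrow> integrable N exp \<Longrightarrow>
        \<forall>\<^sub>F x in at_top. local_mass (cpoisson \<nu> {A<..} \<star> N) c x \<le>
          exp (- measure \<nu> {A<..}) * local_mass (tail_part \<nu> A \<star> N) c x + \<epsilon> * local_mass \<mu> c x" by blast
    from tail_rate_small[OF lm e(1)] obtain A2 where A2: "A2 \<ge> 1" "\<And>A. A \<ge> A2 \<Longrightarrow> measure \<nu> {A<..} < \<epsilon>" by blast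
    define A where "A = max A1 A2"
    have A: "A \<ge> A1" "A \<ge> A2" "A \<ge> 1" using A2(1) by (auto simp: A_def)
    let ?l = "measure \<nu> {A<..}" and ?T = "tail_part \<nu> A"
    have l: "?l > 0" by (rule levy_tail_charged[OF mu hl A(3) cls(1,2)[OF d]])
    have el: "1 - \<epsilon> \<le> exp (- ?l)" using exp_ge_add_one_self[of "- ?l"] A2(2)[OF A(2)] by linarith
    have el1: "exp (- ?l) \<le> 1" using l by simp
    from positive_jumps_decomposition[OF mu hl A(3)] obtain N where N: "real_distribution N" "integrable N exp"
      "\<mu> = (cpoisson \<nu> {A<..} \<star> N)" by blast
    interpret N: real_distribution N by (rule N)
    note T1 = fbm_levy_tail_part[OF lm order_refl] and T = fbm_levy_tail_part[OF lm A(3)] and FN = fbm_real_distribution[OF N(1)]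
    have [measurable]: "local_mass ?T c \<in> borel_measurable borel" using T by measurable
    have ub: "\<forall>\<^sub>F x in at_top. local_mass \<mu> c x \<le> exp (- ?l) * local_mass (?T \<star> N) c x + \<epsilon> * local_mass \<mu> c x"
      unfolding N(3) using A1[OF A(1) l N(1,2)] unfolding N(3) .
    have lb: "exp (- ?l) * local_mass (?T \<star> N) c x \<le> local_mass \<mu> c x" for x
      unfolding N(3) by (rule cpoisson_convolution_ge_single[OF lm A(3) l N(1)])
    define L where "L t = (\<integral>s. H (t - s) \<partial>N)" for t
    have L: "0 \<le> L t" "L t \<le> B" for t
    proof -
      have i: "integrable N (\<lambda>s. H (t - s))" using H0 HB by (intro N.integrable_const_bound[where B = B]) auto
      show "0 \<le> L t" unfolding L_def using H0 by (intro integral_nonneg_AE) auto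
      have "L t \<le> (\<integral>s. B \<partial>N)" unfolding L_def using HB i by (intro integral_mono) auto
      then show "L t \<le> B" using N.prob_space by simp
    qed
    obtain E where E: "countable E" "\<And>t. t \<notin> E \<Longrightarrow> AE s in N. t - s \<notin> D" using countable_shift_null[OF N(1) D] by blast
    have shiftX: "filterlim (\<lambda>n. X n + t) at_top sequentially" for t
      by (rule filterlim_compose[OF filterlim_shift_at_top X])
    have posX: "\<forall>\<^sub>F n in sequentially. 0 < local_mass \<mu> d (X n)"
      using pos X by (rule eventually_compose_filterlim)
    \<comment> \<open>The smoothed masses converge to \<open>L t\<close> for all but countably many \<open>t\<close>.\<close>
    have limT: "(\<lambda>n. local_mass (?T \<star> N) c (X n + t) / local_mass \<mu> d (X n)) \<longlonglongrightarrow> L t" if t: "t \<notin> E" for t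
    proof -
      have "\<forall>\<^sub>F x in at_top. local_mass ?T c x \<le> C * local_mass \<mu> c x"
        using C by eventually_elim (rule order_trans[OF local_mass_levy_tail_part_mono[OF lm order_refl A(3)]])
      from shift_domination[OF cls(1,2)[OF c(1)] local_mass_nonneg local_mass_le[OF T] this] obtain C' x2 where C':
        "\<And>x s. x \<ge> x2 \<Longrightarrow> local_mass ?T c (x - s) \<le> C' * (1 + exp s) * local_mass \<mu> c x" "C' \<ge> 0" by metis
      have le_cd: "local_mass \<mu> c x \<le> local_mass \<mu> d x" for x
      proof -
        have "c \<le> d" using c k d by (simp add: c_def field_simps)
        then show ?thesis unfolding local_mass_def by (intro mu.finite_measure_mono) auto
      qed
      have "\<forall>\<^sub>F x in at_top. local_mass \<mu> d (x + t) / local_mass \<mu> d x < 2"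
        by (rule order_tendstoD(2)[OF long_tailed_fun_shift[OF cls(1)[OF d]]]) simp
      then have sh: "\<forall>\<^sub>F n in sequentially. local_mass \<mu> d (X n + t) / local_mass \<mu> d (X n) < 2"
        using X by (rule eventually_compose_filterlim)
      have x2n: "\<forall>\<^sub>F n in sequentially. X n + t \<ge> x2"
        using eventually_ge_at_top[of x2] shiftX[of t] by (rule eventually_compose_filterlim)
      have dom: "\<forall>\<^sub>F n in sequentially. \<forall>s. local_mass ?T c (X n + t - s) / local_mass \<mu> d (X n) \<le> C' * (1 + exp s) * 2"
        using sh x2n posX
      proof eventually_elim
        case (elim n)
        show ?case
        proof
          fix s
          have "local_mass ?T c (X n + t - s) \<le> C' * (1 + exp s) * local_mass \<mu> c (X n + t)" by (rule C'(1)[OF elim(2)])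
          also have "\<dots> \<le> C' * (1 + exp s) * (2 * local_mass \<mu> d (X n))"
            using le_cd[of "X n + t"] elim(1,3) C'(2) by (intro mult_left_mono) (auto simp: field_simps)
          finally show "local_mass ?T c (X n + t - s) / local_mass \<mu> d (X n) \<le> C' * (1 + exp s) * 2"
            using elim(3) by (simp only: pos_divide_le_eq mult.assoc)
        qed
      qed
      have ptw: "AE s in N. (\<lambda>n. local_mass ?T c (X n + t - s) / local_mass \<mu> d (X n)) \<longlonglongrightarrow> H (t - s)"
        using E(2)[OF t]
      proof eventually_elim
        case (elim s)
        have ic: "isCont F (t - s)" "isCont F (t - s + c)"
          using elim by (auto simp: D_def image_iff)
        from tendsto_diff[OF conv[OF ic(2)] conv[OF ic(1)]]
        have lim: "(\<lambda>n. (cdf (tail_part \<nu> 1) (X n + (t - s + c)) - cdf (tail_part \<nu> 1) (X n + (t - s))) / local_mass \<mu> d (X n)) \<longlonglongrightarrow> H (t - s)"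
          by (simp add: H_def diff_divide_distrib[symmetric])
        have "\<forall>\<^sub>F n in sequentially. X n + (t - s) \<ge> A"
          using eventually_ge_at_top[of A] shiftX[of "t - s"] by (rule eventually_compose_filterlim)
        then have "\<forall>\<^sub>F n in sequentially. (cdf (tail_part \<nu> 1) (X n + (t - s + c)) - cdf (tail_part \<nu> 1) (X n + (t - s))) / local_mass \<mu> d (X n) =
           local_mass ?T c (X n + t - s) / local_mass \<mu> d (X n)"
        proof eventually_elim
          case (elim n)
          have "local_mass ?T c (X n + t - s) = local_mass (tail_part \<nu> 1) c (X n + t - s)"
            using elim A(3) local_mass_tail_part_eq[OF levy_measure_sets[OF lm], of A "X n + t - s" c]
              local_mass_tail_part_eq[OF levy_measure_sets[OF lm], of 1 "X n + t - s" c] by simp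
          also have "\<dots> = cdf (tail_part \<nu> 1) (X n + (t - s + c)) - cdf (tail_part \<nu> 1) (X n + (t - s))"
            using local_mass_cdf[OF T1, of c "X n + t - s"] c(1) by (simp add: algebra_simps)
          finally show ?case by simp
        qed
        with lim show ?case by (rule Lim_transform_eventually)
      qed
      from dom obtain n0 where n0: "\<And>n s. n \<ge> n0 \<Longrightarrow> local_mass ?T c (X n + t - s) / local_mass \<mu> d (X n) \<le> C' * (1 + exp s) * 2"
        unfolding eventually_sequentially by blast
      have "(\<lambda>n. \<integral>s. local_mass ?T c (X (n + n0) + t - s) / local_mass \<mu> d (X (n + n0)) \<partial>N) \<longlonglongrightarrow> (\<integral>s. H (t - s) \<partial>N)"
      proof (rule integral_dominated_convergence[where w = "\<lambda>s. C' * (1 + exp s) * 2"])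
        show "integrable N (\<lambda>s. C' * (1 + exp s) * 2)" using N(2) by auto
        show "AE s in N. (\<lambda>n. local_mass ?T c (X (n + n0) + t - s) / local_mass \<mu> d (X (n + n0))) \<longlonglongrightarrow> H (t - s)"
          using ptw by eventually_elim (rule LIMSEQ_ignore_initial_segment)
        show "AE s in N. norm (local_mass ?T c (X (n + n0) + t - s) / local_mass \<mu> d (X (n + n0))) \<le> C' * (1 + exp s) * 2" for n
          using n0[of "n + n0"] by simp
      qed auto
      then have "(\<lambda>n. local_mass (?T \<star> N) c (X (n + n0) + t) / local_mass \<mu> d (X (n + n0))) \<longlonglongrightarrow> L t"
        unfolding local_mass_convolution[OF T FN] L_def by simp
      then show ?thesis by (rule LIMSEQ_offset)
    qed
    have limmu: "(\<lambda>n. local_mass \<mu> c (X n + t) / local_mass \<mu> d (X n)) \<longlonglongrightarrow> 1 / real k" for t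
    proof -
      have "((\<lambda>x. (local_mass \<mu> c (x + t) / local_mass \<mu> c x) / (local_mass \<mu> (real k * c) x / local_mass \<mu> c x)) \<longlongrightarrow> 1 / real k) at_top"
        using k by (intro tendsto_divide long_tailed_fun_shift window_multiple_limit cls Fmu c) auto
      moreover have "\<forall>\<^sub>F x in at_top. (local_mass \<mu> c (x + t) / local_mass \<mu> c x) / (local_mass \<mu> (real k * c) x / local_mass \<mu> c x) =
          local_mass \<mu> c (x + t) / local_mass \<mu> d x"
        using long_tailed_fun_pos[OF cls(1)[OF c(1)]] by eventually_elim (simp add: c(2))
      ultimately have "((\<lambda>x. local_mass \<mu> c (x + t) / local_mass \<mu> d x) \<longlongrightarrow> 1 / real k) at_top"
        by (rule Lim_transform_eventually)
      then show ?thesis using X by (rule filterlim_compose)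
    qed
    have good: "exp (- ?l) * L t \<le> 1 / real k \<and> 1 / real k \<le> exp (- ?l) * L t + \<epsilon> * (1 / real k)" if t: "t \<notin> E" for t
    proof
      show "exp (- ?l) * L t \<le> 1 / real k"
      proof (rule tendsto_le[OF sequentially_bot limmu[of t] tendsto_mult_left[OF limT[OF t]]])
        show "\<forall>\<^sub>F n in sequentially. exp (- ?l) * (local_mass (?T \<star> N) c (X n + t) / local_mass \<mu> d (X n)) \<le> local_mass \<mu> c (X n + t) / local_mass \<mu> d (X n)"
          using posX by eventually_elim (use lb in \<open>simp add: divide_right_mono\<close>)
      qed
      show "1 / real k \<le> exp (- ?l) * L t + \<epsilon> * (1 / real k)"
      proof (rule tendsto_le[OF sequentially_bot tendsto_add[OF tendsto_mult_left[OF limT[OF t]] tendsto_mult_left[OF limmu[of t]]] limmu[of t]])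
        have "\<forall>\<^sub>F n in sequentially. local_mass \<mu> c (X n + t) \<le> exp (- ?l) * local_mass (?T \<star> N) c (X n + t) + \<epsilon> * local_mass \<mu> c (X n + t)"
          using ub shiftX[of t] by (rule eventually_compose_filterlim)
        with posX show "\<forall>\<^sub>F n in sequentially. local_mass \<mu> c (X n + t) / local_mass \<mu> d (X n) \<le>
           exp (- ?l) * (local_mass (?T \<star> N) c (X n + t) / local_mass \<mu> d (X n)) + \<epsilon> * (local_mass \<mu> c (X n + t) / local_mass \<mu> d (X n))"
          by eventually_elim (simp add: field_simps)
      qed
    qed
    have all: "exp (- ?l) * L t \<le> 1 / real k \<and> 1 / real k \<le> exp (- ?l) * L t + \<epsilon> * (1 / real k)" for t
    proof -
      obtain Y where Y: "\<And>n. Y n > t" "\<And>n. Y n \<notin> E" "Y \<longlonglongrightarrow> t" using right_dense_cocountable[OF E(1)] by blast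
      have "(\<lambda>n. L (Y n)) \<longlonglongrightarrow> L t" unfolding L_def
      proof (rule integral_dominated_convergence[where w = "\<lambda>_. B"])
        show "AE s in N. (\<lambda>n. H (Y n - s)) \<longlonglongrightarrow> H (t - s)"
        proof (rule AE_I2, rule right_continuous_sequentially[OF Hrc])
          show "t - s < Y n - s" for n s using Y(1)[of n] by simp
          show "(\<lambda>n. Y n - s) \<longlonglongrightarrow> t - s" for s by (rule tendsto_diff[OF Y(3) tendsto_const])
        qed
        show "AE s in N. norm (H (Y n - s)) \<le> B" for n using H0 HB by simp
      qed auto
      then have l': "(\<lambda>n. exp (- ?l) * L (Y n)) \<longlonglongrightarrow> exp (- ?l) * L t" by (rule tendsto_mult_left)
      have "exp (- ?l) * L t \<le> 1 / real k" by (rule LIMSEQ_le_const2[OF l']) (use good[OF Y(2)] in auto)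
      moreover have "1 / real k \<le> exp (- ?l) * L t + \<epsilon> * (1 / real k)"
        by (rule LIMSEQ_le_const[OF tendsto_add[OF l' tendsto_const]]) (use good[OF Y(2)] in auto)
      ultimately show ?thesis by simp
    qed
    have "\<bar>(\<integral>s. H (t - s) \<partial>\<mu>) - L t\<bar> \<le> 2 * B * (1 - exp (- ?l))"
      unfolding L_def N(3)
      by (rule cpoisson_perturbation[OF levy_measure_sets[OF lm] _ levy_measure_tail_finite[OF lm A(3)] N(1)])
         (use H0 HB in auto)
    also have "\<dots> \<le> 2 * B * \<epsilon>" using el B0 by (intro mult_left_mono) auto
    finally have 1: "\<bar>(\<integral>s. H (t - s) \<partial>\<mu>) - L t\<bar> \<le> 2 * B * \<epsilon>" .
    have "(1 - exp (- ?l)) * L t \<le> \<epsilon> * B" using el el1 L[of t] e by (intro mult_mono) auto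
    then have 2: "L t - \<epsilon> * B \<le> exp (- ?l) * L t" by (simp add: algebra_simps)
    have 3: "exp (- ?l) * L t \<le> L t" using el el1 L[of t] by (simp add: mult_left_le_one_le)
    have 4: "\<epsilon> * (1 / real k) \<le> \<epsilon>" using k e by (simp add: field_simps)
    have "\<bar>L t - 1 / real k\<bar> \<le> \<epsilon> * B + \<epsilon>"
      using all[of t] 2 3 4 e B0 mult_nonneg_nonneg[of \<epsilon> B] unfolding abs_le_iff by linarith
    moreover have "\<epsilon> * (3 * B + 1) = 2 * B * \<epsilon> + (\<epsilon> * B + \<epsilon>)" by (simp add: algebra_simps)
    ultimately show ?thesis using 1 by linarith
  qed
  have "\<bar>(\<integral>s. H (t - s) \<partial>\<mu>) - 1 / real k\<bar> \<le> 0"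
  proof (rule field_le_epsilon)
    fix e :: real assume e: "e > 0"
    define \<epsilon> where "\<epsilon> = min (1/2) (e / (3 * B + 1))"
    have "3 * B + 1 > 0" using B0 by simp
    then have "0 < \<epsilon>" "\<epsilon> < 1" "\<epsilon> \<le> e / (3 * B + 1)" using e by (auto simp: \<epsilon>_def)
    then show "\<bar>(\<integral>s. H (t - s) \<partial>\<mu>) - 1 / real k\<bar> \<le> 0 + e"
      using approx[of \<epsilon>] \<open>3 * B + 1 > 0\<close> by (simp add: field_simps)
  qed
  then show ?thesis by (simp add: H_def c_def)
qed

lemma isCont_of_equal_increments:
  fixes F :: "real \<Rightarrow> real"
  assumes F: "mono F" and d: "d > 0" and inc: "\<And>k t. k \<ge> 1 \<Longrightarrow> F (t + d / real k) - F t = 1 / real k"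
  shows "isCont F t"
  unfolding continuous_at_eps_delta
proof (intro allI impI)
  fix e :: real assume e: "e > 0"
  obtain k where k: "1 / real (Suc k) < e" using e nat_approx_posE by blast
  show "\<exists>\<delta>>0. \<forall>u. dist u t < \<delta> \<longrightarrow> dist (F u) (F t) < e"
  proof (intro exI[of _ "d / real (Suc k)"] conjI allI impI)
    show "d / real (Suc k) > 0" using d by simp
    fix u assume u: "dist u t < d / real (Suc k)"
    have "F u \<le> F (t + d / real (Suc k))" using u by (intro monoD[OF F]) (auto simp: dist_real_def)
    moreover have "F (t - d / real (Suc k)) \<le> F u" using u by (intro monoD[OF F]) (auto simp: dist_real_def)
    moreover have "F (t + d / real (Suc k)) - F t = 1 / real (Suc k)" by (rule inc) simp
    moreover have "F (t - d / real (Suc k) + d / real (Suc k)) - F (t - d / real (Suc k)) = 1 / real (Suc k)"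
      by (rule inc) simp
    ultimately show "dist (F u) (F t) < e" using k unfolding dist_real_def abs_less_iff by (simp del: of_nat_Suc)
  qed
qed

text \<open>Along any sequence violating the claim, Helly's theorem provides a cluster point of the rescaled Levy
  measures. Its increments over windows of length \<open>d / k\<close>, reduced by \<open>1 / k\<close>, form a bounded function that
  is annihilated by convolution with \<open>\<mu>\<close>, hence vanish. The cluster point is therefore continuous, the
  convergence holds at the ends of the window, and the claim was not violated.\<close>

lemma subexponential_imp_levy_tail_equivalence:
  assumes mu: "real_distribution \<mu>" and hl: "has_levy_measure \<mu> \<nu>" and d: "d > 0"
    and SD: "\<mu> \<in> S_loc \<inter> D_loc"
  shows "((\<lambda>x. local_mass (tail_part \<nu> 1) d x / local_mass \<mu> d x) \<longlongrightarrow> 1) at_top"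
proof (rule ccontr)
  assume neg: "\<not> ?thesis"
  from hl have lm: "levy_measure \<nu>" by (simp add: has_levy_measure_def)
  let ?T = "tail_part \<nu> 1" and ?r = "\<lambda>x. local_mass (tail_part \<nu> 1) d x / local_mass \<mu> d x"
  note T = fbm_levy_tail_part[OF lm order_refl]
  interpret T: finite_borel_measure ?T by (rule T)
  have lt: "long_tailed_fun (local_mass \<mu> d)" and ad: "almost_decreasing (local_mass \<mu> d)"
    using SD d by (auto simp: S_loc_def D_loc_def S_Delta_def L_Delta_def D_Delta_def)
  note pos = long_tailed_fun_pos[OF lt]
  obtain e where e: "e > 0" "\<not> (\<forall>\<^sub>F x in at_top. dist (?r x) 1 < e)" using neg unfolding tendsto_iff by blast
  have "\<forall>n::nat. \<exists>x. x \<ge> real n \<and> \<not> dist (?r x) 1 < e"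
    using e(2) unfolding eventually_at_top_linorder by blast
  from choice[OF this] obtain X where X: "\<And>n. X n \<ge> real n" "\<And>n. \<not> dist (?r (X n)) 1 < e" by blast
  have Xlim: "filterlim X at_top sequentially"
    by (rule filterlim_at_top_mono[OF filterlim_real_sequentially]) (use X(1) in simp)
  define f where "f n t = (cdf ?T (X n + t) - cdf ?T (X n)) / local_mass \<mu> d (X n)" for n t
  have inc: "f n (t + c) - f n t = local_mass ?T c (X n + t) / local_mass \<mu> d (X n)" if "c > 0" for n t c
    using local_mass_cdf[OF T, of c "X n + t"] that by (simp add: f_def add.assoc diff_divide_distrib)
  have fmono: "mono (f n)" for n
    unfolding f_def by (intro monoI divide_right_mono diff_right_mono T.cdf_nondecreasing) auto
  have frc: "continuous (at_right t) (f n)" for n t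
  proof -
    have "continuous (at_right t) (\<lambda>t. cdf ?T (t + X n))"
      by (rule continuous_at_right_shift) (rule T.cdf_is_right_cont)
    then have "continuous (at_right t) (\<lambda>t. (cdf ?T (t + X n) - cdf ?T (X n)) * inverse (local_mass \<mu> d (X n)))"
      by (intro continuous_intros)
    then show ?thesis by (simp add: f_def[abs_def] divide_inverse add.commute)
  qed
  from levy_tail_local_mass_bounded[OF mu hl d lt ad] obtain C where C: "C > 0"
    "\<forall>\<^sub>F x in at_top. local_mass ?T d x \<le> C * local_mass \<mu> d x" by blast
  define B where "B = 2 * C"
  have step: "\<forall>\<^sub>F n in sequentially. f n (t + d) - f n t \<le> B" for t
  proof -
    have sh: "filterlim (\<lambda>n. X n + t) at_top sequentially" by (rule filterlim_compose[OF filterlim_shift_at_top Xlim])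
    have "\<forall>\<^sub>F x in at_top. local_mass \<mu> d (x + t) / local_mass \<mu> d x < 2"
      by (rule order_tendstoD(2)[OF long_tailed_fun_shift[OF lt]]) simp
    then have "\<forall>\<^sub>F n in sequentially. local_mass \<mu> d (X n + t) / local_mass \<mu> d (X n) < 2"
      using Xlim by (rule eventually_compose_filterlim)
    moreover have "\<forall>\<^sub>F n in sequentially. local_mass ?T d (X n + t) \<le> C * local_mass \<mu> d (X n + t)"
      using C(2) sh by (rule eventually_compose_filterlim)
    moreover have "\<forall>\<^sub>F n in sequentially. 0 < local_mass \<mu> d (X n)"
      using pos Xlim by (rule eventually_compose_filterlim)
    ultimately show ?thesis
    proof eventually_elim
      case (elim n)
      have "local_mass ?T d (X n + t) \<le> C * (2 * local_mass \<mu> d (X n))"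
        using elim C(1) by (intro order_trans[OF elim(2)] mult_left_mono) (auto simp: field_simps)
      then show ?case using elim(3) unfolding inc[OF d] by (simp add: B_def pos_divide_le_eq mult_ac)
    qed
  qed
  have up: "\<forall>\<^sub>F n in sequentially. f n (real k * d) \<le> real k * B \<and> - (real k * B) \<le> f n (- (real k * d))" for k
  proof (induction k)
    case 0 then show ?case by (simp add: f_def)
  next
    case (Suc k)
    from Suc step[of "real k * d"] step[of "- (real (Suc k) * d)"] show ?case
      by eventually_elim (simp add: algebra_simps)
  qed
  have bdd: "\<exists>K. \<forall>\<^sub>F n in sequentially. \<bar>f n t\<bar> \<le> K" for t
  proof -
    obtain k where "\<bar>t\<bar> / d \<le> real k" using real_arch_simple by blast
    then have k: "\<bar>t\<bar> \<le> real k * d" using d by (simp add: pos_divide_le_eq)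
    from up[of k] have "\<forall>\<^sub>F n in sequentially. \<bar>f n t\<bar> \<le> real k * B"
    proof eventually_elim
      case (elim n)
      have "f n t \<le> f n (real k * d)" "f n (- (real k * d)) \<le> f n t"
        using k by (auto intro!: monoD[OF fmono])
      then show ?case using elim by (simp add: abs_le_iff)
    qed
    then show ?thesis by blast
  qed
  from helly_selection_locally_bounded[OF frc fmono bdd] obtain s F where s: "strict_mono s"
    and F: "\<And>t. continuous (at_right t) F" "mono F" "\<And>t. isCont F t \<Longrightarrow> (\<lambda>n. f (s n) t) \<longlonglongrightarrow> F t" by blast
  have sX: "filterlim (\<lambda>n. X (s n)) at_top sequentially"
    by (rule filterlim_compose[OF Xlim filterlim_subseq[OF s]])
  have bound: "F (t + d) - F t \<le> B" for t
  proof -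
    let ?E = "{t. \<not> isCont F t} \<union> (\<lambda>t. t - d) ` {t. \<not> isCont F t}"
    have "countable ?E" using mono_ctble_discont[OF F(2)] by simp
    then obtain Y where Y: "\<And>n. Y n > t" "\<And>n. Y n \<notin> ?E" "Y \<longlonglongrightarrow> t" using right_dense_cocountable by blast
    have "F (Y j + d) - F (Y j) \<le> B" for j
    proof -
      have ic: "isCont F (Y j)" "isCont F (Y j + d)"
        using Y(2)[of j] by (auto simp: image_iff)
      have "(\<lambda>n. f (s n) (Y j + d) - f (s n) (Y j)) \<longlonglongrightarrow> F (Y j + d) - F (Y j)"
        by (intro tendsto_diff F(3) ic)
      moreover have "\<forall>\<^sub>F n in sequentially. f (s n) (Y j + d) - f (s n) (Y j) \<le> B"
        using step[of "Y j"] filterlim_subseq[OF s] by (rule eventually_compose_filterlim)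
      ultimately show ?thesis by (rule tendsto_upperbound) simp
    qed
    moreover have "(\<lambda>j. F (Y j + d) - F (Y j)) \<longlonglongrightarrow> F (t + d) - F t"
      by (rule right_continuous_sequentially[OF _ Y(1,3)])
         (intro continuous_diff F continuous_at_right_shift)
    ultimately show ?thesis by (intro LIMSEQ_le_const2) auto
  qed
  have incF: "F (t + d / real k) - F t = 1 / real k" if k: "k \<ge> 1" for k t
  proof -
    let ?c = "d / real k"
    have cd: "?c \<le> d" using k d by (simp add: field_simps)
    have cB: "F (t + ?c) - F t \<le> B" for t
      using bound[of t] monoD[OF F(2), of "t + ?c" "t + d"] cd by simp
    have c0: "0 \<le> F (t + ?c) - F t" for t using monoD[OF F(2), of t "t + ?c"] d by simp
    define g where "g t = F (t + ?c) - F t - 1 / real k" for t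
    have [measurable]: "F \<in> borel_measurable borel" by (rule borel_measurable_mono[OF F(2)])
    have [measurable]: "g \<in> borel_measurable borel" unfolding g_def by measurable
    have gb: "\<bar>g t\<bar> \<le> B + 1" for t
    proof -
      have "1 / real k \<le> 1" "0 \<le> 1 / real k" using k by auto
      then show ?thesis using cB[of t] c0[of t] C(1) unfolding g_def B_def abs_le_iff by linarith
    qed
    interpret mu: real_distribution \<mu> by (rule mu)
    have "(\<integral>w. g (x - w) \<partial>\<mu>) = 0" for x
    proof -
      have "(\<integral>w. F (x - w + ?c) - F (x - w) \<partial>\<mu>) = 1 / real k"
        by (rule cluster_point_equation[OF mu hl d SD k sX F(1,2) _ cB]) (use F(3) in \<open>simp add: f_def\<close>)
      moreover have "integrable \<mu> (\<lambda>w. F (x - w + ?c) - F (x - w))"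
        using cB c0 by (intro mu.integrable_const_bound[where B = B]) auto
      ultimately show ?thesis using mu.prob_space by (simp add: g_def)
    qed
    then have "AE x in lborel. g x = 0"
      by (intro deconvolution_infinitely_divisible[OF mu hl _ gb]) auto
    then have "g t = 0"
      by (rule right_continuous_AE_zero[rotated])
         (unfold g_def, intro continuous_diff continuous_const F continuous_at_right_shift)
    then show ?thesis by (simp add: g_def)
  qed
  have ic: "isCont F t" for t by (rule isCont_of_equal_increments[OF F(2) d incF])
  have "(\<lambda>n. f (s n) d - f (s n) 0) \<longlonglongrightarrow> F d - F 0" by (intro tendsto_diff F(3) ic)
  moreover have "f (s n) d - f (s n) 0 = ?r (X (s n))" for n using inc[OF d, of "s n" 0] by simp
  moreover have "F d - F 0 = 1" using incF[of 1 0] by simp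
  ultimately have "(\<lambda>n. ?r (X (s n))) \<longlonglongrightarrow> 1" by simp
  from tendstoD[OF this e(1)] obtain n where "dist (?r (X (s n))) 1 < e"
    using eventually_happens'[OF sequentially_bot] by blast
  then show False using X(2) by blast
qed

section \<open>The equivalence\<close>

theorem theorem4p10:
  fixes \<mu> \<nu> :: "real measure"
  assumes "infinitely_divisible \<mu>"
    and "has_levy_measure \<mu> \<nu>"
  shows "(\<mu> \<in> S_loc \<inter> D_loc \<longleftrightarrow>
            0 < emeasure \<nu> {1<..} \<and> levy_tail \<nu> \<in> S_loc \<inter> D_loc) \<and>
         (0 < emeasure \<nu> {1<..} \<and> levy_tail \<nu> \<in> S_loc \<inter> D_loc \<longleftrightarrow>
            0 < emeasure \<nu> {1<..} \<and> levy_tail \<nu> \<in> L_loc \<inter> D_loc \<and>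
            (\<forall>c>0. local_mass \<mu> c \<sim>[at_top] local_mass \<nu> c))"
proof -
  have mu: "real_distribution \<mu>" using assms(1) by (simp add: infinitely_divisible_def)
  note hl = assms(2)
  from hl have lm: "levy_measure \<nu>" by (simp add: has_levy_measure_def)
  let ?R = "levy_tail \<nu>" and ?\<kappa> = "measure \<nu> {1<..}"
  have pos_iff: "0 < emeasure \<nu> {1<..} \<longleftrightarrow> 0 < ?\<kappa>"
    using levy_measure_tail_finite[OF lm order_refl] by (simp add: emeasure_eq_ennreal_measure)
  have in_iff: "M \<in> S_loc \<inter> D_loc \<longleftrightarrow> (\<forall>c>0. M \<in> S_Delta c \<inter> D_Delta c)" for M
    by (auto simp: S_loc_def D_loc_def)
  have nu_pos: "\<forall>\<^sub>F x in at_top. 0 < local_mass \<nu> c x"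
    if \<kappa>: "0 < ?\<kappa>" and lt: "long_tailed_fun (local_mass ?R c)" for c
    using long_tailed_fun_pos[OF lt] eventually_ge_at_top[of 1]
    by eventually_elim (simp add: levy_tail_mass(3)[OF lm \<kappa>] \<kappa>)
  \<comment> \<open>Up to the constant \<open>measure \<nu> {1<..}\<close>, the local masses of \<open>levy_tail \<nu>\<close> and \<open>\<nu>\<close> agree.\<close>
  have ratio_iff: "((\<lambda>x. local_mass \<mu> c x / local_mass ?R c x) \<longlongrightarrow> ?\<kappa>) at_top \<longleftrightarrow>
      local_mass \<mu> c \<sim>[at_top] local_mass \<nu> c"
    if \<kappa>: "0 < ?\<kappa>" and lt: "long_tailed_fun (local_mass ?R c)" for c
  proof
    have ev: "\<forall>\<^sub>F x in at_top. ?\<kappa> * (local_mass \<mu> c x / local_mass \<nu> c x) = local_mass \<mu> c x / local_mass ?R c x"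
      using eventually_ge_at_top[of 1] by eventually_elim (use \<kappa> in \<open>simp add: levy_tail_mass(3)[OF lm \<kappa>]\<close>)
    {
      assume "((\<lambda>x. local_mass \<mu> c x / local_mass ?R c x) \<longlongrightarrow> ?\<kappa>) at_top"
      moreover have "\<forall>\<^sub>F x in at_top. local_mass \<mu> c x / local_mass ?R c x = ?\<kappa> * (local_mass \<mu> c x / local_mass \<nu> c x)"
        using ev by eventually_elim simp
      ultimately have "((\<lambda>x. ?\<kappa> * (local_mass \<mu> c x / local_mass \<nu> c x)) \<longlongrightarrow> ?\<kappa>) at_top"
        by (rule Lim_transform_eventually)
      from tendsto_mult[OF tendsto_const[of "1 / ?\<kappa>"] this]
      have "((\<lambda>x. local_mass \<mu> c x / local_mass \<nu> c x) \<longlongrightarrow> 1) at_top" using \<kappa> by simp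
      then show "local_mass \<mu> c \<sim>[at_top] local_mass \<nu> c" by (rule asymp_equivI')
    }
    assume "local_mass \<mu> c \<sim>[at_top] local_mass \<nu> c"
    from asymp_equiv_ratio[OF this nu_pos[OF \<kappa> lt]]
    have "((\<lambda>x. ?\<kappa> * (local_mass \<mu> c x / local_mass \<nu> c x)) \<longlongrightarrow> ?\<kappa> * 1) at_top" by (rule tendsto_mult_left)
    from Lim_transform_eventually[OF this ev]
    show "((\<lambda>x. local_mass \<mu> c x / local_mass ?R c x) \<longlongrightarrow> ?\<kappa>) at_top" by simp
  qed
  have ltR: "long_tailed_fun (local_mass ?R c)" if "?R \<in> L_loc" "c > 0" for c
    using that by (auto simp: L_loc_def L_Delta_def)
  have SL: "?R \<in> L_loc" if "?R \<in> S_loc" using that by (auto simp: S_loc_def S_Delta_def L_loc_def)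
  have ii_ratio: "((\<lambda>x. local_mass \<mu> c x / local_mass ?R c x) \<longlongrightarrow> ?\<kappa>) at_top"
    if "0 < ?\<kappa>" "?R \<in> S_loc \<inter> D_loc" "c > 0" for c
    using subexponential_levy_tail_imp_local_equivalence[OF mu hl that(1,3)] that(2,3) in_iff by blast
  have ii_i: "\<mu> \<in> S_loc \<inter> D_loc" if "0 < ?\<kappa>" "?R \<in> S_loc \<inter> D_loc"
    unfolding in_iff
  proof (intro allI impI)
    fix c :: real assume c: "c > 0"
    have "?R \<in> S_Delta c" "?R \<in> D_Delta c" using that(2) c in_iff by blast+
    from local_class_transfer[OF levy_tail_mass(1)[OF lm that(1)] mu c ii_ratio[OF that c] that(1) this]
    show "\<mu> \<in> S_Delta c \<inter> D_Delta c" .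
  qed
  have ii_iii: "?R \<in> L_loc \<inter> D_loc \<and> (\<forall>c>0. local_mass \<mu> c \<sim>[at_top] local_mass \<nu> c)"
    if "0 < ?\<kappa>" "?R \<in> S_loc \<inter> D_loc"
    using that SL ratio_iff[OF that(1) ltR] ii_ratio[OF that] by blast
  have iii_ii: "?R \<in> S_loc \<inter> D_loc"
    if \<kappa>: "0 < ?\<kappa>" and LD: "?R \<in> L_loc \<inter> D_loc" and eq: "\<forall>c>0. local_mass \<mu> c \<sim>[at_top] local_mass \<nu> c"
    unfolding in_iff
  proof (intro allI impI)
    fix c :: real assume c: "c > 0"
    have L: "?R \<in> L_Delta c" "?R \<in> L_Delta (2 * c)" and D: "?R \<in> D_Delta c" "?R \<in> D_Delta (2 * c)"
      using LD c by (auto simp: L_loc_def D_loc_def)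
    have "((\<lambda>x. local_mass \<mu> (2 * c) x / local_mass ?R (2 * c) x) \<longlongrightarrow> ?\<kappa>) at_top"
      using ratio_iff[OF \<kappa> ltR, of "2 * c"] LD eq c by auto
    from local_equivalence_imp_negligible_two_big_jumps[OF mu hl \<kappa> c L D(2) this]
    have "negligible_two_big_jumps ?R c" .
    moreover have "long_tailed_fun (local_mass ?R c)" "almost_decreasing (local_mass ?R c)"
      using L(1) D(1) by (auto simp: L_Delta_def D_Delta_def)
    ultimately show "?R \<in> S_Delta c \<inter> D_Delta c"
      using local_subexponential_iff[OF levy_tail_mass(1)[OF lm \<kappa>] c] L(1) D(1) by (auto simp: S_Delta_def)
  qed
  have i_pos: "0 < ?\<kappa>" if "\<mu> \<in> S_loc \<inter> D_loc"
  proof -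
    have "\<mu> \<in> S_Delta 1 \<inter> D_Delta 1" using that in_iff by (metis zero_less_one)
    then show ?thesis using levy_tail_charged[OF mu hl order_refl, of 1]
      by (auto simp: S_Delta_def L_Delta_def D_Delta_def)
  qed
  have i_ii: "?R \<in> S_loc \<inter> D_loc" if "\<mu> \<in> S_loc \<inter> D_loc"
    unfolding in_iff
  proof (intro allI impI)
    fix c :: real assume c: "c > 0"
    note \<kappa> = i_pos[OF that]
    have "\<mu> \<in> S_Delta c" "\<mu> \<in> D_Delta c" using that c in_iff by blast+
    moreover have "((\<lambda>x. local_mass ?R c x / local_mass \<mu> c x) \<longlongrightarrow> 1 / ?\<kappa>) at_top"
      using tendsto_mult[OF tendsto_const[of "1 / ?\<kappa>"] subexponential_imp_levy_tail_equivalence[OF mu hl c that]] \<kappa>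
      by (simp add: levy_tail_mass(2)[OF lm \<kappa>])
    ultimately show "?R \<in> S_Delta c \<inter> D_Delta c"
      using local_class_transfer[OF mu levy_tail_mass(1)[OF lm \<kappa>] c, of "1 / ?\<kappa>"] \<kappa> by simp
  qed
  show ?thesis unfolding pos_iff using i_pos i_ii ii_i ii_iii iii_ii by blast
qed

end
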